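(* Consider the mean field game described in the context. Suppose: (A) (Well-posedness and tightness) (1) for each measurable flow $\mu=(\mu_t)_{t\in[0,T]}$ of probability measures on $\mathcal B(\mathbb R)$ there exists a unique optimal pair $(X^\mu,\alpha^\mu)$ ($X^\mu$ unique up to indistinguishability, $\alpha^\mu$ unique up to $\mathbb P\otimes dt$-null sets); (2) there exist a continuous strictly increasing function $\psi:[0,\infty)\to[0,\infty)$ with $\lim_{s\to\infty}\psi(s)=\infty$ and a constant $M>\psi(0)$ such that $\mathbb E[\psi(|X^\mu_t|)]\le M$ for all measurable flows $\mu$ and all $t\in[0,T]$. (B) (Submodularity) For $\mathbb P\otimes dt$-a.a. $(\omega,t)\in\Omega\times[0,T]$, for $\phi\in\{f(\omega,t,\cdot,\cdot),g(\omega,\cdot,\cdot)\}$, $$\phi(\bar x,\bar\mu)-\phi(x,\bar\mu)\le\phi(\bar x,\mu)-\phi(x,\mu)$$ for all $\bar x,x\in\mathbb R$ and $\bar\mu,\mu\in\mathcal P(\mathbb R)$ with $\bar x\ge x$ and $\bar\mu\ge^{\rm st}\mu$. Then the set $\mathcal M$ of MFG solutions, ordered by $\le^{L}$, is a nonempty complete lattice. In particular, there exist a minimal and a maximal MFG solution.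
   Context: Control problem. Fix $T>0$ and a Brownian motion $W=(W_t)_{t\in[0,T]}$ on a complete filtered probability space $(\Omega,\mathcal F,(\mathcal F_t)_{t\in[0,T]},\mathbb P)$. Let $\xi\in L^2(\Omega,\mathcal F_0,\mathbb P)$ and let $(\sigma_t)_{t\in[0,T]}$ be a $[0,\infty)$-valued progressively measurable square integrable process (possibly vanishing on sets of positive measure). Let $U\subset\mathbb R$ be the control set and $\mathcal A$ the set of all square integrable progressively measurable processes $\alpha:\Omega\times[0,T]\to U$. Let $b:\Omega\times[0,T]\times\mathbb R\times U\to\mathbb R$ be measurable (progressively in $(\omega,t)$, jointly with $(x,a)$) such that, for some constant $C_1>0$ and all $(\omega,t,a)$ and $x,y$, $|b(\omega,t,x,a)-b(\omega,t,y,a)|\le C_1|x-y|$ and $|b(\omega,t,x,a)|\le C_1(1+|x|+|a|^2)$. For $\alpha\in\mathcal A$, $X^\alpha$ denotes the unique strong solution of $dX_t=b(t,X_t,\alpha_t)dt+\sigma_t dW_t$, $X_0=\xi$. $\mathcal P(\mathbb R)$ is the set of Borel probability measures on $\mathbb R$ with the topology of weak convergence and its Borel $\sigma$-algebra. Costs are measurable functions $f:\Omega\times[0,T]\times\mathbb R\times\mathcal P(\mathbb R)\to\mathbb R$, $l:\Omega\times[0,T]\times\mathbb R\times U\to\mathbb R$, $g:\Omega\times\mathbb R\times\mathcal P(\mathbb R)\to\mathbb R$, with $f,l$ progressively measurable in $(\omega,t)$ (jointly with the other variables) and $g(\cdot,x,\mu)$ $\mathcal F_T$-measurable. For a measurable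 flow $\mu=(\mu_t)_{t\in[0,T]}$ of probability measures, $$J(\alpha,\mu)=\mathbb E\Big[\int_0^T[f(t,X^\alpha_t,\mu_t)+l(t,X^\alpha_t,\alpha_t)]dt+g(X^\alpha_T,\mu_T)\Big],\quad\alpha\in\mathcal A,$$ the expectation being assumed well defined in $[-\infty,+\infty]$. A pair $(X^\mu,\alpha^\mu)$ with $\alpha^\mu\in\mathcal A$ is an optimal pair for $\mu$ if $-\infty<J(\alpha^\mu,\mu)\le J(\alpha,\mu)$ for all $\alpha\in\mathcal A$ and $X^\mu=X^{\alpha^\mu}$. Order. Write $\mu(s):=\mu(-\infty,s]$. First order stochastic dominance: $\mu\le^{\rm st}\nu$ iff $\mu(s)\ge\nu(s)$ for all $s\in\mathbb R$. Lattice $L$. Under (A)(2), extend $\psi$ by $\psi(s)=\psi(0)$ for $s<0$ and let $\mu^{\rm Min},\mu^{\rm Max}\in\mathcal P(\mathbb R)$ have distribution functions: $\mu^{\rm Min}(s)=1$ if $\psi(-s)\le M$ and $\mu^{\rm Min}(s)=M/\psi(-s)$ otherwise; $\mu^{\rm Max}(s)=0$ if $\psi(s)\le M$ and $\mu^{\rm Max}(s)=1-M/\psi(s)$ otherwise. Then $\mu^{\rm Min}\le^{\rm st}\mathbb P\circ X^\mu_t\le^{\rm st}\mu^{\rm Max}$ for all measurable flows $\mu$ and $t\in[0,T]$, where $\mathbb P\circ Z$ denotes the law of $Z$. Let $[\mu^{\rm Min},\mu^{\rm Max}]=\{\mu\in\mathcal P(\mathbb R):\mu^{\rm Min}\le^{\rm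 st}\mu\le^{\rm st}\mu^{\rm Max}\}$ and $\pi:=\delta_0+dt+\delta_T$ on $\mathcal B([0,T])$. $L$ is the set of $\pi$-equivalence classes of measurable flows $(\mu_t)_{t\in[0,T]}$ with $\mu_t\in[\mu^{\rm Min},\mu^{\rm Max}]$ for $\pi$-a.a. $t\in(0,T]$ and $\mu_0=\mathbb P\circ\xi$. Order on $L$: $\mu\le^{L}\nu$ iff $\mu_t\le^{\rm st}\nu_t$ for $\pi$-a.a. $t\in[0,T]$. Best-response-map $R:L\to L$: $R(\mu):=(\mathbb P\circ X^\mu_t)_{t\in[0,T]}$. An MFG solution is a fixed point of $R$, i.e. $\mu^*$ with $R(\mu^* )=\mu^*$. A partially ordered set is a complete lattice if each of its subsets has a least upper bound and a greatest lower bound in it. *)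

theory Defs
  imports "HOL-Probability.Probability" "HOL-Algebra.Complete_Lattice"
begin

section \<open>Probability measures on the line\<close>

abbreviation prob_measures :: "real measure set"
  where "prob_measures \<equiv> {\<mu>. prob_space \<mu> \<and> sets \<mu> = sets borel}"

definition weak_topology :: "real measure topology"
  where "weak_topology = topology_generated_by
    {{\<mu> \<in> prob_measures. (\<integral>x. h x \<partial>\<mu>) \<in> V} | (h :: real \<Rightarrow> real) V.
       continuous_on UNIV h \<and> bounded (range h) \<and> open V}"

definition weak_borel :: "real measure measure"
  where "weak_borel = sigma prob_measures {S. openin weak_topology S}"

definition st_le :: "real measure \<Rightarrow> real measure \<Rightarrow> bool"  (infix \<open>\<le>st\<close> 50)
  where "\<mu> \<le>st \<nu> \<longleftrightarrow> (\<forall>s. cdf \<nu> s \<le> cdf \<mu> s)"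

definition submodular :: "(real \<Rightarrow> real measure \<Rightarrow> real) \<Rightarrow> bool"
  where "submodular \<phi> \<longleftrightarrow>
    (\<forall>x y. \<forall>\<mu>\<in>prob_measures. \<forall>\<nu>\<in>prob_measures. x \<le> y \<longrightarrow> \<mu> \<le>st \<nu> \<longrightarrow>
       \<phi> y \<nu> - \<phi> x \<nu> \<le> \<phi> y \<mu> - \<phi> x \<mu>)"


section \<open>Extended-real-valued integrals\<close>

text \<open>The value is meaningful only if the positive and the negative part do not both have
  infinite integral, which is what \<open>ereal_integral_defined\<close> expresses.\<close>

definition ereal_integral :: "'b measure \<Rightarrow> ('b \<Rightarrow> ereal) \<Rightarrow> ereal"
  where "ereal_integral N h =
    enn2ereal (\<integral>\<^sup>+ x. e2ennreal (h x) \<partial>N) - enn2ereal (\<integral>\<^sup>+ x. e2ennreal (- h x) \<partial>N)"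

definition ereal_integral_defined :: "'b measure \<Rightarrow> ('b \<Rightarrow> ereal) \<Rightarrow> bool"
  where "ereal_integral_defined N h \<longleftrightarrow>
    (\<integral>\<^sup>+ x. e2ennreal (h x) \<partial>N) < \<infinity> \<or> (\<integral>\<^sup>+ x. e2ennreal (- h x) \<partial>N) < \<infinity>"


section \<open>Data of the control problem\<close>

text \<open>Processes and flows are total functions of the time \<open>t :: real\<close>; only their values on
  the interval \<open>{0..horizon G}\<close> are ever used. The same holds for the filtration.\<close>

record 'a mfg =
  pspace :: "'a measure"
  filt :: "real \<Rightarrow> 'a measure"
  horizon :: real
  bm :: "real \<Rightarrow> 'a \<Rightarrow> real"
  init :: "'a \<Rightarrow> real"
  vol :: "real \<Rightarrow> 'a \<Rightarrow> real"
  ctrl :: "real set"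
  drift :: "'a \<Rightarrow> real \<Rightarrow> real \<Rightarrow> real \<Rightarrow> real"
  cost_f :: "'a \<Rightarrow> real \<Rightarrow> real \<Rightarrow> real measure \<Rightarrow> real"
  cost_l :: "'a \<Rightarrow> real \<Rightarrow> real \<Rightarrow> real \<Rightarrow> real"
  cost_g :: "'a \<Rightarrow> real \<Rightarrow> real measure \<Rightarrow> real"

abbreviation time_set :: "'a mfg \<Rightarrow> real set"
  where "time_set G \<equiv> {0..horizon G}"

abbreviation time_leb :: "'a mfg \<Rightarrow> real measure"
  where "time_leb G \<equiv> restrict_space lborel (time_set G)"

abbreviation prob_time :: "'a mfg \<Rightarrow> ('a \<times> real) measure"
  where "prob_time G \<equiv> pspace G \<Otimes>\<^sub>M time_leb G"

definition prog_algebra :: "'a mfg \<Rightarrow> ('a \<times> real) measure"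
  where "prog_algebra G = sigma (space (pspace G) \<times> time_set G)
    {A. A \<subseteq> space (pspace G) \<times> time_set G \<and>
        (\<forall>t\<in>time_set G. A \<inter> (space (pspace G) \<times> {0..t})
           \<in> sets (filt G t \<Otimes>\<^sub>M restrict_space borel {0..t}))}"

definition square_integrable_prog :: "'a mfg \<Rightarrow> (real \<Rightarrow> 'a \<Rightarrow> real) \<Rightarrow> bool"
  where "square_integrable_prog G \<phi> \<longleftrightarrow>
    (\<lambda>(\<omega>, t). \<phi> t \<omega>) \<in> borel_measurable (prog_algebra G) \<and>
    integrable (prob_time G) (\<lambda>(\<omega>, t). (\<phi> t \<omega>)\<^sup>2)"

definition controls :: "'a mfg \<Rightarrow> (real \<Rightarrow> 'a \<Rightarrow> real) set"
  where "controls G = {\<alpha>. square_integrable_prog G \<alpha> \<and>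
    (\<forall>\<omega>\<in>space (pspace G). \<forall>t\<in>time_set G. \<alpha> t \<omega> \<in> ctrl G)}"

definition continuous_adapted :: "'a mfg \<Rightarrow> (real \<Rightarrow> 'a \<Rightarrow> real) \<Rightarrow> bool"
  where "continuous_adapted G X \<longleftrightarrow>
    (\<forall>t\<in>time_set G. X t \<in> borel_measurable (filt G t)) \<and>
    (\<forall>\<omega>\<in>space (pspace G). continuous_on (time_set G) (\<lambda>t. X t \<omega>))"

definition indistinguishable ::
    "'a mfg \<Rightarrow> (real \<Rightarrow> 'a \<Rightarrow> real) \<Rightarrow> (real \<Rightarrow> 'a \<Rightarrow> real) \<Rightarrow> bool"
  where "indistinguishable G X Y \<longleftrightarrow> (AE \<omega> in pspace G. \<forall>t\<in>time_set G. X t \<omega> = Y t \<omega>)"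

definition brownian_motion :: "'a mfg \<Rightarrow> bool"
  where "brownian_motion G \<longleftrightarrow>
    (\<forall>t\<in>time_set G. bm G t \<in> borel_measurable (filt G t)) \<and>
    (AE \<omega> in pspace G. bm G 0 \<omega> = 0) \<and>
    (AE \<omega> in pspace G. continuous_on (time_set G) (\<lambda>t. bm G t \<omega>)) \<and>
    (\<forall>s t. 0 \<le> s \<longrightarrow> s < t \<longrightarrow> t \<le> horizon G \<longrightarrow>
       distributed (pspace G) lborel (\<lambda>\<omega>. bm G t \<omega> - bm G s \<omega>) (normal_density 0 (sqrt (t - s))) \<and>
       prob_space.indep_set (pspace G) (sets (filt G s))
         {(\<lambda>\<omega>. bm G t \<omega> - bm G s \<omega>) -` B \<inter> space (pspace G) | B. B \<in> sets borel})"


section \<open>The Ito integral\<close>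

definition simple_process ::
    "'a mfg \<Rightarrow> nat \<Rightarrow> (nat \<Rightarrow> real) \<Rightarrow> (nat \<Rightarrow> 'a \<Rightarrow> real) \<Rightarrow> bool"
  where "simple_process G n \<tau> h \<longleftrightarrow>
    (\<forall>i\<le>n. \<tau> i \<in> time_set G) \<and> (\<forall>i<n. \<tau> i \<le> \<tau> (Suc i)) \<and>
    (\<forall>i<n. h i \<in> borel_measurable (filt G (\<tau> i)) \<and> bounded (h i ` space (pspace G)))"

definition simple_val :: "nat \<Rightarrow> (nat \<Rightarrow> real) \<Rightarrow> (nat \<Rightarrow> 'a \<Rightarrow> real) \<Rightarrow> real \<Rightarrow> 'a \<Rightarrow> real"
  where "simple_val n \<tau> h t \<omega> = (\<Sum>i<n. h i \<omega> * indicator {\<tau> i<..\<tau> (Suc i)} t)"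

definition simple_int ::
    "'a mfg \<Rightarrow> nat \<Rightarrow> (nat \<Rightarrow> real) \<Rightarrow> (nat \<Rightarrow> 'a \<Rightarrow> real) \<Rightarrow> real \<Rightarrow> 'a \<Rightarrow> real"
  where "simple_int G n \<tau> h t \<omega> =
    (\<Sum>i<n. h i \<omega> * (bm G (min t (\<tau> (Suc i))) \<omega> - bm G (min t (\<tau> i)) \<omega>))"

definition is_ito_integral :: "'a mfg \<Rightarrow> (real \<Rightarrow> 'a \<Rightarrow> real) \<Rightarrow> (real \<Rightarrow> 'a \<Rightarrow> real) \<Rightarrow> bool"
  where "is_ito_integral G \<phi> I \<longleftrightarrow> continuous_adapted G I \<and>
    (\<exists>n \<tau> h. (\<forall>k. simple_process G (n k) (\<tau> k) (h k)) \<and>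
       (\<lambda>k. \<integral>\<^sup>+ (\<omega>, t). ennreal ((simple_val (n k) (\<tau> k) (h k) t \<omega> - \<phi> t \<omega>)\<^sup>2) \<partial>prob_time G)
         \<longlonglongrightarrow> 0 \<and>
       (\<forall>t\<in>time_set G.
         (\<lambda>k. \<integral>\<^sup>+ \<omega>. ennreal ((simple_int G (n k) (\<tau> k) (h k) t \<omega> - I t \<omega>)\<^sup>2) \<partial>pspace G)
           \<longlonglongrightarrow> 0))"

text \<open>By the Ito isometry any two such integrals are indistinguishable; we fix one version.\<close>

definition ito_integral :: "'a mfg \<Rightarrow> (real \<Rightarrow> 'a \<Rightarrow> real) \<Rightarrow> real \<Rightarrow> 'a \<Rightarrow> real"
  where "ito_integral G \<phi> = (SOME I. is_ito_integral G \<phi> I)"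


section \<open>State equation, cost and optimal pairs\<close>

definition solves :: "'a mfg \<Rightarrow> (real \<Rightarrow> 'a \<Rightarrow> real) \<Rightarrow> (real \<Rightarrow> 'a \<Rightarrow> real) \<Rightarrow> bool"
  where "solves G \<alpha> X \<longleftrightarrow> continuous_adapted G X \<and>
    (AE \<omega> in pspace G. X 0 \<omega> = init G \<omega>) \<and>
    (AE \<omega> in pspace G. set_integrable lborel (time_set G) (\<lambda>s. drift G \<omega> s (X s \<omega>) (\<alpha> s \<omega>)) \<and>
       (\<forall>t\<in>time_set G. X t \<omega> = X 0 \<omega> + (LINT s:{0..t}|lborel. drift G \<omega> s (X s \<omega>) (\<alpha> s \<omega>))
          + ito_integral G (vol G) t \<omega>))"

text \<open>The process $X^\alpha$; solutions of the state equation are unique up to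
  indistinguishability, so the chosen version does not matter.\<close>

definition state :: "'a mfg \<Rightarrow> (real \<Rightarrow> 'a \<Rightarrow> real) \<Rightarrow> real \<Rightarrow> 'a \<Rightarrow> real"
  where "state G \<alpha> = (SOME X. solves G \<alpha> X)"

definition flows :: "'a mfg \<Rightarrow> (real \<Rightarrow> real measure) set"
  where "flows G = measurable (restrict_space borel (time_set G)) weak_borel"

definition running_cost ::
    "'a mfg \<Rightarrow> (real \<Rightarrow> 'a \<Rightarrow> real) \<Rightarrow> (real \<Rightarrow> real measure) \<Rightarrow> 'a \<Rightarrow> real \<Rightarrow> ereal"
  where "running_cost G \<alpha> \<mu> \<omega> t =
    ereal (cost_f G \<omega> t (state G \<alpha> t \<omega>) (\<mu> t) + cost_l G \<omega> t (state G \<alpha> t \<omega>) (\<alpha> t \<omega>))"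

definition total_cost ::
    "'a mfg \<Rightarrow> (real \<Rightarrow> 'a \<Rightarrow> real) \<Rightarrow> (real \<Rightarrow> real measure) \<Rightarrow> 'a \<Rightarrow> ereal"
  where "total_cost G \<alpha> \<mu> \<omega> = ereal_integral (time_leb G) (running_cost G \<alpha> \<mu> \<omega>)
    + ereal (cost_g G \<omega> (state G \<alpha> (horizon G) \<omega>) (\<mu> (horizon G)))"

definition expected_cost :: "'a mfg \<Rightarrow> (real \<Rightarrow> 'a \<Rightarrow> real) \<Rightarrow> (real \<Rightarrow> real measure) \<Rightarrow> ereal"
  where "expected_cost G \<alpha> \<mu> = ereal_integral (pspace G) (total_cost G \<alpha> \<mu>)"

definition expected_cost_defined :: "'a mfg \<Rightarrow> (real \<Rightarrow> 'a \<Rightarrow> real) \<Rightarrow> (real \<Rightarrow> real measure) \<Rightarrow> bool"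
  where "expected_cost_defined G \<alpha> \<mu> \<longleftrightarrow>
    (AE \<omega> in pspace G. ereal_integral_defined (time_leb G) (running_cost G \<alpha> \<mu> \<omega>)) \<and>
    ereal_integral_defined (pspace G) (total_cost G \<alpha> \<mu>)"

definition optimal_pair ::
    "'a mfg \<Rightarrow> (real \<Rightarrow> real measure) \<Rightarrow> (real \<Rightarrow> 'a \<Rightarrow> real) \<Rightarrow> (real \<Rightarrow> 'a \<Rightarrow> real) \<Rightarrow> bool"
  where "optimal_pair G \<mu> X \<alpha> \<longleftrightarrow> \<alpha> \<in> controls G \<and> solves G \<alpha> X \<and>
    - \<infinity> < expected_cost G \<alpha> \<mu> \<and> (\<forall>\<beta>\<in>controls G. expected_cost G \<alpha> \<mu> \<le> expected_cost G \<beta> \<mu>)"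

definition opt_state :: "'a mfg \<Rightarrow> (real \<Rightarrow> real measure) \<Rightarrow> real \<Rightarrow> 'a \<Rightarrow> real"
  where "opt_state G \<mu> = (SOME X. \<exists>\<alpha>. optimal_pair G \<mu> X \<alpha>)"


section \<open>Standing assumptions\<close>

locale mean_field_game =
  fixes G :: "'a mfg"
  assumes is_prob_space: "prob_space (pspace G)"
    and complete: "complete_measure (pspace G)"
    and horizon_pos: "0 < horizon G"
    and filt_subalgebra: "\<And>t. t \<in> time_set G \<Longrightarrow> subalgebra (pspace G) (filt G t)"
    and filt_mono: "\<And>s t. \<lbrakk>0 \<le> s; s \<le> t; t \<le> horizon G\<rbrakk> \<Longrightarrow> sets (filt G s) \<subseteq> sets (filt G t)"
    and filt_complete: "null_sets (pspace G) \<subseteq> sets (filt G 0)"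
    and brownian: "brownian_motion G"
    and init_measurable: "init G \<in> borel_measurable (filt G 0)"
    and init_square_integrable: "integrable (pspace G) (\<lambda>\<omega>. (init G \<omega>)\<^sup>2)"
    and vol_square_integrable: "square_integrable_prog G (vol G)"
    and vol_nonneg: "\<And>\<omega> t. \<lbrakk>\<omega> \<in> space (pspace G); t \<in> time_set G\<rbrakk> \<Longrightarrow> 0 \<le> vol G t \<omega>"
    and drift_measurable: "(\<lambda>((\<omega>, t), x, a). drift G \<omega> t x a)
      \<in> borel_measurable (prog_algebra G \<Otimes>\<^sub>M (borel \<Otimes>\<^sub>M restrict_space borel (ctrl G)))"
    and drift_bounds: "\<exists>C>0. \<forall>\<omega>\<in>space (pspace G). \<forall>t\<in>time_set G. \<forall>a\<in>ctrl G. \<forall>x y.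
      \<bar>drift G \<omega> t x a - drift G \<omega> t y a\<bar> \<le> C * \<bar>x - y\<bar> \<and>
      \<bar>drift G \<omega> t x a\<bar> \<le> C * (1 + \<bar>x\<bar> + \<bar>a\<bar>\<^sup>2)"
    and cost_f_measurable: "(\<lambda>((\<omega>, t), x, m). cost_f G \<omega> t x m)
      \<in> borel_measurable (prog_algebra G \<Otimes>\<^sub>M (borel \<Otimes>\<^sub>M weak_borel))"
    and cost_l_measurable: "(\<lambda>((\<omega>, t), x, a). cost_l G \<omega> t x a)
      \<in> borel_measurable (prog_algebra G \<Otimes>\<^sub>M (borel \<Otimes>\<^sub>M restrict_space borel (ctrl G)))"
    and cost_g_measurable: "(\<lambda>(\<omega>, x, m). cost_g G \<omega> x m)
      \<in> borel_measurable (pspace G \<Otimes>\<^sub>M (borel \<Otimes>\<^sub>M weak_borel))"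
    and cost_g_terminal: "\<And>x m. m \<in> prob_measures \<Longrightarrow>
      (\<lambda>\<omega>. cost_g G \<omega> x m) \<in> borel_measurable (filt G (horizon G))"
    and cost_well_defined: "\<And>\<alpha> \<mu>. \<lbrakk>\<alpha> \<in> controls G; \<mu> \<in> flows G\<rbrakk> \<Longrightarrow> expected_cost_defined G \<alpha> \<mu>"


section \<open>The lattice of flows and the best-response map\<close>

definition ext_left :: "(real \<Rightarrow> real) \<Rightarrow> real \<Rightarrow> real"
  where "ext_left \<psi> s = (if s < 0 then \<psi> 0 else \<psi> s)"

definition mu_Min :: "(real \<Rightarrow> real) \<Rightarrow> real \<Rightarrow> real measure"
  where "mu_Min \<psi> M = interval_measure
    (\<lambda>s. if ext_left \<psi> (- s) \<le> M then 1 else M / ext_left \<psi> (- s))"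

definition mu_Max :: "(real \<Rightarrow> real) \<Rightarrow> real \<Rightarrow> real measure"
  where "mu_Max \<psi> M = interval_measure
    (\<lambda>s. if ext_left \<psi> s \<le> M then 0 else 1 - M / ext_left \<psi> s)"

text \<open>The measure $\delta_0 + dt + \delta_T$ on the Borel sets of $[0,T]$.\<close>

definition time_pi :: "'a mfg \<Rightarrow> real measure"
  where "time_pi G = measure_of (time_set G) (sets (restrict_space borel (time_set G)))
    (\<lambda>A. indicator A 0 + emeasure lborel A + indicator A (horizon G))"

definition flow_eq :: "'a mfg \<Rightarrow> (real \<Rightarrow> real measure) rel"
  where "flow_eq G =
    {(\<mu>, \<nu>). \<mu> \<in> flows G \<and> \<nu> \<in> flows G \<and> (AE t in time_pi G. \<mu> t = \<nu> t)}"

definition flow_lattice :: "'a mfg \<Rightarrow> (real \<Rightarrow> real) \<Rightarrow> real \<Rightarrow> (real \<Rightarrow> real measure) set set"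
  where "flow_lattice G \<psi> M =
    {\<mu> \<in> flows G. \<mu> 0 = distr (pspace G) borel (init G) \<and>
       (AE t in time_pi G. 0 < t \<longrightarrow> mu_Min \<psi> M \<le>st \<mu> t \<and> \<mu> t \<le>st mu_Max \<psi> M)} // flow_eq G"

definition flow_lattice_le :: "'a mfg \<Rightarrow> (real \<Rightarrow> real measure) set \<Rightarrow> (real \<Rightarrow> real measure) set \<Rightarrow> bool"
  where "flow_lattice_le G c d \<longleftrightarrow> (\<forall>\<mu>\<in>c. \<forall>\<nu>\<in>d. AE t in time_pi G. \<mu> t \<le>st \<nu> t)"

text \<open>The union below is over representatives of the class \<open>c\<close>; each of them contributes the
  same class, since $\pi$-equivalent flows have the same costs and optimal pairs.\<close>

definition best_response :: "'a mfg \<Rightarrow> (real \<Rightarrow> real measure) set \<Rightarrow> (real \<Rightarrow> real measure) set"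
  where "best_response G c = (\<Union>\<mu>\<in>c. flow_eq G `` {\<lambda>t. distr (pspace G) borel (opt_state G \<mu> t)})"

definition mfg_solutions ::
    "'a mfg \<Rightarrow> (real \<Rightarrow> real) \<Rightarrow> real \<Rightarrow> (real \<Rightarrow> real measure) set set"
  where "mfg_solutions G \<psi> M = {c \<in> flow_lattice G \<psi> M. best_response G c = c}"

definition mfg_solution_order ::
    "'a mfg \<Rightarrow> (real \<Rightarrow> real) \<Rightarrow> real \<Rightarrow> (real \<Rightarrow> real measure) set gorder"
  where "mfg_solution_order G \<psi> M =
    \<lparr>carrier = mfg_solutions G \<psi> M, eq = (=), le = flow_lattice_le G\<rparr>"

end

theory Submission
  imports Defs
begin

text \<open>Stochastic dominance of flows makes every class of admissible flows a complete lattice, and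
  submodularity makes the best-response map monotone on it; the fixed points of a monotone
  self-map of a complete lattice form a nonempty complete lattice by the theorem of Knaster
  and Tarski. The two halves of the argument are independent of each other.

  \<^bold>\<open>The lattice\<close> (\<open>complete_lattice_flow_order\<close>). At one instant, the infimum of countably
  many laws for stochastic dominance has as distribution function the right-continuous version of
  the supremum of their distribution functions; the bounds \<open>mu_Min\<close> and \<open>mu_Max\<close> keep it from
  losing mass at infinity. For an arbitrary set of flows a pointwise infimum need not be
  measurable in time, but flows are only compared almost everywhere, so essential suprema of
  the distribution functions at rational points are enough, and these are attained along a single
  sequence (\<open>essential_sup_sequence_simultaneous\<close>). A family of laws is Borel measurable for the
  weak topology as soon as its distribution functions at rational points are
  (\<open>measurable_weak_borel_if_rational_cdf\<close>), which makes the infimum a flow again.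

  \<^bold>\<open>Monotonicity\<close> (\<open>optimal_states_mono\<close>). Let \<open>(X, \<alpha>)\<close> be optimal for \<open>\<mu>\<close> and \<open>(Y, \<beta>)\<close>
  for a larger flow \<open>\<nu>\<close>. Both states are driven by the same noise, which cancels in \<open>X - Y\<close>;
  so \<open>X - Y\<close> is an indefinite integral, and the formula for its positive part
  (\<open>positive_part_indefinite_integral\<close>) shows that \<open>max X Y\<close> and \<open>min X Y\<close> are themselves
  controlled states: their controls use \<open>\<alpha>\<close> or \<open>\<beta>\<close> according to which of the two states is
  larger (\<open>solves_max_min\<close>). With these controls, submodularity yields, path by path and then in
  expectation (\<open>expected_cost_exchange\<close>),
  \[ J(\max, \nu) + J(\min, \mu) \le J(\alpha, \mu) + J(\beta, \nu). \]
  Since \<open>\<beta>\<close> is optimal for \<open>\<nu>\<close>, the control of \<open>min X Y\<close> costs no more than \<open>\<alpha>\<close> for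
  \<open>\<mu>\<close>, so it is optimal as well; uniqueness of the optimal pair gives \<open>min X Y = X\<close>, that is,
  \<open>X \<le> Y\<close>. The laws inherit this order.\<close>

section \<open>Pathwise calculus for absolutely continuous functions\<close>

lemma set_integrable_Icc_subset:
  fixes r :: "real \<Rightarrow> real"
  assumes "set_integrable lborel {0..T} r" "0 \<le> u" "v \<le> T"
  shows "set_integrable lborel {u..v} r"
  by (rule set_integrable_subset[OF assms(1)]) (use assms in auto)

lemma set_integral_Icc_split:
  fixes r :: "real \<Rightarrow> real"
  assumes r: "set_integrable lborel {a..c} r" and "a \<le> b" "b \<le> c"
  shows "(LINT s:{a..c}|lborel. r s) = (LINT s:{a..b}|lborel. r s) + (LINT s:{b..c}|lborel. r s)"
proof -
  have eq: "{a..c} = {a..b} \<union> {b<..c}" using assms by auto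
  have "(LINT s:{a..c}|lborel. r s) = (LINT s:{a..b}|lborel. r s) + (LINT s:{b<..c}|lborel. r s)"
    unfolding eq by (rule set_integral_Un; (rule set_integrable_subset[OF r])?) (use assms in auto)
  also have "(LINT s:{b<..c}|lborel. r s) = (LINT s:{b..c}|lborel. r s)"
    unfolding set_lebesgue_integral_def
  proof (rule integral_cong_AE)
    have *: "set_integrable lborel {b..c} r" "set_integrable lborel {b<..c} r"
      by (rule set_integrable_subset[OF r]; use assms in auto)+
    show "(\<lambda>x. indicat_real {b<..c} x *\<^sub>R r x) \<in> borel_measurable lborel"
      "(\<lambda>x. indicat_real {b..c} x *\<^sub>R r x) \<in> borel_measurable lborel"
      using *[unfolded set_integrable_def] by (auto dest: borel_measurable_integrable)
    have "AE x in lborel. x \<noteq> b" by (rule AE_lborel_singleton)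
    then show "AE x in lborel. indicat_real {b<..c} x *\<^sub>R r x = indicat_real {b..c} x *\<^sub>R r x"
      by eventually_elim (auto simp: indicator_def)
  qed
  finally show ?thesis .
qed

lemma set_integrable_continuous_mult:
  fixes r p :: "real \<Rightarrow> real"
  assumes r: "set_integrable lborel {a..b} r" and p: "continuous_on {a..b} p"
  shows "set_integrable lborel {a..b} (\<lambda>s. p s * r s)"
proof -
  have "bounded (p ` {a..b})" by (intro compact_imp_bounded compact_continuous_image p compact_Icc)
  then obtain B where B: "\<And>s. s \<in> {a..b} \<Longrightarrow> \<bar>p s\<bar> \<le> B"
    unfolding bounded_iff by (metis image_eqI real_norm_def)
  have m: "(\<lambda>s. indicator {a..b} s *\<^sub>R p s) \<in> borel_measurable borel"
    by (rule borel_measurable_continuous_on_indicator[OF _ p]) auto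
  have i: "integrable lborel (\<lambda>s. indicator {a..b} s *\<^sub>R r s)"
    using r by (simp add: set_integrable_def)
  have "integrable lborel (\<lambda>s. (indicator {a..b} s *\<^sub>R p s) * (indicator {a..b} s *\<^sub>R r s))"
  proof (rule Bochner_Integration.integrable_bound[OF integrable_mult_right[OF i, of B]])
    show "(\<lambda>s. (indicator {a..b} s *\<^sub>R p s) * (indicator {a..b} s *\<^sub>R r s)) \<in> borel_measurable lborel"
      using m borel_measurable_integrable[OF i] by measurable
    have "norm ((indicator {a..b} s *\<^sub>R p s) * (indicator {a..b} s *\<^sub>R r s))
        \<le> norm (B * (indicator {a..b} s *\<^sub>R r s))" for s
      using B[of s] by (auto simp: indicator_def abs_mult intro!: mult_right_mono)
    then show "AE s in lborel. norm ((indicator {a..b} s *\<^sub>R p s) * (indicator {a..b} s *\<^sub>R r s))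
        \<le> norm (B * (indicator {a..b} s *\<^sub>R r s))"
      by simp
  qed
  then show ?thesis
    unfolding set_integrable_def by (rule Bochner_Integration.integrable_cong[THEN iffD1, rotated -1]) (auto simp: indicator_def)
qed

text \<open>An indefinite integral need not be differentiable at a given point. The defect of the
  claimed identity over an interval is, however, additive over adjacent intervals, and by the mean
  value theorem it is at most \<open>e\<close> times the integral of \<open>\<bar>r\<bar>\<close> over every sufficiently short one.
  Bisection carries this bound to the whole interval, and \<open>e\<close> is arbitrary.\<close>

lemma chain_rule_indefinite_integral:
  fixes d r \<phi> \<phi>' :: "real \<Rightarrow> real"
  assumes r: "set_integrable lborel {0..T} r" and d: "continuous_on {0..T} d"
    and d_eq: "\<And>t. t \<in> {0..T} \<Longrightarrow> d t = d 0 + (LINT s:{0..t}|lborel. r s)"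
    and \<phi>: "\<And>x. (\<phi> has_real_derivative \<phi>' x) (at x)" and \<phi>': "continuous_on UNIV \<phi>'"
    and t: "t \<in> {0..T}"
  shows "\<phi> (d t) = \<phi> (d 0) + (LINT s:{0..t}|lborel. \<phi>' (d s) * r s)"
proof -
  have cd: "continuous_on {0..T} (\<lambda>s. \<phi>' (d s))"
    by (rule continuous_on_compose2[OF \<phi>' d]) auto
  have incr: "d v - d u = (LINT s:{u..v}|lborel. r s)" if "0 \<le> u" "u \<le> v" "v \<le> T" for u v
    using that d_eq[of u] d_eq[of v] set_integral_Icc_split[of 0 v r u]
      set_integrable_Icc_subset[OF r, of 0 v] by auto
  have r': "set_integrable lborel {u..v} r" "set_integrable lborel {u..v} (\<lambda>s. \<bar>r s\<bar>)"
     "set_integrable lborel {u..v} (\<lambda>s. \<phi>' (d s) * r s)" if "0 \<le> u" "v \<le> T" for u v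
  proof -
    show "set_integrable lborel {u..v} r" by (rule set_integrable_Icc_subset[OF r that])
    then show "set_integrable lborel {u..v} (\<lambda>s. \<bar>r s\<bar>)"
      by (rule set_integrable_abs)
    show "set_integrable lborel {u..v} (\<lambda>s. \<phi>' (d s) * r s)"
      by (rule set_integrable_Icc_subset[OF set_integrable_continuous_mult[OF r cd] that])
  qed
  define E where "E u v = \<phi> (d v) - \<phi> (d u) - (LINT s:{u..v}|lborel. \<phi>' (d s) * r s)" for u v
  define R where "R u v = (LINT s:{u..v}|lborel. \<bar>r s\<bar>)" for u v
  have main: "\<bar>E 0 t\<bar> \<le> e * R 0 t" if e: "e > 0" for e
  proof -
    define P where "P u v \<longleftrightarrow> (0 \<le> u \<and> u \<le> v \<and> v \<le> T \<longrightarrow> \<bar>E u v\<bar> \<le> e * R u v)" for u v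
    have "0 \<le> t" using t by auto
    then have "P 0 t"
    proof (induct rule: Bolzano)
      case (trans a b c)
      show ?case unfolding P_def
      proof (intro impI)
        assume *: "0 \<le> a \<and> a \<le> c \<and> c \<le> T"
        have "E a c = E a b + E b c"
          using trans(3,4) * unfolding E_def by (subst set_integral_Icc_split[of a c _ b]) (auto intro: r')
        moreover have "R a c = R a b + R b c"
          using trans(3,4) * unfolding R_def by (subst set_integral_Icc_split[of a c _ b]) (auto intro: r')
        ultimately show "\<bar>E a c\<bar> \<le> e * R a c"
          using trans * unfolding P_def by (auto simp: algebra_simps)
      qed
    next
      case (local x)
      then have x: "x \<in> {0..T}" using t by auto
      have "isCont \<phi>' (d x)" using \<phi>' by (simp add: continuous_on_eq_continuous_at)
      then obtain \<eta> where \<eta>: "\<eta> > 0" "\<And>z. \<bar>z - d x\<bar> < \<eta> \<Longrightarrow> \<bar>\<phi>' z - \<phi>' (d x)\<bar> < e / 2"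
        using e unfolding continuous_at_eps_delta by (metis half_gt_zero real_norm_def dist_real_def)
      obtain \<delta> where \<delta>: "\<delta> > 0" "\<And>s. s \<in> {0..T} \<Longrightarrow> \<bar>s - x\<bar> < \<delta> \<Longrightarrow> \<bar>d s - d x\<bar> < \<eta>"
        using d x \<eta>(1) unfolding continuous_on_iff by (metis dist_real_def)
      have "\<bar>E a b\<bar> \<le> e * R a b" if ab: "a \<le> x" "x \<le> b" "b - a < \<delta>" "0 \<le> a" "b \<le> T" for a b
      proof -
        have near: "\<bar>d s - d x\<bar> < \<eta>" if "s \<in> {a..b}" for s
          using \<delta>(2)[of s] that ab by auto
        have "\<exists>z. \<bar>z - d x\<bar> < \<eta> \<and> \<phi> (d b) - \<phi> (d a) = \<phi>' z * (d b - d a)"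
        proof -
          consider "d a < d b" | "d b < d a" | "d a = d b" by linarith
          then show ?thesis
          proof cases
            case 1
            from MVT2[OF 1, of \<phi> \<phi>'] \<phi> obtain z where "d a < z" "z < d b"
              "\<phi> (d b) - \<phi> (d a) = (d b - d a) * \<phi>' z" by auto
            moreover have "\<bar>z - d x\<bar> < \<eta>" using calculation near[of a] near[of b] ab by auto
            ultimately show ?thesis by (auto simp: mult.commute)
          next
            case 2
            from MVT2[OF 2, of \<phi> \<phi>'] \<phi> obtain z where "d b < z" "z < d a"
              "\<phi> (d a) - \<phi> (d b) = (d a - d b) * \<phi>' z" by auto
            moreover have "\<bar>z - d x\<bar> < \<eta>" using calculation near[of a] near[of b] ab by auto
            ultimately show ?thesis by (intro exI[of _ z]) (auto simp: algebra_simps)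
          next
            case 3
            then show ?thesis using \<eta>(1) by (intro exI[of _ "d x"]) auto
          qed
        qed
        then obtain z where z: "\<bar>z - d x\<bar> < \<eta>" "\<phi> (d b) - \<phi> (d a) = \<phi>' z * (d b - d a)"
          by blast
        have close: "\<bar>\<phi>' z - \<phi>' (d s)\<bar> \<le> e" if "s \<in> {a..b}" for s
          using \<eta>(2)[OF z(1)] \<eta>(2)[OF near[OF that]] by linarith
        have rab: "set_integrable lborel {a..b} r" using r' ab by auto
        have dint: "set_integrable lborel {a..b} (\<lambda>s. \<phi>' z * r s - \<phi>' (d s) * r s)"
          using rab r'(3)[of a b] ab by (intro set_integral_diff(1)) auto
        have "E a b = (LINT s:{a..b}|lborel. \<phi>' z * r s) - (LINT s:{a..b}|lborel. \<phi>' (d s) * r s)"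
          unfolding E_def z(2) using incr[of a b] ab by simp
        also have "\<dots> = (LINT s:{a..b}|lborel. \<phi>' z * r s - \<phi>' (d s) * r s)"
          using ab by (subst set_integral_diff(2)) (auto intro: r' rab)
        also have "\<bar>(LINT s:{a..b}|lborel. \<phi>' z * r s - \<phi>' (d s) * r s)\<bar> \<le> (LINT s:{a..b}|lborel. \<bar>\<phi>' z * r s - \<phi>' (d s) * r s\<bar>)"
          using set_integral_norm_bound[of lborel "{a..b}" "\<lambda>s. \<phi>' z * r s - \<phi>' (d s) * r s"] dint by simp
        also have "\<dots> \<le> (LINT s:{a..b}|lborel. e * \<bar>r s\<bar>)"
        proof (rule set_integral_mono)
          show "set_integrable lborel {a..b} (\<lambda>s. \<bar>\<phi>' z * r s - \<phi>' (d s) * r s\<bar>)"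
            by (rule set_integrable_abs[OF dint])
          show "set_integrable lborel {a..b} (\<lambda>s. e * \<bar>r s\<bar>)" using r'(2)[of a b] ab by auto
          show "\<bar>\<phi>' z * r s - \<phi>' (d s) * r s\<bar> \<le> e * \<bar>r s\<bar>" if "s \<in> {a..b}" for s
            using mult_right_mono[OF close[OF that], of "\<bar>r s\<bar>"]
            by (simp add: abs_mult[symmetric] left_diff_distrib)
        qed
        also have "\<dots> = e * R a b" by (simp add: R_def)
        finally show ?thesis .
      qed
      then show ?case using \<delta>(1) unfolding P_def by (intro exI[of _ \<delta>]) auto
    qed
    then show ?thesis using t by (auto simp: P_def)
  qed
  have "\<bar>E 0 t\<bar> \<le> 0"
  proof (rule field_le_epsilon)
    fix e :: real assume e: "0 < e"
    have "R 0 t \<ge> 0" unfolding R_def set_lebesgue_integral_def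
      by (intro Bochner_Integration.integral_nonneg) auto
    then have "e / (R 0 t + 1) * R 0 t \<le> e"
      using e by (simp add: field_simps)
    then show "\<bar>E 0 t\<bar> \<le> 0 + e" using main[of "e / (R 0 t + 1)"] \<open>R 0 t \<ge> 0\<close> e by auto
  qed
  then show ?thesis by (simp add: E_def)
qed

text \<open>The chain rule is applied to smooth approximations of the positive part whose derivatives
  converge everywhere, also at the corner, to the indicator of the positive half-line.\<close>

lemma positive_part_indefinite_integral:
  fixes d r :: "real \<Rightarrow> real"
  assumes r: "set_integrable lborel {0..T} r" and d: "continuous_on {0..T} d" and d0: "d 0 = 0"
    and d_eq: "\<And>t. t \<in> {0..T} \<Longrightarrow> d t = (LINT s:{0..t}|lborel. r s)"
    and t: "t \<in> {0..T}"
  shows "max 0 (d t) = (LINT s:{0..t}|lborel. if 0 < d s then r s else 0)"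
proof -
  define \<epsilon> where "\<epsilon> n = inverse (real (Suc n))" for n
  have \<epsilon>: "\<epsilon> n > 0" "\<epsilon> n \<noteq> 0" for n by (auto simp: \<epsilon>_def)
  have \<epsilon>0: "\<epsilon> \<longlonglongrightarrow> 0" unfolding \<epsilon>_def by (rule LIMSEQ_inverse_real_of_nat)
  \<comment> \<open>The square root approximates the absolute value and its
    derivative tends to the sign function. The arctangent term vanishes in the limit, but its derivative
    tends to the indicator of \<open>{0}\<close>; it lowers the limit of the derivatives at \<open>0\<close> from \<open>1/2\<close> to \<open>0\<close>.\<close>
  define \<phi> where "\<phi> n x = (x + sqrt (x\<^sup>2 + (\<epsilon> n)\<^sup>2) - \<epsilon> n - \<epsilon> n * arctan (x / \<epsilon> n)) / 2" for n x
  define \<phi>' where "\<phi>' n x = (1 + x / sqrt (x\<^sup>2 + (\<epsilon> n)\<^sup>2) - 1 / (1 + (x / \<epsilon> n)\<^sup>2)) / 2" for n x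
  have pos: "x\<^sup>2 + (\<epsilon> n)\<^sup>2 > 0" for x n using \<epsilon>[of n] by (simp add: sum_power2_gt_zero_iff)
  have der: "(\<phi> n has_real_derivative \<phi>' n x) (at x)" for n x
    unfolding \<phi>_def[abs_def] \<phi>'_def
    using pos[of x n] \<epsilon>[of n]
    by (auto intro!: derivative_eq_intros simp: divide_simps) (simp add: algebra_simps)
  have nz: "1 + (x / \<epsilon> n)\<^sup>2 \<noteq> 0" for x n
    using zero_le_power2[of "x / \<epsilon> n"] by linarith
  have cont: "continuous_on UNIV (\<phi>' n)" for n
    unfolding \<phi>'_def[abs_def] using pos[of _ n] nz[of _ n] \<epsilon>[of n]
    by (intro continuous_intros) (auto simp: less_imp_neq[THEN not_sym])
  have bd: "\<bar>\<phi>' n x\<bar> \<le> 2" for n x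
  proof -
    have "\<bar>x\<bar> \<le> sqrt (x\<^sup>2 + (\<epsilon> n)\<^sup>2)"
      by (rule real_le_rsqrt) simp
    then have "\<bar>x / sqrt (x\<^sup>2 + (\<epsilon> n)\<^sup>2)\<bar> \<le> 1" using pos[of x n] by (simp add: abs_divide)
    moreover have "1 / (1 + y\<^sup>2) \<in> {0..1}" for y :: real
      by (simp add: divide_le_eq_1 add_pos_nonneg add_nonneg_nonneg)
    then have "0 \<le> 1 / (1 + (x / \<epsilon> n)\<^sup>2)" "1 / (1 + (x / \<epsilon> n)\<^sup>2) \<le> 1"
      by (meson atLeastAtMost_iff)+
    moreover have "\<bar>(1 + p - q) / 2\<bar> \<le> 2" if "\<bar>p\<bar> \<le> 1" "0 \<le> q" "q \<le> 1" for p q :: real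
      using that by (simp add: abs_le_iff)
    ultimately show ?thesis unfolding \<phi>'_def by blast
  qed
  have lim: "(\<lambda>n. \<phi>' n x) \<longlonglongrightarrow> (if 0 < x then 1 else 0)" for x
  proof (cases "x = 0")
    case True then show ?thesis by (simp add: \<phi>'_def)
  next
    case False
    have "(\<lambda>n. x / sqrt (x\<^sup>2 + (\<epsilon> n)\<^sup>2)) \<longlonglongrightarrow> x / sqrt (x\<^sup>2 + 0\<^sup>2)"
      by (intro tendsto_intros \<epsilon>0) (use False in auto)
    then have 1: "(\<lambda>n. x / sqrt (x\<^sup>2 + (\<epsilon> n)\<^sup>2)) \<longlonglongrightarrow> sgn x"
      using False by (simp add: sgn_real_def abs_if split: if_splits)
    have "(\<lambda>n. (\<epsilon> n)\<^sup>2 / ((\<epsilon> n)\<^sup>2 + x\<^sup>2)) \<longlonglongrightarrow> 0\<^sup>2 / (0\<^sup>2 + x\<^sup>2)"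
      by (intro tendsto_intros \<epsilon>0) (use False in auto)
    moreover have "(\<epsilon> n)\<^sup>2 / ((\<epsilon> n)\<^sup>2 + x\<^sup>2) = 1 / (1 + (x / \<epsilon> n)\<^sup>2)" for n
      using \<epsilon>[of n] by (simp add: field_simps)
    ultimately have 2: "(\<lambda>n. 1 / (1 + (x / \<epsilon> n)\<^sup>2)) \<longlonglongrightarrow> 0" by simp
    have "(\<lambda>n. \<phi>' n x) \<longlonglongrightarrow> (1 + sgn x - 0) / 2"
      unfolding \<phi>'_def by (intro tendsto_intros 1 2) auto
    then show ?thesis using False by (auto simp: sgn_real_def)
  qed
  have lim\<phi>: "(\<lambda>n. \<phi> n (d t)) \<longlonglongrightarrow> max 0 (d t)"
  proof -
    have "(\<lambda>n. \<epsilon> n * arctan (d t / \<epsilon> n)) \<longlonglongrightarrow> 0"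
    proof (rule lim_null_mult_right_bounded[OF \<epsilon>0])
      have "norm (arctan y) \<le> pi / 2" for y
        using arctan_lbound[of y] arctan_ubound[of y] unfolding real_norm_def abs_le_iff by linarith
      then show "\<forall>\<^sub>F n in sequentially. norm (arctan (d t / \<epsilon> n)) \<le> pi / 2"
        by (intro always_eventually allI)
    qed
    then have "(\<lambda>n. \<phi> n (d t)) \<longlonglongrightarrow> (d t + sqrt ((d t)\<^sup>2 + 0\<^sup>2) - 0 - 0) / 2"
      unfolding \<phi>_def by (intro tendsto_intros \<epsilon>0) auto
    then show ?thesis by (simp add: max_def abs_if split: if_splits)
  qed
  have cd: "continuous_on {0..T} (\<lambda>s. \<phi>' n (d s))" for n
    by (rule continuous_on_compose2[OF cont d]) auto
  have int_n: "set_integrable lborel {0..t} (\<lambda>s. \<phi>' n (d s) * r s)" for n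
    by (rule set_integrable_Icc_subset[OF set_integrable_continuous_mult[OF r cd]]) (use t in auto)
  have rt: "set_integrable lborel {0..t} r" by (rule set_integrable_Icc_subset[OF r]) (use t in auto)
  have ds: "{s \<in> {0..t}. 0 < d s} \<in> sets borel"
  proof -
    have "continuous_on {0..t} d" by (rule continuous_on_subset[OF d]) (use t in auto)
    then have [measurable]: "(\<lambda>s. indicator {0..t} s *\<^sub>R d s) \<in> borel_measurable borel"
      by (intro borel_measurable_continuous_on_indicator) auto
    have "{s \<in> {0..t}. 0 < d s} = {s \<in> space borel. 0 < indicator {0..t} s *\<^sub>R d s}"
      by (auto simp: indicator_def split: if_splits)
    also have "\<dots> \<in> sets borel" by measurable
    finally show ?thesis .
  qed
  have "(\<lambda>n. LINT s:{0..t}|lborel. \<phi>' n (d s) * r s) \<longlonglongrightarrow> (LINT s:{0..t}|lborel. if 0 < d s then r s else 0)"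
    unfolding set_lebesgue_integral_def
  proof (rule integral_dominated_convergence[where w="\<lambda>s. 2 * \<bar>indicator {0..t} s *\<^sub>R r s\<bar>"])
    have mr: "(\<lambda>s. indicator {0..t} s *\<^sub>R r s) \<in> borel_measurable lborel"
      using rt unfolding set_integrable_def by auto
    have "(\<lambda>s. indicator {s\<in>{0..t}. 0 < d s} s *\<^sub>R (indicator {0..t} s *\<^sub>R r s)) \<in> borel_measurable lborel"
      using ds mr by measurable
    then show "(\<lambda>s. indicator {0..t} s *\<^sub>R (if 0 < d s then r s else 0)) \<in> borel_measurable lborel"
      by (rule measurable_cong[THEN iffD1, rotated]) (auto simp: indicator_def)
    show "(\<lambda>s. indicator {0..t} s *\<^sub>R (\<phi>' n (d s) * r s)) \<in> borel_measurable lborel" for n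
      using int_n[of n] unfolding set_integrable_def by auto
    show "integrable lborel (\<lambda>s. 2 * \<bar>indicat_real {0..t} s *\<^sub>R r s\<bar>)"
      using rt unfolding set_integrable_def by auto
    show "AE s in lborel. (\<lambda>n. indicat_real {0..t} s *\<^sub>R (\<phi>' n (d s) * r s))
        \<longlonglongrightarrow> indicat_real {0..t} s *\<^sub>R (if 0 < d s then r s else 0)"
    proof (rule AE_I2)
      fix s :: real
      have "(\<lambda>n. indicat_real {0..t} s *\<^sub>R (\<phi>' n (d s) * r s))
        \<longlonglongrightarrow> indicat_real {0..t} s *\<^sub>R ((if 0 < d s then 1 else 0) * r s)"
        by (intro tendsto_intros lim)
      then show "(\<lambda>n. indicat_real {0..t} s *\<^sub>R (\<phi>' n (d s) * r s))
        \<longlonglongrightarrow> indicat_real {0..t} s *\<^sub>R (if 0 < d s then r s else 0)"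
        by (simp split: if_splits)
    qed
    show "AE s in lborel. norm (indicat_real {0..t} s *\<^sub>R (\<phi>' n (d s) * r s))
       \<le> 2 * \<bar>indicat_real {0..t} s *\<^sub>R r s\<bar>" for n
      using bd[of n] by (auto simp: indicator_def abs_mult intro!: mult_right_mono)
  qed
  moreover have "\<phi> n (d t) = (LINT s:{0..t}|lborel. \<phi>' n (d s) * r s)" for n
    using chain_rule_indefinite_integral[OF r d _ der cont t, of n] d_eq d0 \<epsilon>[of n]
    by (simp add: \<phi>_def)
  ultimately show ?thesis using lim\<phi> LIMSEQ_unique by (metis (no_types, lifting) ext)
qed

text \<open>The hypothesis says that \<open>exp (- C t)\<close> times the integral of \<open>m\<close> up to \<open>t\<close> is nonincreasing;
  it starts at zero, so the integral, and with it \<open>m\<close>, cannot be positive.\<close>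

lemma gronwall_zero:
  fixes m :: "real \<Rightarrow> real"
  assumes m: "continuous_on {0..T} m" and nonneg: "\<And>t. t \<in> {0..T} \<Longrightarrow> 0 \<le> m t"
    and bound: "\<And>t. t \<in> {0..T} \<Longrightarrow> m t \<le> C * (LINT s:{0..t}|lborel. m s)" and C: "0 \<le> C"
    and t: "t \<in> {0..T}"
  shows "m t = 0"
proof -
  have eq: "(LINT s:{0..u}|lborel. m s) = integral {0..u} m" if "u \<in> {0..T}" for u
  proof (rule set_borel_integral_eq_integral(2))
    show "set_integrable lborel {0..u} m"
      by (rule borel_integrable_atLeastAtMost') (rule continuous_on_subset[OF m], use that in auto)
  qed
  define u where "u s = integral {0..s} m" for s
  have du: "(u has_real_derivative m s) (at s within {0..T})" if "s \<in> {0..T}" for s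
    unfolding u_def by (rule integral_has_real_derivative[OF m that])
  have "exp (- C * t) * u t \<le> exp (- C * 0) * u 0"
  proof (rule DERIV_nonpos_imp_decreasing_open[where f = "\<lambda>s. exp (- C * s) * u s"])
    show "0 \<le> t" using t by auto
    show "continuous_on {0..t} (\<lambda>s. exp (- C * s) * u s)"
    proof -
      have "continuous_on {0..T} u" using du DERIV_continuous_on by blast
      then have "continuous_on {0..t} u" by (rule continuous_on_subset) (use t in auto)
      then show ?thesis by (intro continuous_intros)
    qed
    fix s assume s: "0 < s" "s < t"
    have "at s within {0..T} = at s" using s t by (intro at_within_interior) auto
    then have "(u has_real_derivative m s) (at s)" using du[of s] s t by auto
    then have "((\<lambda>s. exp (- C * s) * u s) has_real_derivative exp (- C * s) * (m s - C * u s)) (at s)"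
      by (auto intro!: derivative_eq_intros simp: algebra_simps)
    moreover have "m s - C * u s \<le> 0" using bound[of s] eq[of s] s t by (auto simp: u_def)
    ultimately show "\<exists>y. ((\<lambda>s. exp (- C * s) * u s) has_real_derivative y) (at s) \<and> y \<le> 0"
      by (auto simp: mult_le_0_iff)
  qed
  then have "u t \<le> 0" by (simp add: u_def mult_le_0_iff)
  then have "m t \<le> 0" using bound[OF t] eq[OF t] C by (auto simp: u_def mult_nonneg_nonpos intro: order_trans)
  then show ?thesis using nonneg[OF t] by auto
qed


section \<open>The measurable space of probability measures on the line\<close>

lemma real_distributionI:
  assumes "m \<in> prob_measures"
  shows "real_distribution m"
proof -
  interpret prob_space m using assms by simp
  show ?thesis by standard (use assms in auto)
qed

lemma prob_measuresI: "real_distribution m \<Longrightarrow> m \<in> prob_measures"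
  unfolding real_distribution_def real_distribution_axioms_def by auto

lemma st_le_refl: "m \<le>st m"
  by (simp add: st_le_def)

lemma st_le_trans: "k \<le>st m \<Longrightarrow> m \<le>st n \<Longrightarrow> k \<le>st n"
  unfolding st_le_def by (meson order_trans)

lemma st_le_antisym:
  assumes "m \<in> prob_measures" "n \<in> prob_measures" "m \<le>st n" "n \<le>st m"
  shows "m = n"
  using assms by (intro cdf_unique real_distributionI) (auto simp: st_le_def intro: antisym)

lemma distr_in_prob_measures:
  assumes "prob_space M" "X \<in> borel_measurable M"
  shows "distr M borel X \<in> prob_measures"
  using prob_space.prob_space_distr[OF assms] by simp

lemma topspace_weak_topology: "topspace weak_topology = prob_measures"
proof -
  have "prob_measures \<subseteq> \<Union> {{\<mu> \<in> prob_measures. (\<integral>x. h x \<partial>\<mu>) \<in> V} | (h :: real \<Rightarrow> real) V.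
       continuous_on UNIV h \<and> bounded (range h) \<and> open V}"
    by (intro Union_upper CollectI exI[of _ "\<lambda>_. 0"] exI[of _ UNIV]) auto
  then show ?thesis
    unfolding weak_topology_def topology_generated_by_topspace by auto
qed

lemma weak_opens_subset: "{S. openin weak_topology S} \<subseteq> Pow prob_measures"
  using openin_subset topspace_weak_topology by blast

lemma space_weak_borel: "space weak_borel = prob_measures"
  unfolding weak_borel_def by (rule space_measure_of[OF weak_opens_subset])

lemma sets_weak_borel: "sets weak_borel = sigma_sets prob_measures {S. openin weak_topology S}"
  unfolding weak_borel_def by (rule sets_measure_of[OF weak_opens_subset])

lemma measurable_weak_borelI:
  assumes "\<And>x. x \<in> space N \<Longrightarrow> m x \<in> prob_measures"
    and "\<And>S. openin weak_topology S \<Longrightarrow> m -` S \<inter> space N \<in> sets N"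
  shows "m \<in> measurable N weak_borel"
  unfolding weak_borel_def
  by (rule measurable_measure_of[OF weak_opens_subset]) (use assms in auto)

lemma borel_measurable_integral_weak_borel:
  fixes h :: "real \<Rightarrow> real"
  assumes "continuous_on UNIV h" "bounded (range h)"
  shows "(\<lambda>m. \<integral>x. h x \<partial>m) \<in> borel_measurable weak_borel"
proof (rule borel_measurableI)
  fix V :: "real set" assume "open V"
  then have "openin weak_topology {m \<in> prob_measures. (\<integral>x. h x \<partial>m) \<in> V}"
    unfolding weak_topology_def using assms by (intro topology_generated_by_Basis) blast
  moreover have "(\<lambda>m. \<integral>x. h x \<partial>m) -` V \<inter> space weak_borel = {m \<in> prob_measures. (\<integral>x. h x \<partial>m) \<in> V}"
    by (auto simp: space_weak_borel)
  ultimately show "(\<lambda>m. \<integral>x. h x \<partial>m) -` V \<inter> space weak_borel \<in> sets weak_borel"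
    by (auto simp: sets_weak_borel)
qed

text \<open>A distribution function is not weakly continuous in the measure, but it is the limit of the
  integrals of continuous ramps that drop from 1 to 0 just to the right of \<open>s\<close>.\<close>

lemma borel_measurable_cdf_weak_borel: "(\<lambda>m. cdf m s) \<in> borel_measurable weak_borel"
proof (rule borel_measurable_LIMSEQ_real)
  let ?h = "\<lambda>n::nat. cts_step s (s + inverse (real (Suc n)))"
  show "(\<lambda>m. \<integral>x. ?h n x \<partial>m) \<in> borel_measurable weak_borel" for n
  proof (rule borel_measurable_integral_weak_borel)
    show "continuous_on UNIV (?h n)"
      by (intro uniformly_continuous_imp_continuous cts_step_uniformly_continuous) simp
    show "bounded (range (?h n))"
      unfolding bounded_iff by (intro exI[of _ 1]) (auto simp: cts_step_def divide_simps)
  qed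
  fix m :: "real measure" assume "m \<in> space weak_borel"
  then interpret real_distribution m by (simp add: space_weak_borel real_distributionI)
  show "(\<lambda>n. \<integral>x. ?h n x \<partial>m) \<longlonglongrightarrow> cdf m s"
  proof (rule tendsto_sandwich)
    show "\<forall>\<^sub>F n in sequentially. cdf m s \<le> (\<integral>x. ?h n x \<partial>m)"
      "\<forall>\<^sub>F n in sequentially. (\<integral>x. ?h n x \<partial>m) \<le> cdf m (s + inverse (real (Suc n)))"
      by (auto intro!: always_eventually cdf_cts_step)
    show "(\<lambda>n. cdf m s) \<longlonglongrightarrow> cdf m s" by simp
    have "filterlim (\<lambda>n. s + inverse (real (Suc n))) (at_right s) sequentially"
      unfolding filterlim_at
      by (intro conjI always_eventually LIMSEQ_inverse_real_of_nat_add) auto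
    then show "(\<lambda>n. cdf m (s + inverse (real (Suc n)))) \<longlonglongrightarrow> cdf m s"
      using cdf_is_right_cont[of s] unfolding continuous_within by (rule filterlim_compose[rotated])
  qed
qed

text \<open>Near a continuity point of the limit, monotonicity squeezes the distribution functions between
  their values at two close rational points.\<close>

lemma weak_conv_m_from_rational_cdf:
  assumes "\<And>n. real_distribution (M n)" "real_distribution m"
    and conv: "\<And>q. q \<in> \<rat> \<Longrightarrow> (\<lambda>n. cdf (M n) q) \<longlonglongrightarrow> cdf m q"
  shows "weak_conv_m M m"
  unfolding weak_conv_m_def weak_conv_def
proof (intro allI impI)
  fix x assume x: "isCont (cdf m) x"
  interpret M: real_distribution "M n" for n by fact
  interpret m: real_distribution m by fact
  show "(\<lambda>n. cdf (M n) x) \<longlonglongrightarrow> cdf m x"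
  proof (rule LIMSEQ_I)
    fix e :: real assume e: "0 < e"
    obtain d where d: "d > 0" "\<And>y. \<bar>y - x\<bar> < d \<Longrightarrow> \<bar>cdf m y - cdf m x\<bar> < e / 2"
      using x e unfolding continuous_at_eps_delta by (metis half_gt_zero dist_real_def)
    obtain p where p: "p \<in> \<rat>" "x - d < p" "p < x" using Rats_dense_in_real[of "x - d" x] d by auto
    obtain q where q: "q \<in> \<rat>" "x < q" "q < x + d" using Rats_dense_in_real[of x "x + d"] d by auto
    obtain N1 where N1: "\<And>n. n \<ge> N1 \<Longrightarrow> \<bar>cdf (M n) p - cdf m p\<bar> < e / 2"
      using LIMSEQ_D[OF conv[OF p(1)], of "e/2"] e by auto
    obtain N2 where N2: "\<And>n. n \<ge> N2 \<Longrightarrow> \<bar>cdf (M n) q - cdf m q\<bar> < e / 2"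
      using LIMSEQ_D[OF conv[OF q(1)], of "e/2"] e by auto
    show "\<exists>no. \<forall>n\<ge>no. norm (cdf (M n) x - cdf m x) < e"
    proof (intro exI[of _ "max N1 N2"] allI impI)
      fix n assume n: "n \<ge> max N1 N2"
      have "cdf (M n) p \<le> cdf (M n) x" "cdf (M n) x \<le> cdf (M n) q"
        using p q by (auto intro!: M.cdf_nondecreasing)
      moreover have "\<bar>cdf m p - cdf m x\<bar> < e / 2" "\<bar>cdf m q - cdf m x\<bar> < e / 2"
        using d(2)[of p] d(2)[of q] p q by auto
      ultimately show "norm (cdf (M n) x - cdf m x) < e"
        using N1[of n] N2[of n] n by (auto simp: abs_if split: if_splits)
    qed
  qed
qed

lemma prob_measures_eqI_rational_cdf:
  assumes "m \<in> prob_measures" "n \<in> prob_measures" and eq: "\<And>q. q \<in> \<rat> \<Longrightarrow> cdf m q = cdf n q"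
  shows "m = n"
proof (rule cdf_unique)
  show rd: "real_distribution m" "real_distribution n" using assms by (auto intro: real_distributionI)
  show "cdf m = cdf n"
  proof
    fix s
    have lim: "((\<lambda>x. cdf m x - cdf n x) \<longlongrightarrow> cdf m s - cdf n s) (at_right s)"
      using finite_borel_measure.cdf_is_right_cont[OF real_distribution.finite_borel_measure_M[OF rd(1)], of s]
        finite_borel_measure.cdf_is_right_cont[OF real_distribution.finite_borel_measure_M[OF rd(2)], of s]
      unfolding continuous_within by (rule tendsto_diff)
    have "\<exists>q. q \<in> \<rat> \<and> s < q \<and> q < s + inverse (real (Suc k))" for k
      using Rats_dense_in_real[of s "s + inverse (real (Suc k))"] by auto
    then obtain q where q: "\<And>k. q k \<in> \<rat> \<and> s < q k \<and> q k < s + inverse (real (Suc k))"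
      by metis
    have "q \<longlonglongrightarrow> s"
      by (rule tendsto_sandwich[OF _ _ tendsto_const LIMSEQ_inverse_real_of_nat_add])
         (use q less_imp_le in \<open>auto intro!: always_eventually\<close>)
    then have "filterlim q (at_right s) sequentially"
      unfolding filterlim_at using q by (auto intro!: always_eventually)
    from filterlim_compose[OF lim this] have "(\<lambda>k. 0) \<longlonglongrightarrow> cdf m s - cdf n s"
      using eq q by simp
    then show "cdf m s = cdf n s" by (simp add: LIMSEQ_const_iff)
  qed
qed

text \<open>The map \<open>\<Phi>\<close> that sends a law to its distribution function at the rationals is injective into a
  countable product of lines, and its inverse is continuous, because convergence at all rationals
  implies weak convergence and sequences suffice in a metrizable space. Hence a weakly open set
  is the preimage under \<open>\<Phi>\<close> of an open set of the product, where measurability can be checked by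
  coordinates.\<close>

lemma measurable_weak_borel_if_rational_cdf:
  assumes P: "\<And>x. x \<in> space N \<Longrightarrow> m x \<in> prob_measures"
    and cdf: "\<And>q. q \<in> \<rat> \<Longrightarrow> (\<lambda>x. cdf (m x) q) \<in> borel_measurable N"
  shows "m \<in> measurable N weak_borel"
proof (rule measurable_weak_borelI[OF P])
  define q :: "nat \<Rightarrow> real" where "q = from_nat_into \<rat>"
  have q: "q k \<in> \<rat>" for k unfolding q_def by (rule from_nat_into) (use Rats_0 in blast)
  have q_onto: "\<exists>k. r = q k" if "r \<in> \<rat>" for r
    using from_nat_into_surj[OF countable_rat that] by (auto simp: q_def)
  define \<Phi> :: "real measure \<Rightarrow> nat \<Rightarrow> real" where "\<Phi> k = (\<lambda>i. cdf k (q i))" for k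
  define \<Psi> where "\<Psi> = inv_into prob_measures \<Phi>"
  have inj: "inj_on \<Phi> prob_measures"
  proof (rule inj_onI)
    fix k l assume kl: "k \<in> prob_measures" "l \<in> prob_measures" "\<Phi> k = \<Phi> l"
    show "k = l"
    proof (rule prob_measures_eqI_rational_cdf[OF kl(1,2)])
      fix r :: real assume "r \<in> \<rat>"
      then obtain i where "r = q i" using q_onto by blast
      then show "cdf k r = cdf l r" using fun_cong[OF kl(3), of i] by (simp add: \<Phi>_def)
    qed
  qed
  have \<Psi>\<Phi>: "\<Psi> (\<Phi> k) = k" if "k \<in> prob_measures" for k
    unfolding \<Psi>_def by (rule inv_into_f_f[OF inj that])
  have cont: "continuous_map (top_of_set (\<Phi> ` prob_measures)) weak_topology \<Psi>"
    unfolding weak_topology_def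
  proof (rule continuous_on_generated_topo)
    fix U assume "U \<in> {{\<mu> \<in> prob_measures. (\<integral>x. h x \<partial>\<mu>) \<in> V} | (h :: real \<Rightarrow> real) V.
       continuous_on UNIV h \<and> bounded (range h) \<and> open V}"
    then obtain h V where U: "U = {\<mu> \<in> prob_measures. (\<integral>x. h x \<partial>\<mu>) \<in> V}"
      and h: "continuous_on UNIV (h :: real \<Rightarrow> real)" "bounded (range h)" and V: "open V"
      by blast
    obtain B where B: "\<And>x. norm (h x) \<le> B" using h(2) unfolding bounded_iff by auto
    have "continuous_on (\<Phi> ` prob_measures) (\<lambda>y. \<integral>x. h x \<partial>\<Psi> y)"
    proof (rule continuous_on_sequentiallyI)
      fix u :: "nat \<Rightarrow> nat \<Rightarrow> real" and y
      assume u: "\<forall>n. u n \<in> \<Phi> ` prob_measures" and y: "y \<in> \<Phi> ` prob_measures" and lim: "u \<longlonglongrightarrow> y"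
      have rd: "real_distribution (\<Psi> (u n))" "real_distribution (\<Psi> y)" for n
        using u y \<Psi>\<Phi> by (auto intro!: real_distributionI dest: spec[of _ n])
      have "weak_conv_m (\<lambda>n. \<Psi> (u n)) (\<Psi> y)"
      proof (rule weak_conv_m_from_rational_cdf[OF rd])
        fix r :: real assume "r \<in> \<rat>"
        then obtain i where i: "r = q i" using q_onto by blast
        have eval: "cdf (\<Psi> z) r = z i" if "z \<in> \<Phi> ` prob_measures" for z
          using that \<Psi>\<Phi> by (auto simp: \<Phi>_def i)
        have "(\<lambda>n. u n i) \<longlonglongrightarrow> y i"
          using continuous_on_tendsto_compose[OF continuous_on_product_coordinates lim, of i] by simp
        then show "(\<lambda>n. cdf (\<Psi> (u n)) r) \<longlonglongrightarrow> cdf (\<Psi> y) r"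
          using u y by (simp add: eval)
      qed
      then show "(\<lambda>n. \<integral>x. h x \<partial>\<Psi> (u n)) \<longlonglongrightarrow> (\<integral>x. h x \<partial>\<Psi> y)"
        by (rule weak_conv_imp_integral_bdd_continuous_conv[OF rd])
           (use h B in \<open>auto simp: continuous_on_eq_continuous_at\<close>)
    qed
    then have "openin (top_of_set (\<Phi> ` prob_measures))
        (\<Phi> ` prob_measures \<inter> (\<lambda>y. \<integral>x. h x \<partial>\<Psi> y) -` V)"
      using V by (simp add: continuous_openin_preimage_gen)
    also have "\<Phi> ` prob_measures \<inter> (\<lambda>y. \<integral>x. h x \<partial>\<Psi> y) -` V
        = \<Psi> -` U \<inter> topspace (top_of_set (\<Phi> ` prob_measures))"
      using \<Psi>\<Phi> by (auto simp: U)
    finally show "openin (top_of_set (\<Phi> ` prob_measures)) \<dots>" .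
  next
    show "\<Psi> ` topspace (top_of_set (\<Phi> ` prob_measures)) \<subseteq>
       \<Union> {{\<mu> \<in> prob_measures. (\<integral>x. h x \<partial>\<mu>) \<in> V} | (h :: real \<Rightarrow> real) V.
       continuous_on UNIV h \<and> bounded (range h) \<and> open V}"
      using topspace_weak_topology[unfolded weak_topology_def topology_generated_by_topspace] \<Psi>\<Phi>
      by auto
  qed
  have meas: "(\<lambda>x. \<Phi> (m x)) \<in> borel_measurable N"
    by (rule measurable_coordinatewise_then_product) (simp add: \<Phi>_def cdf q)
  fix S assume S: "openin weak_topology S"
  have "openin (top_of_set (\<Phi> ` prob_measures)) {y \<in> \<Phi> ` prob_measures. \<Psi> y \<in> S}"
    using openin_continuous_map_preimage[OF cont S] by simp
  then obtain V where V: "open V" "{y \<in> \<Phi> ` prob_measures. \<Psi> y \<in> S} = \<Phi> ` prob_measures \<inter> V"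
    unfolding openin_open by blast
  have mem: "p y \<longleftrightarrow> y \<in> V'" if "{y \<in> A. p y} = A \<inter> V'" "y \<in> A" for p and y :: "nat \<Rightarrow> real" and A V'
    using that by blast
  have "m x \<in> S \<longleftrightarrow> \<Phi> (m x) \<in> V" if "x \<in> space N" for x
    using mem[OF V(2) imageI[OF P[OF that]]] unfolding \<Psi>\<Phi>[OF P[OF that]] .
  then have "m -` S \<inter> space N = (\<lambda>x. \<Phi> (m x)) -` V \<inter> space N" by auto
  also have "\<dots> \<in> sets N" using meas V(1) by (auto intro: measurable_sets)
  finally show "m -` S \<inter> space N \<in> sets N" .
qed

text \<open>By dominated convergence such a flow of laws is even weakly continuous.\<close>

lemma measurable_law_of_continuous_process:
  fixes X :: "real \<Rightarrow> 'a \<Rightarrow> real"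
  assumes "prob_space M" and X: "\<And>t. t \<in> {0..T} \<Longrightarrow> X t \<in> borel_measurable M"
    and cont: "\<And>\<omega>. \<omega> \<in> space M \<Longrightarrow> continuous_on {0..T} (\<lambda>t. X t \<omega>)"
  shows "(\<lambda>t. distr M borel (X t)) \<in> measurable (restrict_space borel {0..T}) weak_borel"
proof -
  interpret prob_space M by fact
  let ?L = "\<lambda>t. distr M borel (X t)"
  have L: "?L t \<in> prob_measures" if "t \<in> {0..T}" for t
    using distr_in_prob_measures[OF assms(1) X[OF that]] .
  have "continuous_map (top_of_set {0..T}) weak_topology ?L"
    unfolding weak_topology_def
  proof (rule continuous_on_generated_topo)
    fix U assume "U \<in> {{\<mu> \<in> prob_measures. (\<integral>x. h x \<partial>\<mu>) \<in> V} | (h :: real \<Rightarrow> real) V.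
       continuous_on UNIV h \<and> bounded (range h) \<and> open V}"
    then obtain h V where U: "U = {\<mu> \<in> prob_measures. (\<integral>x. h x \<partial>\<mu>) \<in> V}"
      and h: "continuous_on UNIV (h :: real \<Rightarrow> real)" "bounded (range h)" and V: "open V"
      by blast
    obtain B where B: "\<And>x. norm (h x) \<le> B" using h(2) unfolding bounded_iff by auto
    have [measurable]: "h \<in> borel_measurable borel" using h(1) by (rule borel_measurable_continuous_onI)
    have "continuous_on {0..T} (\<lambda>t. \<integral>x. h x \<partial>?L t)"
    proof (rule continuous_on_sequentiallyI)
      fix u :: "nat \<Rightarrow> real" and t assume u: "\<forall>n. u n \<in> {0..T}" and t: "t \<in> {0..T}" and lim: "u \<longlonglongrightarrow> t"
      have [measurable]: "X (u n) \<in> borel_measurable M" "X t \<in> borel_measurable M" for n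
        using u t X by auto
      have "(\<lambda>n. \<integral>\<omega>. h (X (u n) \<omega>) \<partial>M) \<longlonglongrightarrow> (\<integral>\<omega>. h (X t \<omega>) \<partial>M)"
      proof (rule integral_dominated_convergence[where w="\<lambda>_. B"])
        show "AE \<omega> in M. (\<lambda>n. h (X (u n) \<omega>)) \<longlonglongrightarrow> h (X t \<omega>)"
        proof (rule AE_I2)
          fix \<omega> assume "\<omega> \<in> space M"
          then have "continuous_on {0..T} (\<lambda>t. h (X t \<omega>))"
            using continuous_on_compose2[OF h(1) cont] by auto
          then show "(\<lambda>n. h (X (u n) \<omega>)) \<longlonglongrightarrow> h (X t \<omega>)"
            using u t lim unfolding continuous_on_sequentially comp_def by auto
        qed
      qed (use B in auto)
      then show "(\<lambda>n. \<integral>x. h x \<partial>?L (u n)) \<longlonglongrightarrow> (\<integral>x. h x \<partial>?L t)"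
        by (simp add: integral_distr)
    qed
    then have "openin (top_of_set {0..T}) ({0..T} \<inter> (\<lambda>t. \<integral>x. h x \<partial>?L t) -` V)"
      using V by (simp add: continuous_openin_preimage_gen)
    also have "{0..T} \<inter> (\<lambda>t. \<integral>x. h x \<partial>?L t) -` V = ?L -` U \<inter> topspace (top_of_set {0..T})"
      using L by (auto simp: U)
    finally show "openin (top_of_set {0..T}) \<dots>" .
  next
    show "?L ` topspace (top_of_set {0..T}) \<subseteq>
       \<Union> {{\<mu> \<in> prob_measures. (\<integral>x. h x \<partial>\<mu>) \<in> V} | (h :: real \<Rightarrow> real) V.
       continuous_on UNIV h \<and> bounded (range h) \<and> open V}"
      using topspace_weak_topology[unfolded weak_topology_def topology_generated_by_topspace] L
      by auto
  qed
  note cont_L = this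
  show ?thesis
  proof (rule measurable_weak_borelI)
    show "?L t \<in> prob_measures" if "t \<in> space (restrict_space borel {0..T})" for t
      using that L by (auto simp: space_restrict_space)
    fix S assume "openin weak_topology S"
    then have "openin (top_of_set {0..T}) {t \<in> {0..T}. ?L t \<in> S}"
      using openin_continuous_map_preimage[OF cont_L] by simp
    then obtain V where "open V" "{t \<in> {0..T}. ?L t \<in> S} = {0..T} \<inter> V"
      unfolding openin_open by blast
    moreover have "?L -` S \<inter> space (restrict_space borel {0..T}) = {t \<in> {0..T}. ?L t \<in> S}"
      by (auto simp: space_restrict_space)
    ultimately show "?L -` S \<inter> space (restrict_space borel {0..T}) \<in> sets (restrict_space borel {0..T})"
      unfolding sets_restrict_space by (simp add: image_eqI)
  qed
qed


section \<open>Infima of sequences for stochastic dominance\<close>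

text \<open>By right-continuity, lower bounds on a distribution function need only be known at the rational
  points to the right.\<close>

lemma cdf_right_limit_bound:
  assumes m: "m \<in> prob_measures" and le: "\<And>q. q \<in> \<rat> \<Longrightarrow> s < q \<Longrightarrow> c \<le> cdf m q"
  shows "c \<le> cdf m s"
proof -
  interpret real_distribution m using m by (rule real_distributionI)
  have "(cdf m \<longlongrightarrow> cdf m s) (at_right s)"
    using cdf_is_right_cont[of s] by (simp add: continuous_within)
  moreover have "\<forall>\<^sub>F x in at_right s. c \<le> cdf m x"
    unfolding eventually_at_right_field
  proof (intro exI[of _ "s + 1"] conjI allI impI)
    fix x assume "s < x"
    then obtain q where q: "q \<in> \<rat>" "s < q" "q < x" using Rats_dense_in_real by blast
    then show "c \<le> cdf m x" using le[OF q(1,2)] cdf_nondecreasing[of q x] by linarith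
  qed simp
  ultimately show ?thesis by (rule tendsto_lowerbound) simp
qed

text \<open>A supremum of distribution functions can fail to be right-continuous; its right limits repair
  this. Taking them along the rationals keeps the result measurable in any further parameter.\<close>

definition right_regularization :: "(real \<Rightarrow> real) \<Rightarrow> real \<Rightarrow> real"
  where "right_regularization H s = (INF q\<in>{q \<in> \<rat>. s < q}. H q)"

context
  fixes H :: "real \<Rightarrow> real" and lo hi :: "real measure"
  assumes lo: "lo \<in> prob_measures" and hi: "hi \<in> prob_measures"
    and H_ge: "\<And>q. q \<in> \<rat> \<Longrightarrow> cdf hi q \<le> H q" and H_le: "\<And>q. q \<in> \<rat> \<Longrightarrow> H q \<le> cdf lo q"
    and H_mono: "\<And>p q. p \<le> q \<Longrightarrow> H p \<le> H q"
begin

text \<open>The two laws that enclose \<open>H\<close> force the limits 0 and 1 at the ends of the line, so no mass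
  escapes.\<close>

lemma right_regularization_cdf:
  shows "interval_measure (right_regularization H) \<in> prob_measures" (is ?P)
    and "cdf (interval_measure (right_regularization H)) = right_regularization H" (is ?C)
    and right_regularization_le: "q \<in> \<rat> \<Longrightarrow> s < q \<Longrightarrow> right_regularization H s \<le> H q"
    and right_regularization_ge: "(\<And>q. q \<in> \<rat> \<Longrightarrow> s < q \<Longrightarrow> c \<le> H q) \<Longrightarrow> c \<le> right_regularization H s"
proof -
  interpret lo: real_distribution lo using lo by (rule real_distributionI)
  interpret hi: real_distribution hi using hi by (rule real_distributionI)
  let ?F = "right_regularization H"
  have bdd: "bdd_below (H ` {q \<in> \<rat>. s < q})" for s
    using H_ge hi.cdf_nonneg by (intro bdd_belowI[of _ 0]) (auto intro: order_trans)
  have ne: "{q \<in> \<rat>. s < q} \<noteq> {}" for s :: real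
    using Rats_dense_in_real[of s "s + 1"] by auto
  show le: "?F s \<le> H q" if "q \<in> \<rat>" "s < q" for s q
    unfolding right_regularization_def by (rule cINF_lower[OF bdd]) (use that in auto)
  show ge: "c \<le> ?F s" if "\<And>q. q \<in> \<rat> \<Longrightarrow> s < q \<Longrightarrow> c \<le> H q" for s c
    unfolding right_regularization_def by (rule cINF_greatest[OF ne]) (use that in auto)
  have mono: "?F x \<le> ?F y" if "x \<le> y" for x y
    by (rule ge) (use that in \<open>auto intro!: le\<close>)
  have hi_le: "cdf hi s \<le> ?F s" for s
  proof (rule ge)
    fix q :: real assume "q \<in> \<rat>" "s < q"
    then show "cdf hi s \<le> H q" using H_ge[of q] hi.cdf_nondecreasing[of s q] by linarith
  qed
  have le_lo: "?F s \<le> cdf lo s" for s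
  proof (rule cdf_right_limit_bound[OF lo])
    fix q :: real assume "q \<in> \<rat>" "s < q"
    then show "?F s \<le> cdf lo q" using H_le[of q] le[of q s] by linarith
  qed
  have cont: "continuous (at_right a) ?F" for a
    unfolding continuous_within
  proof (rule order_tendstoI)
    fix b assume "b < ?F a"
    then show "\<forall>\<^sub>F x in at_right a. b < ?F x"
      unfolding eventually_at_right_field using mono
      by (intro exI[of _ "a + 1"]) (auto intro: order.strict_trans2)
  next
    fix b assume "?F a < b"
    then obtain q where q: "q \<in> \<rat>" "a < q" "H q < b"
      using ge[of a b] by force
    have "?F x < b" if "a < x" "x < q" for x
      using le[OF q(1) that(2)] q(3) by simp
    then show "\<forall>\<^sub>F x in at_right a. ?F x < b"
      unfolding eventually_at_right_field using q(2) by auto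
  qed
  have bot: "(?F \<longlongrightarrow> 0) at_bot"
    by (rule tendsto_sandwich[OF _ _ hi.cdf_lim_at_bot lo.cdf_lim_at_bot])
       (use hi_le le_lo in \<open>auto intro!: always_eventually\<close>)
  have top: "(?F \<longlongrightarrow> 1) at_top"
    by (rule tendsto_sandwich[OF _ _ hi.cdf_lim_at_top_prob lo.cdf_lim_at_top_prob])
       (use hi_le le_lo in \<open>auto intro!: always_eventually\<close>)
  show ?P
    by (rule prob_measuresI[OF real_distribution_interval_measure[OF mono cont bot top]])
  show ?C
    by (rule cdf_interval_measure[OF mono cont bot])
qed

end

text \<open>The smaller a law is, the larger is its distribution function, so an infimum of laws is a
  supremum of distribution functions. Clamping these between the ones of \<open>hi\<close> and \<open>lo\<close> changes
  nothing for laws between \<open>lo\<close> and \<open>hi\<close>, and makes the result a law between them for every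
  sequence; this is convenient for flows, which obey such bounds only almost everywhere.\<close>

definition st_inf :: "real measure \<Rightarrow> real measure \<Rightarrow> (nat \<Rightarrow> real measure) \<Rightarrow> real measure"
  where "st_inf lo hi \<nu> = interval_measure
    (right_regularization (\<lambda>s. SUP n. max (cdf hi s) (min (cdf lo s) (cdf (\<nu> n) s))))"

context
  fixes lo hi :: "real measure" and \<nu> :: "nat \<Rightarrow> real measure"
  assumes lo: "lo \<in> prob_measures" and hi: "hi \<in> prob_measures" and lohi: "lo \<le>st hi"
    and \<nu>: "\<And>n. \<nu> n \<in> prob_measures"
begin

private abbreviation (input) "H \<equiv> \<lambda>s. SUP n. max (cdf hi s) (min (cdf lo s) (cdf (\<nu> n) s))"

private lemma clamped_sup_bdd: "bdd_above (range (\<lambda>n. max (cdf hi s) (min (cdf lo s) (cdf (\<nu> n) s))))"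
  by (rule bdd_aboveI[of _ "max (cdf hi s) (cdf lo s)"]) auto

private lemma clamped_sup_props:
  shows "cdf hi q \<le> H q" "H q \<le> cdf lo q" "p \<le> q \<Longrightarrow> H p \<le> H q"
proof -
  show "cdf hi q \<le> H q"
    by (rule cSUP_upper2[OF clamped_sup_bdd]) auto
  show "H q \<le> cdf lo q"
    by (rule cSUP_least) (use lohi in \<open>auto simp: st_le_def\<close>)
  have mono: "cdf m p \<le> cdf m q" if "p \<le> q" "m \<in> prob_measures" for m
    using finite_borel_measure.cdf_nondecreasing[OF real_distribution.finite_borel_measure_M[OF real_distributionI]] that
    by blast
  show "H p \<le> H q" if "p \<le> q"
  proof (rule cSUP_mono[OF _ clamped_sup_bdd])
    show "\<exists>m\<in>UNIV. max (cdf hi p) (min (cdf lo p) (cdf (\<nu> n) p)) \<le> max (cdf hi q) (min (cdf lo q) (cdf (\<nu> m) q))" for n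
      using mono[OF that lo] mono[OF that hi] mono[OF that \<nu>[of n]] by (intro bexI[of _ n]) auto
  qed simp
qed

lemma st_inf_in_prob_measures: "st_inf lo hi \<nu> \<in> prob_measures"
  unfolding st_inf_def by (rule right_regularization_cdf(1)[OF lo hi]) (rule clamped_sup_props; assumption?)+

lemma cdf_st_inf: "cdf (st_inf lo hi \<nu>) = right_regularization H"
  unfolding st_inf_def by (rule right_regularization_cdf(2)[OF lo hi]) (rule clamped_sup_props; assumption?)+

lemma st_inf_between: "lo \<le>st st_inf lo hi \<nu>" "st_inf lo hi \<nu> \<le>st hi"
proof -
  have mono: "cdf hi s \<le> cdf hi q" if "s < q" for s q
    using finite_borel_measure.cdf_nondecreasing[OF real_distribution.finite_borel_measure_M[OF real_distributionI[OF hi]]] that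
    by auto
  show "st_inf lo hi \<nu> \<le>st hi"
    unfolding st_le_def cdf_st_inf
    by (intro allI right_regularization_ge[OF lo hi] clamped_sup_props order_trans[OF mono clamped_sup_props(1)]; assumption?)
  show "lo \<le>st st_inf lo hi \<nu>"
    unfolding st_le_def cdf_st_inf
  proof
    fix s show "right_regularization H s \<le> cdf lo s"
    proof (rule cdf_right_limit_bound[OF lo])
      fix q :: real assume q: "q \<in> \<rat>" "s < q"
      have "right_regularization H s \<le> H q"
        by (rule right_regularization_le[OF lo hi _ _ _ q]) (rule clamped_sup_props; assumption?)+
      then show "right_regularization H s \<le> cdf lo q" using clamped_sup_props(2)[of q] by linarith
    qed
  qed
qed

text \<open>This covers not only the members of the sequence but every law whose distribution function is
  dominated by their supremum, which is all that an essential supremum provides.\<close>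

lemma st_inf_le:
  assumes between: "\<And>n. lo \<le>st \<nu> n" "\<And>n. \<nu> n \<le>st hi"
    and \<kappa>: "\<kappa> \<in> prob_measures" "\<And>q. q \<in> \<rat> \<Longrightarrow> cdf \<kappa> q \<le> (SUP n. cdf (\<nu> n) q)"
  shows "st_inf lo hi \<nu> \<le>st \<kappa>"
  unfolding st_le_def cdf_st_inf
proof (intro allI right_regularization_ge[OF lo hi] clamped_sup_props)
  fix s q :: real assume q: "q \<in> \<rat>" "s < q"
  have "cdf \<kappa> s \<le> cdf \<kappa> q"
    using finite_borel_measure.cdf_nondecreasing[OF real_distribution.finite_borel_measure_M[OF real_distributionI[OF \<kappa>(1)]]] q
    by auto
  also have "\<dots> \<le> (SUP n. cdf (\<nu> n) q)" by (rule \<kappa>(2)[OF q(1)])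
  also have "\<dots> = H q"
    using between lohi by (intro SUP_cong refl) (auto simp: st_le_def max_absorb2 min_absorb2)
  finally show "cdf \<kappa> s \<le> H q" .
qed

lemma st_le_st_inf:
  assumes \<kappa>: "\<kappa> \<in> prob_measures" "\<kappa> \<le>st hi" "\<And>n. \<kappa> \<le>st \<nu> n"
  shows "\<kappa> \<le>st st_inf lo hi \<nu>"
  unfolding st_le_def cdf_st_inf
proof
  fix s show "right_regularization H s \<le> cdf \<kappa> s"
  proof (rule cdf_right_limit_bound[OF \<kappa>(1)])
    fix q :: real assume q: "q \<in> \<rat>" "s < q"
    have "right_regularization H s \<le> H q"
      by (rule right_regularization_le[OF lo hi _ _ _ q]) (rule clamped_sup_props; assumption?)+
    also have "H q \<le> cdf \<kappa> q"
      by (rule cSUP_least) (use \<kappa>(2,3) in \<open>auto simp: st_le_def min_le_iff_disj\<close>)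
    finally show "right_regularization H s \<le> cdf \<kappa> q" .
  qed
qed

end

lemma measurable_st_inf:
  assumes lo: "lo \<in> prob_measures" and hi: "hi \<in> prob_measures" and lohi: "lo \<le>st hi"
    and \<nu>: "\<And>n. \<nu> n \<in> measurable N weak_borel"
  shows "(\<lambda>t. st_inf lo hi (\<lambda>n. \<nu> n t)) \<in> measurable N weak_borel"
proof (rule measurable_weak_borel_if_rational_cdf)
  have \<nu>P: "\<nu> n t \<in> prob_measures" if "t \<in> space N" for n t
    using measurable_space[OF \<nu> that] space_weak_borel by auto
  show "st_inf lo hi (\<lambda>n. \<nu> n t) \<in> prob_measures" if "t \<in> space N" for t
    by (rule st_inf_in_prob_measures[OF lo hi lohi \<nu>P[OF that]])
  fix q :: real
  have cdf_le: "cdf m r \<le> 1" "0 \<le> cdf m r" if "m \<in> prob_measures" for m r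
    using real_distribution.cdf_bounded_prob[OF real_distributionI[OF that]]
    by (auto simp: cdf_def)
  have [measurable]: "(\<lambda>t. cdf (\<nu> n t) r) \<in> borel_measurable N" for n r
    using measurable_compose[OF \<nu> borel_measurable_cdf_weak_borel] .
  have H: "(\<lambda>t. SUP n. max (cdf hi r) (min (cdf lo r) (cdf (\<nu> n t) r))) \<in> borel_measurable N" for r
    by (rule borel_measurable_cSUP)
       (auto intro!: bdd_aboveI[of _ "max (cdf hi r) (cdf lo r)"])
  have "(\<lambda>t. right_regularization (\<lambda>s. SUP n. max (cdf hi s) (min (cdf lo s) (cdf (\<nu> n t) s))) q)
      \<in> borel_measurable N"
    unfolding right_regularization_def
  proof (rule borel_measurable_cINF[OF _ H])
    show "countable {r \<in> \<rat>. q < r}" by (rule countable_subset[OF _ countable_rat]) auto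
    show "bdd_below ((\<lambda>r. SUP n. max (cdf hi r) (min (cdf lo r) (cdf (\<nu> n t) r))) ` {r \<in> \<rat>. q < r})" for t
    proof (rule bdd_belowI[of _ 0])
      fix y assume "y \<in> (\<lambda>r. SUP n. max (cdf hi r) (min (cdf lo r) (cdf (\<nu> n t) r))) ` {r \<in> \<rat>. q < r}"
      then obtain r where y: "y = (SUP n. max (cdf hi r) (min (cdf lo r) (cdf (\<nu> n t) r)))" by auto
      show "0 \<le> y" unfolding y
        by (rule cSUP_upper2[where x = 0])
           (use cdf_le(2)[OF hi] in \<open>auto intro!: bdd_aboveI[of _ "max (cdf hi r) (cdf lo r)"] simp: le_max_iff_disj\<close>)
    qed
  qed
  then show "(\<lambda>t. cdf (st_inf lo hi (\<lambda>n. \<nu> n t)) q) \<in> borel_measurable N"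
    by (rule measurable_cong[THEN iffD1, rotated]) (simp add: cdf_st_inf[OF lo hi lohi \<nu>P])
qed



section \<open>Essential suprema over countable subfamilies\<close>

text \<open>Choose a sequence for which the integral of the supremum is as large as possible; it exists, since
  maximizing sequences can be merged into one. Adjoining a further member of the family does not
  increase this integral, so it raises the supremum only on a null set.\<close>

lemma (in finite_measure) essential_sup_sequence:
  fixes f :: "'i \<Rightarrow> 'a \<Rightarrow> real"
  assumes ne: "A \<noteq> {}" and meas: "\<And>i. i \<in> A \<Longrightarrow> f i \<in> borel_measurable M"
    and bd: "\<And>i x. i \<in> A \<Longrightarrow> x \<in> space M \<Longrightarrow> f i x \<in> {0..1}"
  shows "\<exists>\<nu>::nat \<Rightarrow> 'i. range \<nu> \<subseteq> A \<and> (\<forall>i\<in>A. AE x in M. f i x \<le> (SUP n. f (\<nu> n) x))"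
proof -
  define S where "S \<nu> x = (SUP n. f (\<nu> n) x)" for \<nu> :: "nat \<Rightarrow> 'i" and x
  define I where "I \<nu> = (\<integral>x. S \<nu> x \<partial>M)" for \<nu>
  define Q where "Q = {\<nu> :: nat \<Rightarrow> 'i. range \<nu> \<subseteq> A}"
  have bdd: "bdd_above (range (\<lambda>n. f (\<nu> n) x))" if "\<nu> \<in> Q" "x \<in> space M" for \<nu> x
    using that bd by (intro bdd_aboveI[of _ 1]) (auto simp: Q_def)
  have S_ge: "f (\<nu> n) x \<le> S \<nu> x" if "\<nu> \<in> Q" "x \<in> space M" for \<nu> n x
    unfolding S_def by (rule cSUP_upper[OF _ bdd[OF that]]) simp
  have S_bd: "S \<nu> x \<in> {0..1}" if "\<nu> \<in> Q" "x \<in> space M" for \<nu> x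
  proof -
    have in01: "f (\<nu> n) x \<in> {0..1}" for n using that bd by (auto simp: Q_def)
    then have "S \<nu> x \<le> 1" unfolding S_def by (intro cSUP_least) auto
    then show ?thesis using S_ge[OF that, of 0] in01[of 0] by auto
  qed
  have S_meas: "S \<nu> \<in> borel_measurable M" if "\<nu> \<in> Q" for \<nu>
  proof -
    have "f (\<nu> n) \<in> borel_measurable M" for n using that meas by (simp add: Q_def image_subset_iff)
    then show ?thesis unfolding S_def[abs_def] using bdd[OF that] by (intro borel_measurable_cSUP) simp_all
  qed
  have S_int: "integrable M (S \<nu>)" if "\<nu> \<in> Q" for \<nu>
    by (rule integrable_const_bound[of _ 1]) (use S_bd[OF that] S_meas[OF that] in auto)
  have S_mono: "S \<nu> x \<le> S \<kappa> x" if \<nu>\<kappa>: "\<nu> \<in> Q" "\<kappa> \<in> Q" "range \<nu> \<subseteq> range \<kappa>" "x \<in> space M" for \<nu> \<kappa> x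
    unfolding S_def
  proof (rule cSUP_least)
    fix n
    obtain k where "\<nu> n = \<kappa> k" using \<nu>\<kappa>(3) by blast
    then show "f (\<nu> n) x \<le> (SUP n. f (\<kappa> n) x)" using S_ge[OF \<nu>\<kappa>(2,4), of k] by (simp add: S_def)
  qed simp
  have I_mono: "I \<nu> \<le> I \<kappa>" if "\<nu> \<in> Q" "\<kappa> \<in> Q" "range \<nu> \<subseteq> range \<kappa>" for \<nu> \<kappa>
    unfolding I_def by (rule integral_mono[OF S_int S_int]) (use that S_mono in auto)
  have I_le: "I \<nu> \<le> measure M (space M)" if "\<nu> \<in> Q" for \<nu>
    using integral_mono[OF S_int[OF that] integrable_const[of 1]] S_bd[OF that] by (simp add: I_def)
  obtain i0 where "i0 \<in> A" using ne by blast
  then have "(\<lambda>_. i0) \<in> Q" by (simp add: Q_def image_subset_iff)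
  then have Q_ne: "Q \<noteq> {}" by blast
  define c where "c = (SUP \<nu>\<in>Q. I \<nu>)"
  have bddI: "bdd_above (I ` Q)" using I_le by (intro bdd_aboveI) auto
  have "\<exists>\<nu>\<in>Q. c - inverse (real (Suc k)) < I \<nu>" for k
    using less_cSUP_iff[OF Q_ne bddI, of "c - inverse (real (Suc k))"] unfolding c_def[symmetric] by simp
  then have "\<forall>k. \<exists>\<nu>. \<nu> \<in> Q \<and> c - inverse (real (Suc k)) < I \<nu>" by blast
  from choice[OF this] obtain \<kappa> where \<kappa>: "\<And>k. \<kappa> k \<in> Q" "\<And>k. c - inverse (real (Suc k)) < I (\<kappa> k)" by blast
  define \<nu> where "\<nu> n = (case prod_decode n of (k, j) \<Rightarrow> \<kappa> k j)" for n
  have \<nu>: "\<nu> \<in> Q" using \<kappa>(1) by (simp add: Q_def \<nu>_def image_subset_iff split: prod.split)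
  have "\<kappa> k j = \<nu> (prod_encode (k, j))" for k j by (simp add: \<nu>_def)
  then have "range (\<kappa> k) \<subseteq> range \<nu>" for k by auto
  then have "c - inverse (real (Suc k)) \<le> I \<nu>" for k
    using \<kappa>(2)[of k] I_mono[OF \<kappa>(1) \<nu>] by (meson less_imp_le less_le_trans)
  moreover have "(\<lambda>k. c - inverse (real (Suc k))) \<longlonglongrightarrow> c"
    using tendsto_diff[OF tendsto_const LIMSEQ_inverse_real_of_nat] by simp
  ultimately have c_le: "c \<le> I \<nu>"
    by (intro LIMSEQ_le_const2) auto
  show ?thesis
  proof (intro exI conjI ballI)
    show "range \<nu> \<subseteq> A" using \<nu> by (simp add: Q_def)
    fix i assume i: "i \<in> A"
    \<comment> \<open>The sequence \<open>\<nu>\<close> with \<open>i\<close> put in front.\<close>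
    define \<nu>' where "\<nu>' n = (case n of 0 \<Rightarrow> i | Suc k \<Rightarrow> \<nu> k)" for n
    have \<nu>': "\<nu>' \<in> Q" using i \<nu> by (simp add: Q_def \<nu>'_def image_subset_iff split: nat.split)
    have "\<nu> k = \<nu>' (Suc k)" for k by (simp add: \<nu>'_def)
    then have sub: "range \<nu> \<subseteq> range \<nu>'" by auto
    have "I \<nu>' \<le> c" unfolding c_def by (rule cSUP_upper[OF \<nu>' bddI])
    then have eq: "(\<integral>x. S \<nu>' x - S \<nu> x \<partial>M) = 0"
      using c_le I_mono[OF \<nu> \<nu>' sub] by (simp add: I_def Bochner_Integration.integral_diff[OF S_int[OF \<nu>'] S_int[OF \<nu>]])
    have "AE x in M. S \<nu>' x - S \<nu> x = 0"
      by (rule integral_nonneg_eq_0_iff_AE[THEN iffD1, OF _ _ eq])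
         (simp_all add: S_int[OF \<nu>] S_int[OF \<nu>'] S_mono[OF \<nu> \<nu>' sub])
    then show "AE x in M. f i x \<le> (SUP n. f (\<nu> n) x)"
    proof (rule AE_mp, intro AE_I2 impI)
      fix x assume "x \<in> space M" "S \<nu>' x - S \<nu> x = 0"
      then show "f i x \<le> (SUP n. f (\<nu> n) x)"
        using S_ge[OF \<nu>', of x 0] by (simp add: \<nu>'_def S_def)
    qed
  qed
qed

text \<open>The sequences obtained for the individual \<open>k\<close> are merged into one.\<close>

lemma (in finite_measure) essential_sup_sequence_simultaneous:
  fixes f :: "'k \<Rightarrow> 'i \<Rightarrow> 'a \<Rightarrow> real"
  assumes K: "countable K" "K \<noteq> {}" and ne: "A \<noteq> {}"
    and meas: "\<And>k i. k \<in> K \<Longrightarrow> i \<in> A \<Longrightarrow> f k i \<in> borel_measurable M"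
    and bd: "\<And>k i x. k \<in> K \<Longrightarrow> i \<in> A \<Longrightarrow> x \<in> space M \<Longrightarrow> f k i x \<in> {0..1}"
  shows "\<exists>\<nu>::nat \<Rightarrow> 'i. range \<nu> \<subseteq> A \<and> (\<forall>i\<in>A. AE x in M. \<forall>k\<in>K. f k i x \<le> (SUP n. f k (\<nu> n) x))"
proof -
  have "\<forall>k\<in>K. \<exists>\<nu>::nat \<Rightarrow> 'i. range \<nu> \<subseteq> A \<and> (\<forall>i\<in>A. AE x in M. f k i x \<le> (SUP n. f k (\<nu> n) x))"
  proof
    fix k assume "k \<in> K"
    then show "\<exists>\<nu>::nat \<Rightarrow> 'i. range \<nu> \<subseteq> A \<and> (\<forall>i\<in>A. AE x in M. f k i x \<le> (SUP n. f k (\<nu> n) x))"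
      by (intro essential_sup_sequence[OF ne]) (use meas bd in blast)+
  qed
  from bchoice[OF this] obtain \<kappa> :: "'k \<Rightarrow> nat \<Rightarrow> 'i" where \<kappa>': "\<forall>k\<in>K. range (\<kappa> k) \<subseteq> A \<and>
    (\<forall>i\<in>A. AE x in M. f k i x \<le> (SUP n. f k (\<kappa> k n) x))"
    by blast
  then have \<kappa>: "range (\<kappa> k) \<subseteq> A" "\<And>i. i \<in> A \<Longrightarrow> AE x in M. f k i x \<le> (SUP n. f k (\<kappa> k n) x)" if "k \<in> K" for k
    using that by blast+
  define \<nu> where "\<nu> n = (case prod_decode n of (k, j) \<Rightarrow> \<kappa> (from_nat_into K k) j)" for n
  have fK: "from_nat_into K k \<in> K" for k by (rule from_nat_into[OF K(2)])
  have \<nu>: "range \<nu> \<subseteq> A" using \<kappa>(1)[OF fK] by (simp add: \<nu>_def image_subset_iff split: prod.split)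
  have sub: "\<exists>m. \<kappa> k j = \<nu> m" if k: "k \<in> K" for k j
  proof -
    obtain l where "from_nat_into K l = k" using from_nat_into_surj[OF K(1) k] by blast
    then show ?thesis by (intro exI[of _ "prod_encode (l, j)"]) (simp add: \<nu>_def)
  qed
  show ?thesis
  proof (intro exI[of _ \<nu>] conjI ballI \<nu>)
    fix i assume i: "i \<in> A"
    have "AE x in M. \<forall>k\<in>K. f k i x \<le> (SUP n. f k (\<kappa> k n) x)"
      using \<kappa>(2) i by (subst AE_ball_countable[OF K(1)]) auto
    then show "AE x in M. \<forall>k\<in>K. f k i x \<le> (SUP n. f k (\<nu> n) x)"
    proof (rule AE_mp, intro AE_I2 impI ballI)
      fix x k assume x: "x \<in> space M" "\<forall>k\<in>K. f k i x \<le> (SUP n. f k (\<kappa> k n) x)" and k: "k \<in> K"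
      have "(SUP n. f k (\<kappa> k n) x) \<le> (SUP n. f k (\<nu> n) x)"
      proof (rule cSUP_mono)
        show "bdd_above (range (\<lambda>n. f k (\<nu> n) x))"
          using bd[OF k _ x(1)] \<nu> by (intro bdd_aboveI[of _ 1]) fastforce
        show "\<exists>m\<in>UNIV. f k (\<kappa> k n) x \<le> f k (\<nu> m) x" for n
          using sub[OF k, of n] by force
      qed simp
      then show "f k i x \<le> (SUP n. f k (\<nu> n) x)" using x k by force
    qed
  qed
qed


section \<open>The complete lattice of flows\<close>

lemma cdf_nonneg_le_1:
  assumes "m \<in> prob_measures"
  shows "cdf m s \<in> {0..1}"
  using real_distribution.cdf_bounded_prob[OF real_distributionI[OF assms]] by (simp add: cdf_def)

text \<open>Both extremal distribution functions come from the one continuous nonincreasing function \<open>h\<close>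
  below, which tends to 1 on the left and to 0 on the right.\<close>

lemma
  assumes \<psi>: "continuous_on {0..} \<psi>" "strict_mono_on {0..} \<psi>" "filterlim \<psi> at_top at_top"
    and M: "0 < M" "\<psi> 0 < M"
  shows mu_Min_in_prob_measures: "mu_Min \<psi> M \<in> prob_measures"
    and cdf_mu_Min: "cdf (mu_Min \<psi> M) s = M / max M (\<psi> (max 0 (- s)))"
    and mu_Max_in_prob_measures: "mu_Max \<psi> M \<in> prob_measures"
    and cdf_mu_Max: "cdf (mu_Max \<psi> M) s = 1 - M / max M (\<psi> (max 0 s))"
    and mu_Min_le_mu_Max: "mu_Min \<psi> M \<le>st mu_Max \<psi> M"
proof -
  have ext: "ext_left \<psi> s = \<psi> (max 0 s)" for s
    by (simp add: ext_left_def max_def)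
  define h where "h s = M / max M (\<psi> (max 0 s))" for s
  have h_cont: "continuous_on UNIV h"
    unfolding h_def using M by (intro continuous_intros continuous_on_compose2[OF \<psi>(1)]) auto
  have \<psi>_mono: "\<psi> x \<le> \<psi> y" if "0 \<le> x" "x \<le> y" for x y
    using strict_mono_on_leD[OF \<psi>(2), of x y] that by auto
  have h_mono: "h t \<le> h s" if "s \<le> t" for s t
  proof -
    have "\<psi> (max 0 s) \<le> \<psi> (max 0 t)" using that by (intro \<psi>_mono) auto
    then show ?thesis unfolding h_def using M by (intro divide_left_mono mult_pos_pos) auto
  qed
  have h_top: "(h \<longlongrightarrow> 0) at_top"
    unfolding h_def
  proof (rule tendsto_divide_0[OF tendsto_const])
    have "filterlim (\<lambda>s. max M (\<psi> (max 0 s))) at_top at_top"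
    proof (rule filterlim_at_top_mono[OF \<psi>(3)])
      show "\<forall>\<^sub>F s in at_top. \<psi> s \<le> max M (\<psi> (max 0 s))"
        using eventually_ge_at_top[of 0] by eventually_elim auto
    qed
    then show "filterlim (\<lambda>s. max M (\<psi> (max 0 s))) at_infinity at_top"
      by (rule filterlim_at_top_imp_at_infinity)
  qed
  have h_bot: "(h \<longlongrightarrow> 1) at_bot"
  proof (rule tendsto_eventually)
    show "\<forall>\<^sub>F s in at_bot. h s = 1"
      using eventually_le_at_bot[of 0] by eventually_elim (use M in \<open>auto simp: h_def max_def\<close>)
  qed
  have Min: "mu_Min \<psi> M = interval_measure (\<lambda>s. h (- s))"
    unfolding mu_Min_def ext h_def using M by (intro arg_cong[of _ _ interval_measure]) (auto simp: max_def)
  have Max: "mu_Max \<psi> M = interval_measure (\<lambda>s. 1 - h s)"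
    unfolding mu_Max_def ext h_def using M by (intro arg_cong[of _ _ interval_measure]) (auto simp: max_def)
  have h_at: "continuous (at_right a) h" for a
    using h_cont by (auto simp: continuous_on_eq_continuous_at intro: continuous_at_imp_continuous_within)
  have hm_at: "continuous (at_right a) (\<lambda>s. h (- s))" for a
  proof -
    have "continuous_on UNIV (\<lambda>s. h (- s))"
      by (intro continuous_on_compose2[OF h_cont] continuous_intros) auto
    then show ?thesis by (auto simp: continuous_on_eq_continuous_at intro: continuous_at_imp_continuous_within)
  qed
  have Min_lims: "((\<lambda>s. h (- s)) \<longlongrightarrow> 0) at_bot" "((\<lambda>s. h (- s)) \<longlongrightarrow> 1) at_top"
    by (rule filterlim_compose[OF h_top filterlim_uminus_at_top_at_bot]
             filterlim_compose[OF h_bot filterlim_uminus_at_bot_at_top])+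
  have Max_lims: "((\<lambda>s. 1 - h s) \<longlongrightarrow> 0) at_bot" "((\<lambda>s. 1 - h s) \<longlongrightarrow> 1) at_top"
    using tendsto_diff[OF tendsto_const h_bot, of 1] tendsto_diff[OF tendsto_const h_top, of 1] by auto
  show "mu_Min \<psi> M \<in> prob_measures"
    unfolding Min by (intro prob_measuresI real_distribution_interval_measure Min_lims hm_at h_mono) auto
  show "mu_Max \<psi> M \<in> prob_measures"
    unfolding Max
    by (intro prob_measuresI real_distribution_interval_measure Max_lims continuous_intros h_at)
       (auto intro: h_mono)
  have cMin: "cdf (mu_Min \<psi> M) = (\<lambda>s. h (- s))"
    unfolding Min by (intro cdf_interval_measure Min_lims hm_at h_mono) auto
  have cMax: "cdf (mu_Max \<psi> M) = (\<lambda>s. 1 - h s)"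
    unfolding Max by (intro cdf_interval_measure Max_lims continuous_intros h_at) (auto intro: h_mono)
  show "cdf (mu_Min \<psi> M) s = M / max M (\<psi> (max 0 (- s)))"
    "cdf (mu_Max \<psi> M) s = 1 - M / max M (\<psi> (max 0 s))"
    by (simp_all add: cMin cMax h_def)
  have "1 - h s \<le> h (- s)" for s
  proof (cases "s \<le> 0")
    case True
    then have "h s = 1" using M by (auto simp: h_def max_def)
    moreover have "h (- s) \<ge> 0" using M by (auto simp: h_def)
    ultimately show ?thesis by simp
  next
    case False
    then have "h (- s) = 1" using M by (auto simp: h_def max_def)
    moreover have "h s \<ge> 0" using M by (auto simp: h_def)
    ultimately show ?thesis by simp
  qed
  then show "mu_Min \<psi> M \<le>st mu_Max \<psi> M"
    by (simp add: st_le_def cMin cMax)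
qed

lemma space_time_pi: "space (time_pi G) = time_set G"
  and sets_time_pi: "sets (time_pi G) = sets (restrict_space borel (time_set G))"
proof -
  have "sets (restrict_space borel (time_set G)) \<subseteq> Pow (time_set G)"
    using sets.space_closed[of "restrict_space borel (time_set G)"] by (simp add: space_restrict_space)
  then show "space (time_pi G) = time_set G" "sets (time_pi G) = sets (restrict_space borel (time_set G))"
    using sets.sigma_sets_eq[of "restrict_space borel (time_set G)"]
    unfolding time_pi_def by (simp_all add: sets_measure_of space_measure_of space_restrict_space)
qed

lemma emeasure_time_pi:
  assumes "A \<in> sets (time_pi G)"
  shows "emeasure (time_pi G) A = indicator A 0 + emeasure lborel A + indicator A (horizon G)"
proof (rule emeasure_measure_of[OF time_pi_def _ _ _ assms])
  show "sets (restrict_space borel (time_set G)) \<subseteq> Pow (time_set G)"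
    using sets.space_closed[of "restrict_space borel (time_set G)"] by (simp add: space_restrict_space)
  show "positive (sets (time_pi G)) (\<lambda>A. indicator A 0 + emeasure lborel A + indicator A (horizon G))"
    by (simp add: positive_def)
  show "countably_additive (sets (time_pi G)) (\<lambda>A. indicator A 0 + emeasure lborel A + indicator A (horizon G))"
  proof (rule countably_additiveI)
    fix A :: "nat \<Rightarrow> real set"
    assume A: "range A \<subseteq> sets (time_pi G)" and d: "disjoint_family A"
    then have Ab: "range A \<subseteq> sets borel"
      by (auto simp: sets_time_pi sets_restrict_space_iff subset_iff)
    have ret: "(\<Sum>i. indicator (A i) x) = (indicator (\<Union>i. A i) x :: ennreal)" for x
      using suminf_emeasure[of A "return borel x"] d Ab by (simp add: subset_iff)
    have "(\<Sum>i. emeasure lborel (A i)) = emeasure lborel (\<Union>i. A i)"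
      using suminf_emeasure[of A lborel] d Ab by simp
    then show "(\<Sum>i. indicator (A i) 0 + emeasure lborel (A i) + indicator (A i) (horizon G)) =
        indicator (\<Union>i. A i) 0 + emeasure lborel (\<Union>i. A i) + indicator (\<Union>i. A i) (horizon G)"
      by (simp add: suminf_add[symmetric] ret)
  qed
qed

lemma finite_measure_time_pi: "finite_measure (time_pi G)"
proof
  have "space (time_pi G) \<in> sets (time_pi G)" by (rule sets.top)
  then have "emeasure (time_pi G) (space (time_pi G)) < \<infinity>"
    by (simp add: emeasure_time_pi space_time_pi indicator_def ennreal_add_less_top less_top[symmetric] del: sets.top split: if_splits)
  then show "emeasure (time_pi G) (space (time_pi G)) \<noteq> \<infinity>" by simp
qed

text \<open>The endpoints are atoms: classes of flows remember the initial law and the law entering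
  the terminal cost.\<close>

lemma AE_time_pi_iff:
  assumes T: "0 \<le> horizon G"
  shows "(AE t in time_pi G. P t) \<longleftrightarrow> P 0 \<and> P (horizon G) \<and> (AE t in time_leb G. P t)"
proof
  assume "AE t in time_pi G. P t"
  then obtain N where N: "{t \<in> space (time_pi G). \<not> P t} \<subseteq> N" "N \<in> sets (time_pi G)" "emeasure (time_pi G) N = 0"
    by (auto elim!: AE_E)
  then have N0: "0 \<notin> N" "horizon G \<notin> N" "emeasure lborel N = 0"
    by (auto simp: emeasure_time_pi indicator_def split: if_splits)
  have Nb: "N \<in> sets borel" "N \<subseteq> time_set G"
    using N(2) by (auto simp: sets_time_pi sets_restrict_space_iff)
  have "AE t in time_leb G. P t"
  proof (rule AE_I)
    show "{t \<in> space (time_leb G). \<not> P t} \<subseteq> N" using N(1) by (simp add: space_time_pi space_restrict_space)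
    show "emeasure (time_leb G) N = 0" using N0 Nb by (subst emeasure_restrict_space) auto
    show "N \<in> sets (time_leb G)" using Nb by (simp add: sets_restrict_space_iff)
  qed
  then show "P 0 \<and> P (horizon G) \<and> (AE t in time_leb G. P t)"
    using N(1) N0 T by (auto simp: space_time_pi)
next
  assume P: "P 0 \<and> P (horizon G) \<and> (AE t in time_leb G. P t)"
  then obtain N where N: "{t \<in> space (time_leb G). \<not> P t} \<subseteq> N" "N \<in> sets (time_leb G)" "emeasure (time_leb G) N = 0"
    by (auto elim!: AE_E)
  then have Nb: "N \<in> sets borel" "N \<subseteq> time_set G"
    by (auto simp: sets_restrict_space_iff)
  then have N0: "emeasure lborel N = 0" using N(3) by (subst (asm) emeasure_restrict_space) auto
  let ?N = "N - {0, horizon G}"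
  have Ns: "?N \<in> sets (time_pi G)" using Nb by (auto simp: sets_time_pi sets_restrict_space_iff)
  show "AE t in time_pi G. P t"
  proof (rule AE_I[OF _ _ Ns])
    show "{t \<in> space (time_pi G). \<not> P t} \<subseteq> ?N"
      using N(1) P by (auto simp: space_time_pi space_restrict_space)
    have "emeasure lborel ?N \<le> emeasure lborel N" using Nb by (intro emeasure_mono) auto
    then show "emeasure (time_pi G) ?N = 0" using N0 by (simp add: emeasure_time_pi[OF Ns])
  qed
qed

lemma flow_in_prob_measures: "\<mu> \<in> flows G \<Longrightarrow> t \<in> time_set G \<Longrightarrow> \<mu> t \<in> prob_measures"
  unfolding flows_def using measurable_space[of \<mu> "restrict_space borel (time_set G)" weak_borel t]
  by (simp add: space_restrict_space space_weak_borel)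

lemma AE_time_pi_in_time_set: "AE t in time_pi G. t \<in> time_set G"
  by (rule AE_I2) (simp add: space_time_pi)

text \<open>The order of the lattice of flows, read on representatives.\<close>

definition flow_le :: "'a mfg \<Rightarrow> (real \<Rightarrow> real measure) \<Rightarrow> (real \<Rightarrow> real measure) \<Rightarrow> bool"
  where "flow_le G \<mu> \<nu> \<longleftrightarrow> (AE t in time_pi G. \<mu> t \<le>st \<nu> t)"

lemma flow_le_refl: "flow_le G \<mu> \<mu>"
  by (simp add: flow_le_def st_le_refl)

lemma flow_le_trans:
  assumes "flow_le G \<mu> \<nu>" "flow_le G \<nu> \<kappa>"
  shows "flow_le G \<mu> \<kappa>"
  using assms unfolding flow_le_def by eventually_elim (rule st_le_trans)

lemma flow_eq_iff_flow_le:
  "(\<mu>, \<nu>) \<in> flow_eq G \<longleftrightarrow> \<mu> \<in> flows G \<and> \<nu> \<in> flows G \<and> flow_le G \<mu> \<nu> \<and> flow_le G \<nu> \<mu>"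
proof
  assume "(\<mu>, \<nu>) \<in> flow_eq G"
  then have *: "\<mu> \<in> flows G" "\<nu> \<in> flows G" and eq: "AE t in time_pi G. \<mu> t = \<nu> t" by (auto simp: flow_eq_def)
  have "flow_le G \<mu> \<nu>" "flow_le G \<nu> \<mu>"
    unfolding flow_le_def using eq by (eventually_elim, simp add: st_le_refl)+
  with * show "\<mu> \<in> flows G \<and> \<nu> \<in> flows G \<and> flow_le G \<mu> \<nu> \<and> flow_le G \<nu> \<mu>" by simp
next
  assume *: "\<mu> \<in> flows G \<and> \<nu> \<in> flows G \<and> flow_le G \<mu> \<nu> \<and> flow_le G \<nu> \<mu>"
  have "AE t in time_pi G. \<mu> t = \<nu> t"
    using AE_time_pi_in_time_set *[THEN conjunct2, THEN conjunct2, THEN conjunct1, unfolded flow_le_def]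
      *[THEN conjunct2, THEN conjunct2, THEN conjunct2, unfolded flow_le_def]
    by eventually_elim (rule st_le_antisym[OF flow_in_prob_measures flow_in_prob_measures], use * in \<open>auto\<close>)
  with * show "(\<mu>, \<nu>) \<in> flow_eq G" by (simp add: flow_eq_def)
qed

lemma equiv_flow_eq: "equiv (flows G) (flow_eq G)"
proof (rule equivI)
  show "flow_eq G \<subseteq> flows G \<times> flows G" by (auto simp: flow_eq_iff_flow_le)
  show "refl_on (flows G) (flow_eq G)" by (auto simp: refl_on_def flow_eq_iff_flow_le flow_le_refl)
  show "sym (flow_eq G)" by (auto simp: sym_def flow_eq_iff_flow_le)
  show "trans (flow_eq G)" by (auto simp: trans_def flow_eq_iff_flow_le intro: flow_le_trans)
qed

lemma flow_lattice_le_classes: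
  assumes "\<mu> \<in> flows G" "\<nu> \<in> flows G"
  shows "flow_lattice_le G (flow_eq G `` {\<mu>}) (flow_eq G `` {\<nu>}) \<longleftrightarrow> flow_le G \<mu> \<nu>"
proof
  assume "flow_lattice_le G (flow_eq G `` {\<mu>}) (flow_eq G `` {\<nu>})"
  moreover have "\<mu> \<in> flow_eq G `` {\<mu>}" "\<nu> \<in> flow_eq G `` {\<nu>}"
    using assms by (simp_all add: flow_eq_iff_flow_le flow_le_refl)
  ultimately show "flow_le G \<mu> \<nu>" unfolding flow_lattice_le_def flow_le_def by blast
next
  assume le: "flow_le G \<mu> \<nu>"
  have "flow_le G \<mu>' \<nu>'" if "\<mu>' \<in> flow_eq G `` {\<mu>}" "\<nu>' \<in> flow_eq G `` {\<nu>}" for \<mu>' \<nu>'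
  proof -
    from that have "flow_le G \<mu>' \<mu>" "flow_le G \<nu> \<nu>'" by (simp_all add: flow_eq_iff_flow_le)
    then show ?thesis using flow_le_trans[OF _ flow_le_trans[OF le]] by blast
  qed
  then show "flow_lattice_le G (flow_eq G `` {\<mu>}) (flow_eq G `` {\<nu>})"
    unfolding flow_lattice_le_def flow_le_def by blast
qed

definition admissible_flows :: "'a mfg \<Rightarrow> (real \<Rightarrow> real) \<Rightarrow> real \<Rightarrow> (real \<Rightarrow> real measure) set"
  where "admissible_flows G \<psi> M = {\<mu> \<in> flows G. \<mu> 0 = distr (pspace G) borel (init G) \<and>
       (AE t in time_pi G. 0 < t \<longrightarrow> mu_Min \<psi> M \<le>st \<mu> t \<and> \<mu> t \<le>st mu_Max \<psi> M)}"

lemma flow_lattice_eq: "flow_lattice G \<psi> M = (\<lambda>\<mu>. flow_eq G `` {\<mu>}) ` admissible_flows G \<psi> M"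
  by (auto simp: flow_lattice_def admissible_flows_def quotient_def)

abbreviation flow_order :: "'a mfg \<Rightarrow> (real \<Rightarrow> real) \<Rightarrow> real \<Rightarrow> (real \<Rightarrow> real measure) set gorder"
  where "flow_order G \<psi> M \<equiv> \<lparr>carrier = flow_lattice G \<psi> M, eq = (=), le = flow_lattice_le G\<rparr>"

text \<open>Antisymmetry is where passing to classes matters: flows below each other in both directions agree
  only almost everywhere.\<close>

lemma partial_order_flow_order: "partial_order (flow_order G \<psi> M)"
proof -
  have adm: "\<mu> \<in> flows G" if "\<mu> \<in> admissible_flows G \<psi> M" for \<mu>
    using that by (simp add: admissible_flows_def)
  show ?thesis
  proof
    fix x assume "x \<in> carrier (flow_order G \<psi> M)"
    then show "x \<sqsubseteq>\<^bsub>flow_order G \<psi> M\<^esub> x"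
      by (auto simp: flow_lattice_eq flow_lattice_le_classes adm flow_le_refl)
  next
    fix x y assume *: "x \<sqsubseteq>\<^bsub>flow_order G \<psi> M\<^esub> y" "y \<sqsubseteq>\<^bsub>flow_order G \<psi> M\<^esub> x"
      "x \<in> carrier (flow_order G \<psi> M)" "y \<in> carrier (flow_order G \<psi> M)"
    then obtain \<mu> \<nu> where \<mu>\<nu>: "x = flow_eq G `` {\<mu>}" "y = flow_eq G `` {\<nu>}" "\<mu> \<in> flows G" "\<nu> \<in> flows G"
      by (auto simp: flow_lattice_eq adm)
    then have "(\<mu>, \<nu>) \<in> flow_eq G"
      using *(1,2) by (simp add: flow_lattice_le_classes flow_eq_iff_flow_le)
    then show "x .=\<^bsub>flow_order G \<psi> M\<^esub> y"
      using \<mu>\<nu> equiv_class_eq[OF equiv_flow_eq] by auto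
  next
    fix x y z assume *: "x \<sqsubseteq>\<^bsub>flow_order G \<psi> M\<^esub> y" "y \<sqsubseteq>\<^bsub>flow_order G \<psi> M\<^esub> z"
      "x \<in> carrier (flow_order G \<psi> M)" "y \<in> carrier (flow_order G \<psi> M)" "z \<in> carrier (flow_order G \<psi> M)"
    then show "x \<sqsubseteq>\<^bsub>flow_order G \<psi> M\<^esub> z"
      by (auto simp: flow_lattice_eq flow_lattice_le_classes adm intro: flow_le_trans)
  qed simp_all
qed

text \<open>It suffices to have a greatest element and infima of nonempty sets. The infimum is built from a
  sequence \<open>\<nu>\<close> along which the essential suprema of all distribution functions at rational points
  are attained: the pointwise infimum \<open>\<iota>\<close> of this sequence lies below every member of the set
  almost everywhere, and a common lower bound of the set lies below all of \<open>\<nu>\<close>, hence below \<open>\<iota>\<close>.\<close>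

lemma complete_lattice_flow_order:
  assumes prob: "prob_space (pspace G)" and T: "0 < horizon G"
    and init: "init G \<in> borel_measurable (pspace G)"
    and lo: "mu_Min \<psi> M \<in> prob_measures" and hi: "mu_Max \<psi> M \<in> prob_measures"
    and lohi: "mu_Min \<psi> M \<le>st mu_Max \<psi> M"
  shows "complete_lattice (flow_order G \<psi> M)"
proof -
  interpret L: partial_order "flow_order G \<psi> M" by (rule partial_order_flow_order)
  interpret tp: finite_measure "time_pi G" by (rule finite_measure_time_pi)
  define law0 where "law0 = distr (pspace G) borel (init G)"
  have law0: "law0 \<in> prob_measures"
    unfolding law0_def by (rule distr_in_prob_measures[OF prob init])
  let ?S = "admissible_flows G \<psi> M"
  have S: "\<mu> \<in> flows G" "\<mu> 0 = law0"
    "AE t in time_pi G. 0 < t \<longrightarrow> mu_Min \<psi> M \<le>st \<mu> t \<and> \<mu> t \<le>st mu_Max \<psi> M" if "\<mu> \<in> ?S" for \<mu>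
    using that by (simp_all add: admissible_flows_def law0_def)
  have start: "(\<lambda>t. if t = 0 then law0 else \<mu> t) \<in> flows G"
    if "\<mu> \<in> measurable (restrict_space borel (time_set G)) weak_borel" for \<mu>
    unfolding flows_def
  proof (rule measurable_If[OF _ that])
    show "(\<lambda>t. law0) \<in> restrict_space borel (time_set G) \<rightarrow>\<^sub>M weak_borel"
      by (rule measurable_const) (use law0 in \<open>simp add: space_weak_borel\<close>)
    have "{x \<in> space (restrict_space borel (time_set G)). x = 0} = {0}"
      using T by (auto simp: space_restrict_space)
    then show "{x \<in> space (restrict_space borel (time_set G)). x = 0} \<in> sets (restrict_space borel (time_set G))"
      using T by (auto simp: sets_restrict_space_iff)
  qed
  show ?thesis
  proof (rule L.complete_lattice_criterion1)
    define \<tau> where "\<tau> t = (if t = 0 then law0 else mu_Max \<psi> M)" for t :: real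
    have \<tau>: "\<tau> \<in> ?S"
    proof -
      have "\<tau> \<in> flows G"
        unfolding \<tau>_def[abs_def]
        by (rule start, rule measurable_const) (use hi in \<open>simp add: space_weak_borel\<close>)
      moreover have "\<tau> 0 = distr (pspace G) borel (init G)" by (simp add: \<tau>_def law0_def)
      moreover have "AE t in time_pi G. 0 < t \<longrightarrow> mu_Min \<psi> M \<le>st \<tau> t \<and> \<tau> t \<le>st mu_Max \<psi> M"
        by (rule AE_I2) (simp add: \<tau>_def st_le_refl lohi)
      ultimately show ?thesis by (simp add: admissible_flows_def)
    qed
    show "\<exists>g. greatest (flow_order G \<psi> M) g (carrier (flow_order G \<psi> M))"
    proof (rule exI, unfold greatest_def, intro conjI ballI)
      show "flow_eq G `` {\<tau>} \<in> carrier (flow_order G \<psi> M)" using \<tau> by (auto simp: flow_lattice_eq)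
      fix x assume "x \<in> carrier (flow_order G \<psi> M)"
      then obtain \<mu> where \<mu>: "\<mu> \<in> ?S" "x = flow_eq G `` {\<mu>}" by (auto simp: flow_lattice_eq)
      have "flow_le G \<mu> \<tau>"
        unfolding flow_le_def using S(3)[OF \<mu>(1)] AE_time_pi_in_time_set
        by eventually_elim (use S(2)[OF \<mu>(1)] in \<open>auto simp: \<tau>_def st_le_refl\<close>)
      then show "x \<sqsubseteq>\<^bsub>flow_order G \<psi> M\<^esub> flow_eq G `` {\<tau>}"
        using \<mu> \<tau> S(1) by (simp add: flow_lattice_le_classes)
    qed simp
  next
    fix A assume A: "A \<subseteq> carrier (flow_order G \<psi> M)" "A \<noteq> {}"
    define B where "B = {\<mu> \<in> ?S. flow_eq G `` {\<mu>} \<in> A}"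
    have A_eq: "A = (\<lambda>\<mu>. flow_eq G `` {\<mu>}) ` B" using A(1) by (auto simp: B_def flow_lattice_eq)
    have B: "B \<noteq> {}" "\<And>\<mu>. \<mu> \<in> B \<Longrightarrow> \<mu> \<in> ?S"
      using A(2) A_eq by blast (simp add: B_def)
    have "\<exists>\<nu>::nat \<Rightarrow> real \<Rightarrow> real measure. range \<nu> \<subseteq> B \<and>
        (\<forall>\<mu>\<in>B. AE t in time_pi G. \<forall>q\<in>\<rat>. cdf (\<mu> t) q \<le> (SUP n. cdf (\<nu> n t) q))"
    proof (rule tp.essential_sup_sequence_simultaneous[OF countable_rat _ B(1)])
      show "\<rat> \<noteq> ({} :: real set)" using Rats_0 by blast
      fix q \<mu> assume \<mu>: "\<mu> \<in> B"
      have "(\<lambda>t. cdf (\<mu> t) q) \<in> borel_measurable (restrict_space borel (time_set G))"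
        using measurable_compose[OF S(1)[OF B(2)[OF \<mu>], unfolded flows_def] borel_measurable_cdf_weak_borel] .
      then show "(\<lambda>t. cdf (\<mu> t) q) \<in> borel_measurable (time_pi G)"
        by (simp add: measurable_cong_sets[OF sets_time_pi refl])
      show "cdf (\<mu> t) q \<in> {0..1}" if "t \<in> space (time_pi G)" for t
        using that by (intro cdf_nonneg_le_1 flow_in_prob_measures[OF S(1)[OF B(2)[OF \<mu>]]]) (simp add: space_time_pi)
    qed
    then obtain \<nu> :: "nat \<Rightarrow> real \<Rightarrow> real measure" where \<nu>: "\<And>n. \<nu> n \<in> B"
      and ess: "\<And>\<mu>. \<mu> \<in> B \<Longrightarrow> AE t in time_pi G. \<forall>q\<in>\<rat>. cdf (\<mu> t) q \<le> (SUP n. cdf (\<nu> n t) q)"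
      by (auto simp: image_subset_iff)
    have \<nu>S: "\<nu> n \<in> ?S" for n using \<nu> B by auto
    define \<iota> where "\<iota> t = (if t = 0 then law0 else st_inf (mu_Min \<psi> M) (mu_Max \<psi> M) (\<lambda>n. \<nu> n t))" for t
    have \<nu>P: "\<nu> n t \<in> prob_measures" if "t \<in> time_set G" for n t
      by (rule flow_in_prob_measures[OF S(1)[OF \<nu>S] that])
    have \<iota>: "\<iota> \<in> ?S"
    proof -
      have "\<iota> \<in> flows G"
        unfolding \<iota>_def by (rule start[OF measurable_st_inf[OF lo hi lohi S(1)[OF \<nu>S, unfolded flows_def]]])
      moreover have "AE t in time_pi G. 0 < t \<longrightarrow> mu_Min \<psi> M \<le>st \<iota> t \<and> \<iota> t \<le>st mu_Max \<psi> M"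
        using AE_time_pi_in_time_set
        by eventually_elim (simp add: \<iota>_def st_inf_between[OF lo hi lohi \<nu>P])
      ultimately show ?thesis by (simp add: admissible_flows_def \<iota>_def law0_def)
    qed
    have bounds: "AE t in time_pi G. \<forall>n. 0 < t \<longrightarrow> mu_Min \<psi> M \<le>st \<nu> n t \<and> \<nu> n t \<le>st mu_Max \<psi> M"
      unfolding AE_all_countable using S(3)[OF \<nu>S] by blast
    have lower: "flow_le G \<iota> \<mu>" if "\<mu> \<in> B" for \<mu>
      unfolding flow_le_def using bounds ess[OF that] AE_time_pi_in_time_set
    proof eventually_elim
      case (elim t)
      show ?case
      proof (cases "t = 0")
        case True then show ?thesis using S(2)[OF B(2)[OF that]] by (simp add: \<iota>_def st_le_refl)
      next
        case False
        have "st_inf (mu_Min \<psi> M) (mu_Max \<psi> M) (\<lambda>n. \<nu> n t) \<le>st \<mu> t"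
          by (rule st_inf_le[OF lo hi lohi \<nu>P _ _ flow_in_prob_measures[OF S(1)[OF B(2)[OF that]]]])
             (use False elim in auto)
        then show ?thesis using False by (simp add: \<iota>_def)
      qed
    qed
    have greatest: "flow_le G \<kappa> \<iota>" if \<kappa>: "\<kappa> \<in> ?S" "\<And>\<mu>. \<mu> \<in> B \<Longrightarrow> flow_le G \<kappa> \<mu>" for \<kappa>
    proof -
      have "AE t in time_pi G. \<forall>n. \<kappa> t \<le>st \<nu> n t"
        unfolding AE_all_countable using \<kappa>(2)[OF \<nu>] unfolding flow_le_def by blast
      then show ?thesis
        unfolding flow_le_def using S(3)[OF \<kappa>(1)] AE_time_pi_in_time_set
      proof eventually_elim
        case (elim t)
        show ?case
        proof (cases "t = 0")
          case True then show ?thesis using S(2)[OF \<kappa>(1)] by (simp add: \<iota>_def st_le_refl)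
        next
          case False
          have "\<kappa> t \<le>st st_inf (mu_Min \<psi> M) (mu_Max \<psi> M) (\<lambda>n. \<nu> n t)"
            by (rule st_le_st_inf[OF lo hi lohi \<nu>P flow_in_prob_measures[OF S(1)[OF \<kappa>(1)]]])
               (use False elim in auto)
          then show ?thesis using False by (simp add: \<iota>_def)
        qed
      qed
    qed
    show "\<exists>i. greatest (flow_order G \<psi> M) i (Lower (flow_order G \<psi> M) A)"
    proof (rule exI, unfold greatest_def, intro conjI ballI)
      show "Lower (flow_order G \<psi> M) A \<subseteq> carrier (flow_order G \<psi> M)" by (rule Lower_closed)
      show "flow_eq G `` {\<iota>} \<in> Lower (flow_order G \<psi> M) A"
      proof -
        have "flow_lattice_le G (flow_eq G `` {\<iota>}) a" if "a \<in> A" for a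
        proof -
          from that obtain \<mu> where "\<mu> \<in> B" "a = flow_eq G `` {\<mu>}" using A_eq by blast
          then show ?thesis using lower S(1)[OF \<iota>] S(1)[OF B(2)] by (simp add: flow_lattice_le_classes)
        qed
        then show ?thesis using \<iota> by (simp add: Lower_def flow_lattice_eq)
      qed
      fix x assume x: "x \<in> Lower (flow_order G \<psi> M) A"
      then obtain \<kappa> where \<kappa>: "\<kappa> \<in> ?S" "x = flow_eq G `` {\<kappa>}" by (auto simp: Lower_def flow_lattice_eq)
      have "flow_le G \<kappa> \<mu>" if "\<mu> \<in> B" for \<mu>
      proof -
        have "flow_eq G `` {\<mu>} \<in> A" using that A_eq by blast
        then have "flow_lattice_le G (flow_eq G `` {\<kappa>}) (flow_eq G `` {\<mu>})"
          using x A(1) unfolding \<kappa>(2) Lower_def by auto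
        then show ?thesis using S(1)[OF \<kappa>(1)] S(1)[OF B(2)[OF that]] by (simp add: flow_lattice_le_classes)
      qed
      then show "x \<sqsubseteq>\<^bsub>flow_order G \<psi> M\<^esub> flow_eq G `` {\<iota>}"
        using greatest[OF \<kappa>(1)] \<kappa> \<iota> S(1) by (simp add: flow_lattice_le_classes)
    qed
  qed
qed


section \<open>Exchange of extended-real-valued integrals\<close>

lemma enn2ereal_eq_ereal_enn2real: "a < \<infinity> \<Longrightarrow> enn2ereal a = ereal (enn2real a)"
  by (cases a) (auto simp: enn2ereal_ennreal)

text \<open>If the negative part had infinite integral, the positive part would have a finite one and the
  integral would be \<open>- \<infinity>\<close>.\<close>

lemma ereal_integral_neg_part:
  assumes "ereal_integral_defined N h" "- \<infinity> < ereal_integral N h"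
  shows "(\<integral>\<^sup>+ x. e2ennreal (- h x) \<partial>N) < \<infinity>"
proof (rule ccontr)
  assume "\<not> ?thesis"
  then have inf: "(\<integral>\<^sup>+ x. e2ennreal (- h x) \<partial>N) = \<infinity>" by (simp add: less_top[symmetric])
  then have "(\<integral>\<^sup>+ x. e2ennreal (h x) \<partial>N) < \<infinity>" using assms(1) by (simp add: ereal_integral_defined_def)
  from enn2ereal_eq_ereal_enn2real[OF this] have "ereal_integral N h = - \<infinity>"
    unfolding ereal_integral_def inf by simp
  then show False using assms(2) by simp
qed

lemma ereal_integral_pos_part:
  assumes "ereal_integral_defined N h" "ereal_integral N h < \<infinity>"
  shows "(\<integral>\<^sup>+ x. e2ennreal (h x) \<partial>N) < \<infinity>"
proof (rule ccontr)
  assume "\<not> ?thesis"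
  then have inf: "(\<integral>\<^sup>+ x. e2ennreal (h x) \<partial>N) = \<infinity>" by (simp add: less_top[symmetric])
  then have "(\<integral>\<^sup>+ x. e2ennreal (- h x) \<partial>N) < \<infinity>" using assms(1) by (simp add: ereal_integral_defined_def)
  from enn2ereal_eq_ereal_enn2real[OF this] have "ereal_integral N h = \<infinity>"
    unfolding ereal_integral_def inf by simp
  then show False using assms(2) by simp
qed

lemma ereal_integral_eq_integral:
  assumes [measurable]: "h \<in> borel_measurable N"
    and pos: "(\<integral>\<^sup>+ x. e2ennreal (h x) \<partial>N) < \<infinity>" and neg: "(\<integral>\<^sup>+ x. e2ennreal (- h x) \<partial>N) < \<infinity>"
  shows "AE x in N. \<bar>h x\<bar> \<noteq> \<infinity>"
    and "integrable N (\<lambda>x. real_of_ereal (h x))"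
    and "ereal_integral N h = ereal (\<integral>x. real_of_ereal (h x) \<partial>N)"
proof -
  have "AE x in N. e2ennreal (h x) \<noteq> \<infinity>" "AE x in N. e2ennreal (- h x) \<noteq> \<infinity>"
    by (rule nn_integral_PInf_AE; use pos neg in simp)+
  then show fin: "AE x in N. \<bar>h x\<bar> \<noteq> \<infinity>"
  proof eventually_elim
    case (elim x)
    then show ?case by (cases "h x") auto
  qed
  have p: "(\<integral>\<^sup>+ x. ennreal (real_of_ereal (h x)) \<partial>N) = (\<integral>\<^sup>+ x. e2ennreal (h x) \<partial>N)"
    by (rule nn_integral_cong_AE) (use fin in eventually_elim, auto elim!: abs_neq_infinity_cases)
  have n: "(\<integral>\<^sup>+ x. ennreal (- real_of_ereal (h x)) \<partial>N) = (\<integral>\<^sup>+ x. e2ennreal (- h x) \<partial>N)"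
    by (rule nn_integral_cong_AE) (use fin in eventually_elim, auto elim!: abs_neq_infinity_cases)
  show int: "integrable N (\<lambda>x. real_of_ereal (h x))"
    unfolding real_integrable_def using p n pos neg by auto
  show "ereal_integral N h = ereal (\<integral>x. real_of_ereal (h x) \<partial>N)"
    unfolding ereal_integral_def real_lebesgue_integral_def[OF int] p n
      enn2ereal_eq_ereal_enn2real[OF pos] enn2ereal_eq_ereal_enn2real[OF neg] by simp
qed

text \<open>The point is that \<open>c\<close> and \<open>d\<close> are only known to have integrals above \<open>- \<infinity>\<close>. As
  \<open>c \<le> a + b - d\<close> and the negative part of \<open>d\<close> is integrable, the positive part of \<open>c\<close> is
  integrable too, and symmetrically for \<open>d\<close>; then everything is a statement about real integrals.
  The guards in the pointwise inequality hold almost everywhere; with them it can be verified at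
  points where no \<open>\<infinity> - \<infinity>\<close> occurs.\<close>

lemma ereal_integral_exchange:
  assumes [measurable]: "a \<in> borel_measurable N" "b \<in> borel_measurable N"
      "c \<in> borel_measurable N" "d \<in> borel_measurable N"
    and defd: "ereal_integral_defined N a" "ereal_integral_defined N b"
      "ereal_integral_defined N c" "ereal_integral_defined N d"
    and fin: "\<bar>ereal_integral N a\<bar> \<noteq> \<infinity>" "\<bar>ereal_integral N b\<bar> \<noteq> \<infinity>"
    and bdd: "- \<infinity> < ereal_integral N c" "- \<infinity> < ereal_integral N d"
    and le: "AE x in N. \<bar>a x\<bar> \<noteq> \<infinity> \<longrightarrow> \<bar>b x\<bar> \<noteq> \<infinity> \<longrightarrow> - \<infinity> < c x \<longrightarrow> - \<infinity> < d x \<longrightarrow> c x + d x \<le> a x + b x"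
  shows "\<bar>ereal_integral N c\<bar> \<noteq> \<infinity>" "\<bar>ereal_integral N d\<bar> \<noteq> \<infinity>"
    "ereal_integral N c + ereal_integral N d \<le> ereal_integral N a + ereal_integral N b"
proof -
  have fin': "ereal_integral N a < \<infinity>" "- \<infinity> < ereal_integral N a" "ereal_integral N b < \<infinity>" "- \<infinity> < ereal_integral N b"
    using fin by auto
  note pa = ereal_integral_pos_part[OF defd(1) fin'(1)] ereal_integral_neg_part[OF defd(1) fin'(2)]
  note pb = ereal_integral_pos_part[OF defd(2) fin'(3)] ereal_integral_neg_part[OF defd(2) fin'(4)]
  note nc = ereal_integral_neg_part[OF defd(3) bdd(1)]
  note nd = ereal_integral_neg_part[OF defd(4) bdd(2)]
  note A = ereal_integral_eq_integral[OF assms(1) pa]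
  note B = ereal_integral_eq_integral[OF assms(2) pb]
  have gt: "AE x in N. - \<infinity> < h x" if [measurable]: "h \<in> borel_measurable N" and "(\<integral>\<^sup>+ x. e2ennreal (- h x) \<partial>N) < \<infinity>" for h
  proof -
    have "AE x in N. e2ennreal (- h x) \<noteq> \<infinity>" by (rule nn_integral_PInf_AE) (use that in simp_all)
    then show ?thesis
    proof eventually_elim
      case (elim x)
      then show ?case by (cases "h x") auto
    qed
  qed
  have le': "AE x in N. c x + d x \<le> a x + b x" and finab: "AE x in N. \<bar>a x\<bar> \<noteq> \<infinity> \<and> \<bar>b x\<bar> \<noteq> \<infinity> \<and> - \<infinity> < c x \<and> - \<infinity> < d x"
    using le A(1) B(1) gt[OF assms(3) nc] gt[OF assms(4) nd] by (eventually_elim, auto)+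
  have bound: "e2ennreal u \<le> e2ennreal x + e2ennreal y + e2ennreal (- v)"
    if uvxy: "u + v \<le> x + y" "\<bar>x\<bar> \<noteq> \<infinity>" "\<bar>y\<bar> \<noteq> \<infinity>" "- \<infinity> < u" "- \<infinity> < v" for u v x y :: ereal
  proof -
    obtain x' y' where xy: "x = ereal x'" "y = ereal y'" using uvxy by (auto elim!: abs_neq_infinity_cases)
    obtain u' v' where uv: "u = ereal u'" "v = ereal v'"
      using uvxy xy by (cases u; cases v) auto
    have "u' \<le> x' + y' - v'" using that(1) by (simp add: xy uv)
    then have "ennreal u' \<le> ennreal (max 0 x' + max 0 y' + max 0 (- v'))"
      by (intro ennreal_leI) (auto simp: max_def)
    also have "\<dots> = ennreal x' + ennreal y' + ennreal (- v')"
      by (simp add: ennreal_plus max_def ennreal_neg)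
    finally show ?thesis by (simp add: xy uv)
  qed
  have pos: "(\<integral>\<^sup>+ x. e2ennreal (u x) \<partial>N) < \<infinity>"
    if [measurable]: "u \<in> borel_measurable N" "v \<in> borel_measurable N" and nv: "(\<integral>\<^sup>+ x. e2ennreal (- v x) \<partial>N) < \<infinity>"
      and le: "AE x in N. u x + v x \<le> a x + b x" and g: "AE x in N. - \<infinity> < u x \<and> - \<infinity> < v x" for u v
  proof -
    have "(\<integral>\<^sup>+ x. e2ennreal (u x) \<partial>N) \<le> (\<integral>\<^sup>+ x. e2ennreal (a x) + e2ennreal (b x) + e2ennreal (- v x) \<partial>N)"
      by (rule nn_integral_mono_AE) (use le g finab in eventually_elim, intro bound, auto)
    also have "\<dots> = (\<integral>\<^sup>+ x. e2ennreal (a x) \<partial>N) + (\<integral>\<^sup>+ x. e2ennreal (b x) \<partial>N) + (\<integral>\<^sup>+ x. e2ennreal (- v x) \<partial>N)"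
      by (simp add: nn_integral_add)
    also have "\<dots> < \<infinity>" using pa(1) pb(1) nv by simp
    finally show ?thesis .
  qed
  have pc: "(\<integral>\<^sup>+ x. e2ennreal (c x) \<partial>N) < \<infinity>"
    by (rule pos[OF assms(3,4) nd le']) (use finab in eventually_elim, auto)
  have pd: "(\<integral>\<^sup>+ x. e2ennreal (d x) \<partial>N) < \<infinity>"
    by (rule pos[OF assms(4,3) nc]) (use le' finab in \<open>eventually_elim, auto simp: add.commute\<close>)+
  note C = ereal_integral_eq_integral[OF assms(3) pc nc]
  note D = ereal_integral_eq_integral[OF assms(4) pd nd]
  show "\<bar>ereal_integral N c\<bar> \<noteq> \<infinity>" "\<bar>ereal_integral N d\<bar> \<noteq> \<infinity>"
    by (simp_all add: C(3) D(3))
  have "(\<integral>x. real_of_ereal (c x) + real_of_ereal (d x) \<partial>N) \<le> (\<integral>x. real_of_ereal (a x) + real_of_ereal (b x) \<partial>N)"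
  proof (rule integral_mono_AE)
    show "AE x in N. real_of_ereal (c x) + real_of_ereal (d x) \<le> real_of_ereal (a x) + real_of_ereal (b x)"
      using le' A(1) B(1) C(1) D(1)
      by eventually_elim (auto elim!: abs_neq_infinity_cases)
  qed (use A(2) B(2) C(2) D(2) in auto)
  then show "ereal_integral N c + ereal_integral N d \<le> ereal_integral N a + ereal_integral N b"
    by (simp add: A(2,3) B(2,3) C(2,3) D(2,3))
qed


section \<open>Progressive measurability\<close>

context mean_field_game
begin

lemma filt_space: "t \<in> time_set G \<Longrightarrow> space (filt G t) = space (pspace G)"
  and filt_sets: "t \<in> time_set G \<Longrightarrow> sets (filt G t) \<subseteq> sets (pspace G)"
  using filt_subalgebra by (auto simp: subalgebra_def)

lemma measurable_filt_mono:
  assumes "f \<in> measurable (filt G s) N" "0 \<le> s" "s \<le> t" "t \<le> horizon G"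
  shows "f \<in> measurable (filt G t) N"
proof (rule measurable_from_subalg[OF _ assms(1)])
  show "subalgebra (filt G t) (filt G s)"
    using filt_space[of s] filt_space[of t] filt_mono[OF assms(2-4)] assms(2-4) by (simp add: subalgebra_def)
qed

lemma measurable_filt_pspace:
  assumes "f \<in> measurable (filt G t) N" "t \<in> time_set G"
  shows "f \<in> measurable (pspace G) N"
  by (rule measurable_from_subalg[OF filt_subalgebra[OF assms(2)] assms(1)])

lemma prog_generators_subset:
  "{A. A \<subseteq> space (pspace G) \<times> time_set G \<and> (\<forall>t\<in>time_set G. A \<inter> (space (pspace G) \<times> {0..t})
           \<in> sets (filt G t \<Otimes>\<^sub>M restrict_space borel {0..t}))} \<subseteq> Pow (space (pspace G) \<times> time_set G)"
  by blast

lemma space_prog_algebra: "space (prog_algebra G) = space (pspace G) \<times> time_set G"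
  unfolding prog_algebra_def by (rule space_measure_of[OF prog_generators_subset])

lemma prog_algebraI:
  assumes "A \<subseteq> space (pspace G) \<times> time_set G"
    and "\<And>t. t \<in> time_set G \<Longrightarrow> A \<inter> (space (pspace G) \<times> {0..t}) \<in> sets (filt G t \<Otimes>\<^sub>M restrict_space borel {0..t})"
  shows "A \<in> sets (prog_algebra G)"
  unfolding prog_algebra_def sets_measure_of[OF prog_generators_subset] using assms by blast

text \<open>The sets used to generate the progressive \<open>\<sigma>\<close>-algebra are exactly those that are measurable up to
  each time, so the condition can be tested directly on preimages.\<close>

lemma measurable_progI:
  assumes f: "f \<in> space (pspace G) \<times> time_set G \<rightarrow> space N"
    and meas: "\<And>t. t \<in> time_set G \<Longrightarrow> f \<in> measurable (filt G t \<Otimes>\<^sub>M restrict_space borel {0..t}) N"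
  shows "f \<in> measurable (prog_algebra G) N"
proof (rule measurableI)
  show "f p \<in> space N" if "p \<in> space (prog_algebra G)" for p
    using that f by (auto simp: space_prog_algebra)
  fix B assume B: "B \<in> sets N"
  show "f -` B \<inter> space (prog_algebra G) \<in> sets (prog_algebra G)"
  proof (rule prog_algebraI)
    show "f -` B \<inter> space (prog_algebra G) \<subseteq> space (pspace G) \<times> time_set G"
      by (simp add: space_prog_algebra)
    fix t assume t: "t \<in> time_set G"
    have "f -` B \<inter> space (prog_algebra G) \<inter> (space (pspace G) \<times> {0..t})
      = f -` B \<inter> space (filt G t \<Otimes>\<^sub>M restrict_space borel {0..t})"
      using t by (auto simp: space_prog_algebra space_pair_measure filt_space space_restrict_space)
    also have "\<dots> \<in> sets (filt G t \<Otimes>\<^sub>M restrict_space borel {0..t})"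
      by (rule measurable_sets[OF meas[OF t] B])
    finally show "f -` B \<inter> space (prog_algebra G) \<inter> (space (pspace G) \<times> {0..t})
      \<in> sets (filt G t \<Otimes>\<^sub>M restrict_space borel {0..t})" .
  qed
qed

lemma endpoints_in_time_set: "horizon G \<in> time_set G" "0 \<in> time_set G"
  using horizon_pos by auto

text \<open>Apply the defining condition of progressive sets at the horizon.\<close>

lemma measurable_prog_imp_prob_time:
  assumes "f \<in> measurable (prog_algebra G) N"
  shows "f \<in> measurable (prob_time G) N"
proof (rule measurable_from_subalg[OF _ assms])
  have "sets (prog_algebra G) \<subseteq> sets (prob_time G)"
    unfolding prog_algebra_def sets_measure_of[OF prog_generators_subset]
  proof (rule sets.sigma_sets_subset', safe)
    show "space (pspace G) \<times> time_set G \<in> sets (prob_time G)"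
      by (rule pair_measureI) (auto simp: sets_restrict_space_iff)
    fix A assume A: "A \<subseteq> space (pspace G) \<times> time_set G" "\<forall>t\<in>time_set G. A \<inter> (space (pspace G) \<times> {0..t})
           \<in> sets (filt G t \<Otimes>\<^sub>M restrict_space borel {0..t})"
    then have "A \<in> sets (filt G (horizon G) \<Otimes>\<^sub>M restrict_space borel (time_set G))"
      using bspec[OF A(2) endpoints_in_time_set(1)] by (simp add: Int_absorb2)
    also have "\<dots> \<subseteq> sets (pspace G \<Otimes>\<^sub>M restrict_space borel (time_set G))"
      unfolding sets_pair_measure filt_space[OF endpoints_in_time_set(1)]
      by (rule sigma_sets_mono') (use filt_sets[OF endpoints_in_time_set(1)] in blast)
    also have "\<dots> = sets (prob_time G)"
      by (rule sets_pair_measure_cong) (auto simp: sets_restrict_space)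
    finally show "A \<in> sets (prob_time G)" .
  qed
  then show "subalgebra (prob_time G) (prog_algebra G)"
    by (simp add: subalgebra_def space_prog_algebra space_pair_measure space_restrict_space)
qed

lemma measurable_prog_time: "snd \<in> measurable (prog_algebra G) (restrict_space borel (time_set G))"
proof (rule measurable_progI)
  fix t assume t: "t \<in> time_set G"
  have "(\<lambda>s. s) \<in> measurable (restrict_space borel {0..t}) (restrict_space borel (time_set G))"
    by (rule measurable_restrict_space2) (use t in \<open>auto simp: space_restrict_space intro: measurable_restrict_space1\<close>)
  from measurable_compose[OF measurable_snd this]
  show "snd \<in> measurable (filt G t \<Otimes>\<^sub>M restrict_space borel {0..t}) (restrict_space borel (time_set G))" .
qed (auto simp: space_restrict_space)

text \<open>Up to time \<open>t\<close>, the path is the limit of its values at the next grid points to the right, capped at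
  \<open>t\<close> so that only information available at \<open>t\<close> enters.\<close>

lemma continuous_adapted_prog_measurable:
  assumes X: "continuous_adapted G X"
  shows "(\<lambda>(\<omega>, t). X t \<omega>) \<in> borel_measurable (prog_algebra G)"
proof (rule measurable_progI)
  fix t assume t: "t \<in> time_set G"
  let ?N = "filt G t \<Otimes>\<^sub>M restrict_space borel {0..t}"
  have X_meas: "X s \<in> borel_measurable (filt G t)" if "0 \<le> s" "s \<le> t" for s
  proof (rule measurable_filt_mono)
    show "X s \<in> borel_measurable (filt G s)" using X t that by (simp add: continuous_adapted_def)
  qed (use t that in auto)
  define r where "r n s = max 0 (min t (real_of_int \<lceil>s * real (Suc n)\<rceil> / real (Suc n)))" for n s
  show "(\<lambda>(\<omega>, s). X s \<omega>) \<in> borel_measurable ?N"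
  proof (rule borel_measurable_LIMSEQ_real)
    fix n
    have m1: "(\<lambda>p. \<lceil>snd p * real (Suc n)\<rceil>) \<in> measurable ?N (count_space UNIV)"
    proof -
      have "(\<lambda>s. s) \<in> borel_measurable (restrict_space borel {0..t})"
        by (rule measurable_restrict_space1) simp
      from measurable_compose[OF measurable_snd this]
      have "(\<lambda>p. snd p * real (Suc n)) \<in> borel_measurable ?N" by measurable
      then show ?thesis by measurable
    qed
    have m2: "(\<lambda>p. X (max 0 (min t (real_of_int k / real (Suc n)))) (fst p)) \<in> borel_measurable ?N" for k
      by (rule measurable_compose[OF measurable_fst X_meas]) (use t in auto)
    have "(\<lambda>p. X (r n (snd p)) (fst p)) \<in> borel_measurable ?N"
      unfolding r_def
      using measurable_compose_countable[OF m2 m1] by simp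
    then show "(\<lambda>(\<omega>, s). X (r n s) \<omega>) \<in> borel_measurable ?N"
      by (simp add: case_prod_beta')
  next
    fix p assume "p \<in> space ?N"
    then obtain \<omega> s where p: "p = (\<omega>, s)" and \<omega>: "\<omega> \<in> space (pspace G)" and s: "0 \<le> s" "s \<le> t"
      using t by (auto simp: space_pair_measure filt_space space_restrict_space)
    have lim: "(\<lambda>n. r n s) \<longlonglongrightarrow> s"
    proof (rule tendsto_sandwich)
      show "\<forall>\<^sub>F n in sequentially. s \<le> r n s"
      proof (intro always_eventually allI)
        fix n
        have "s * real (Suc n) \<le> real_of_int \<lceil>s * real (Suc n)\<rceil>" by (rule le_of_int_ceiling)
        then have "s \<le> real_of_int \<lceil>s * real (Suc n)\<rceil> / real (Suc n)" by (simp add: pos_le_divide_eq)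
        then show "s \<le> r n s" using s by (auto simp: r_def)
      qed
      show "\<forall>\<^sub>F n in sequentially. r n s \<le> s + inverse (real (Suc n))"
      proof (intro always_eventually allI)
        fix n
        have "real_of_int \<lceil>s * real (Suc n)\<rceil> \<le> s * real (Suc n) + 1" by (rule of_int_ceiling_le_add_one)
        then have "real_of_int \<lceil>s * real (Suc n)\<rceil> / real (Suc n) \<le> (s * real (Suc n) + 1) / real (Suc n)"
          by (rule divide_right_mono) simp
        also have "\<dots> = s + inverse (real (Suc n))"
          by (simp add: add_divide_distrib inverse_eq_divide del: of_nat_Suc)
        finally have "real_of_int \<lceil>s * real (Suc n)\<rceil> / real (Suc n) \<le> s + inverse (real (Suc n))" .
        moreover have "0 \<le> s + inverse (real (Suc n))" using s by simp
        ultimately show "r n s \<le> s + inverse (real (Suc n))" unfolding r_def by linarith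
      qed
      show "(\<lambda>n. s) \<longlonglongrightarrow> s" by simp
      show "(\<lambda>n. s + inverse (real (Suc n))) \<longlonglongrightarrow> s" by (rule LIMSEQ_inverse_real_of_nat_add)
    qed
    have "continuous_on (time_set G) (\<lambda>s. X s \<omega>)" using X \<omega> by (simp add: continuous_adapted_def)
    then have "(\<lambda>n. X (r n s) \<omega>) \<longlonglongrightarrow> X s \<omega>"
      by (rule continuous_on_tendsto_compose[OF _ lim]) (use s t in \<open>auto simp: r_def min.coboundedI1\<close>)
    then show "(\<lambda>n. (\<lambda>(\<omega>, s). X (r n s) \<omega>) p) \<longlonglongrightarrow> (\<lambda>(\<omega>, s). X s \<omega>) p" by (simp add: p)
  qed
qed simp

lemma control_prog_measurable:
  assumes "\<alpha> \<in> controls G"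
  shows "(\<lambda>(\<omega>, t). \<alpha> t \<omega>) \<in> measurable (prog_algebra G) (restrict_space borel (ctrl G))"
  by (rule measurable_restrict_space2)
     (use assms in \<open>auto simp: controls_def square_integrable_prog_def space_prog_algebra\<close>)

lemma running_cost_prog_measurable:
  assumes \<alpha>: "\<alpha> \<in> controls G" and X: "continuous_adapted G (state G \<alpha>)" and \<mu>: "\<mu> \<in> flows G"
  shows "(\<lambda>(\<omega>, t). running_cost G \<alpha> \<mu> \<omega> t) \<in> borel_measurable (prog_algebra G)"
proof -
  note X' = continuous_adapted_prog_measurable[OF X]
  note \<alpha>' = control_prog_measurable[OF \<alpha>]
  have \<mu>': "(\<lambda>p. \<mu> (snd p)) \<in> measurable (prog_algebra G) weak_borel"
    using measurable_compose[OF measurable_prog_time \<mu>[unfolded flows_def]] .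
  have "(\<lambda>p. (p, (case p of (\<omega>, t) \<Rightarrow> state G \<alpha> t \<omega>), \<mu> (snd p)))
      \<in> measurable (prog_algebra G) (prog_algebra G \<Otimes>\<^sub>M (borel \<Otimes>\<^sub>M weak_borel))"
    using X' \<mu>' by (intro measurable_Pair) auto
  from measurable_compose[OF this cost_f_measurable]
  have f: "(\<lambda>p. cost_f G (fst p) (snd p) (state G \<alpha> (snd p) (fst p)) (\<mu> (snd p))) \<in> borel_measurable (prog_algebra G)"
    by (simp add: case_prod_beta')
  have "(\<lambda>p. (p, (case p of (\<omega>, t) \<Rightarrow> state G \<alpha> t \<omega>), (case p of (\<omega>, t) \<Rightarrow> \<alpha> t \<omega>)))
      \<in> measurable (prog_algebra G) (prog_algebra G \<Otimes>\<^sub>M (borel \<Otimes>\<^sub>M restrict_space borel (ctrl G)))"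
    using X' \<alpha>' by (intro measurable_Pair) auto
  from measurable_compose[OF this cost_l_measurable]
  have l: "(\<lambda>p. cost_l G (fst p) (snd p) (state G \<alpha> (snd p) (fst p)) (\<alpha> (snd p) (fst p))) \<in> borel_measurable (prog_algebra G)"
    by (simp add: case_prod_beta')
  have "(\<lambda>p. ereal (cost_f G (fst p) (snd p) (state G \<alpha> (snd p) (fst p)) (\<mu> (snd p))
      + cost_l G (fst p) (snd p) (state G \<alpha> (snd p) (fst p)) (\<alpha> (snd p) (fst p)))) \<in> borel_measurable (prog_algebra G)"
    using f l by measurable
  then show ?thesis by (simp add: running_cost_def case_prod_beta')
qed

lemma sigma_finite_time_leb: "sigma_finite_measure (time_leb G)"
proof -
  have "finite_measure (time_leb G)"
    by (rule finite_measureI) (use horizon_pos in \<open>simp add: emeasure_restrict_space space_restrict_space\<close>)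
  then show ?thesis by (simp add: finite_measure.axioms(1))
qed

lemma running_cost_time_measurable:
  assumes "\<alpha> \<in> controls G" "continuous_adapted G (state G \<alpha>)" "\<mu> \<in> flows G" "\<omega> \<in> space (pspace G)"
  shows "running_cost G \<alpha> \<mu> \<omega> \<in> borel_measurable (time_leb G)"
  using measurable_compose[OF measurable_Pair1'[OF assms(4)]
      measurable_prog_imp_prob_time[OF running_cost_prog_measurable[OF assms(1-3)]]] by simp

lemma total_cost_measurable:
  assumes \<alpha>: "\<alpha> \<in> controls G" and X: "continuous_adapted G (state G \<alpha>)" and \<mu>: "\<mu> \<in> flows G"
  shows "total_cost G \<alpha> \<mu> \<in> borel_measurable (pspace G)"
proof -
  interpret sigma_finite_measure "time_leb G" by (rule sigma_finite_time_leb)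
  have rc: "(\<lambda>(\<omega>, t). running_cost G \<alpha> \<mu> \<omega> t) \<in> borel_measurable (prob_time G)"
    by (rule measurable_prog_imp_prob_time[OF running_cost_prog_measurable[OF assms]])
  have "(\<lambda>(\<omega>, t). e2ennreal (running_cost G \<alpha> \<mu> \<omega> t)) \<in> borel_measurable (prob_time G)"
    "(\<lambda>(\<omega>, t). e2ennreal (- running_cost G \<alpha> \<mu> \<omega> t)) \<in> borel_measurable (prob_time G)"
    using rc by (simp_all add: case_prod_beta')
  from borel_measurable_nn_integral[OF this(1)] borel_measurable_nn_integral[OF this(2)]
  have i: "(\<lambda>\<omega>. ereal_integral (time_leb G) (running_cost G \<alpha> \<mu> \<omega>)) \<in> borel_measurable (pspace G)"
    unfolding ereal_integral_def by measurable
  have XT: "state G \<alpha> (horizon G) \<in> borel_measurable (pspace G)"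
    using X endpoints_in_time_set(1) measurable_filt_pspace[OF _ endpoints_in_time_set(1)] unfolding continuous_adapted_def by blast
  have "(\<lambda>\<omega>. (\<omega>, state G \<alpha> (horizon G) \<omega>, \<mu> (horizon G))) \<in> measurable (pspace G) (pspace G \<Otimes>\<^sub>M (borel \<Otimes>\<^sub>M weak_borel))"
    using XT flow_in_prob_measures[OF \<mu> endpoints_in_time_set(1)]
    by (intro measurable_Pair measurable_const) (simp_all add: space_weak_borel)
  from measurable_compose[OF this cost_g_measurable]
  have "(\<lambda>\<omega>. cost_g G \<omega> (state G \<alpha> (horizon G) \<omega>) (\<mu> (horizon G))) \<in> borel_measurable (pspace G)" by simp
  with i show ?thesis unfolding total_cost_def[abs_def] by measurable
qed

end


context mean_field_game
begin

section \<open>The state equation\<close>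

lemma drift_lipschitz:
  "\<exists>C>0. \<forall>\<omega>\<in>space (pspace G). \<forall>t\<in>time_set G. \<forall>a\<in>ctrl G. \<forall>x y.
     \<bar>drift G \<omega> t x a - drift G \<omega> t y a\<bar> \<le> C * \<bar>x - y\<bar>"
  using drift_bounds by blast

text \<open>The noise is the same for both solutions and cancels in their difference, so Gronwall's
  inequality and the Lipschitz condition apply to each path separately.\<close>

lemma solves_unique:
  assumes \<alpha>: "\<alpha> \<in> controls G" and X: "solves G \<alpha> X" and Y: "solves G \<alpha> Y"
  shows "AE \<omega> in pspace G. \<forall>t\<in>time_set G. X t \<omega> = Y t \<omega>"
proof -
  obtain C where C: "C > 0" and lip: "\<And>\<omega> t a x y. \<lbrakk>\<omega> \<in> space (pspace G); t \<in> time_set G; a \<in> ctrl G\<rbrakk> \<Longrightarrow>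
     \<bar>drift G \<omega> t x a - drift G \<omega> t y a\<bar> \<le> C * \<bar>x - y\<bar>"
    using drift_lipschitz by blast
  show ?thesis
    using X[unfolded solves_def, THEN conjunct2, THEN conjunct1] X[unfolded solves_def, THEN conjunct2, THEN conjunct2]
      Y[unfolded solves_def, THEN conjunct2, THEN conjunct1] Y[unfolded solves_def, THEN conjunct2, THEN conjunct2]
      AE_space
  proof eventually_elim
    case (elim \<omega>)
    define p where "p s = drift G \<omega> s (X s \<omega>) (\<alpha> s \<omega>)" for s
    define q where "q s = drift G \<omega> s (Y s \<omega>) (\<alpha> s \<omega>)" for s
    have p: "set_integrable lborel (time_set G) p" and q: "set_integrable lborel (time_set G) q"
      using elim unfolding p_def q_def by blast+
    have Xc: "continuous_on (time_set G) (\<lambda>t. X t \<omega>)" and Yc: "continuous_on (time_set G) (\<lambda>t. Y t \<omega>)"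
      using X Y elim(5) by (auto simp: solves_def continuous_adapted_def)
    have m: "continuous_on (time_set G) (\<lambda>t. \<bar>X t \<omega> - Y t \<omega>\<bar>)" by (intro continuous_intros Xc Yc)
    show "\<forall>t\<in>time_set G. X t \<omega> = Y t \<omega>"
    proof
      fix t assume t: "t \<in> time_set G"
      have "\<bar>X t \<omega> - Y t \<omega>\<bar> = 0"
      proof (rule gronwall_zero[OF m _ _ _ t])
        show "0 \<le> C" using C by simp
        fix u assume u: "u \<in> time_set G"
        have pu: "set_integrable lborel {0..u} p" and qu: "set_integrable lborel {0..u} q"
          by (rule set_integrable_Icc_subset[OF p] set_integrable_Icc_subset[OF q]; use u in auto)+
        have mu: "set_integrable lborel {0..u} (\<lambda>s. \<bar>X s \<omega> - Y s \<omega>\<bar>)"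
          by (rule borel_integrable_atLeastAtMost') (rule continuous_on_subset[OF m], use u in auto)
        have "X u \<omega> - Y u \<omega> = (LINT s:{0..u}|lborel. p s) - (LINT s:{0..u}|lborel. q s)"
          using elim u endpoints_in_time_set by (simp add: p_def q_def)
        also have "\<dots> = (LINT s:{0..u}|lborel. p s - q s)"
          by (rule set_integral_diff(2)[OF pu qu, symmetric])
        finally have "\<bar>X u \<omega> - Y u \<omega>\<bar> = \<bar>LINT s:{0..u}|lborel. p s - q s\<bar>" by simp
        also have "\<dots> \<le> (LINT s:{0..u}|lborel. \<bar>p s - q s\<bar>)"
          using set_integral_norm_bound[OF set_integral_diff(1)[OF pu qu]] by simp
        also have "\<dots> \<le> (LINT s:{0..u}|lborel. C * \<bar>X s \<omega> - Y s \<omega>\<bar>)"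
        proof (rule set_integral_mono)
          show "set_integrable lborel {0..u} (\<lambda>s. \<bar>p s - q s\<bar>)"
            by (rule set_integrable_abs[OF set_integral_diff(1)[OF pu qu]])
          show "set_integrable lborel {0..u} (\<lambda>s. C * \<bar>X s \<omega> - Y s \<omega>\<bar>)" using mu by simp
          show "\<bar>p s - q s\<bar> \<le> C * \<bar>X s \<omega> - Y s \<omega>\<bar>" if "s \<in> {0..u}" for s
            unfolding p_def q_def by (rule lip[OF elim(5)]) (use that u \<alpha> elim(5) in \<open>auto simp: controls_def\<close>)
        qed
        also have "\<dots> = C * (LINT s:{0..u}|lborel. \<bar>X s \<omega> - Y s \<omega>\<bar>)" by simp
        finally show "\<bar>X u \<omega> - Y u \<omega>\<bar> \<le> C * (LINT s:{0..u}|lborel. \<bar>X s \<omega> - Y s \<omega>\<bar>)" .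
      qed simp
      then show "X t \<omega> = Y t \<omega>" by simp
    qed
  qed
qed

lemma solves_state: "solves G \<alpha> X \<Longrightarrow> solves G \<alpha> (state G \<alpha>)"
  unfolding state_def by (rule someI[where P = "solves G \<alpha>"])

text \<open>The feedback rule that uses \<open>\<alpha>\<close> where \<open>X\<close> is strictly above \<open>Y\<close>, and \<open>\<beta>\<close> elsewhere.\<close>

definition glue :: "(real \<Rightarrow> 'a \<Rightarrow> real) \<Rightarrow> (real \<Rightarrow> 'a \<Rightarrow> real) \<Rightarrow>
    (real \<Rightarrow> 'a \<Rightarrow> real) \<Rightarrow> (real \<Rightarrow> 'a \<Rightarrow> real) \<Rightarrow> real \<Rightarrow> 'a \<Rightarrow> real"
  where "glue X Y \<alpha> \<beta> t \<omega> = (if Y t \<omega> < X t \<omega> then \<alpha> t \<omega> else \<beta> t \<omega>)"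

lemma glue_in_controls:
  assumes X: "continuous_adapted G X" and Y: "continuous_adapted G Y"
    and \<alpha>: "\<alpha> \<in> controls G" and \<beta>: "\<beta> \<in> controls G"
  shows "glue X Y \<alpha> \<beta> \<in> controls G"
proof -
  note [measurable] = continuous_adapted_prog_measurable[OF X] continuous_adapted_prog_measurable[OF Y]
  have am[measurable]: "(\<lambda>(\<omega>, t). \<alpha> t \<omega>) \<in> borel_measurable (prog_algebra G)" "(\<lambda>(\<omega>, t). \<beta> t \<omega>) \<in> borel_measurable (prog_algebra G)"
    and ai: "integrable (prob_time G) (\<lambda>(\<omega>, t). (\<alpha> t \<omega>)\<^sup>2)" "integrable (prob_time G) (\<lambda>(\<omega>, t). (\<beta> t \<omega>)\<^sup>2)"
    using \<alpha> \<beta> by (auto simp: controls_def square_integrable_prog_def)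
  have "(\<lambda>p. if (case p of (\<omega>, t) \<Rightarrow> Y t \<omega>) < (case p of (\<omega>, t) \<Rightarrow> X t \<omega>) then (case p of (\<omega>, t) \<Rightarrow> \<alpha> t \<omega>)
      else (case p of (\<omega>, t) \<Rightarrow> \<beta> t \<omega>)) \<in> borel_measurable (prog_algebra G)"
    by measurable
  then have m: "(\<lambda>(\<omega>, t). glue X Y \<alpha> \<beta> t \<omega>) \<in> borel_measurable (prog_algebra G)"
    by (simp add: glue_def case_prod_beta' cong: if_cong)
  have "integrable (prob_time G) (\<lambda>(\<omega>, t). (glue X Y \<alpha> \<beta> t \<omega>)\<^sup>2)"
  proof (rule Bochner_Integration.integrable_bound[OF Bochner_Integration.integrable_add[OF ai]])
    show "(\<lambda>(\<omega>, t). (glue X Y \<alpha> \<beta> t \<omega>)\<^sup>2) \<in> borel_measurable (prob_time G)"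
      using measurable_prog_imp_prob_time[OF m] by (simp add: case_prod_beta')
    show "AE p in prob_time G. norm (case p of (\<omega>, t) \<Rightarrow> (glue X Y \<alpha> \<beta> t \<omega>)\<^sup>2)
      \<le> norm ((case p of (\<omega>, t) \<Rightarrow> (\<alpha> t \<omega>)\<^sup>2) + (case p of (\<omega>, t) \<Rightarrow> (\<beta> t \<omega>)\<^sup>2))"
      by (intro AE_I2) (auto simp: glue_def)
  qed
  with m show ?thesis
    using \<alpha> \<beta> by (auto simp: controls_def square_integrable_prog_def glue_def)
qed

lemma continuous_adapted_max_min:
  assumes X: "continuous_adapted G X" and Y: "continuous_adapted G Y"
  shows "continuous_adapted G (\<lambda>t \<omega>. max (X t \<omega>) (Y t \<omega>))" "continuous_adapted G (\<lambda>t \<omega>. min (X t \<omega>) (Y t \<omega>))"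
  using X Y unfolding continuous_adapted_def
  by (auto intro!: continuous_on_max continuous_on_min borel_measurable_max borel_measurable_min)

text \<open>Almost surely \<open>X - Y\<close> is an indefinite integral that starts at zero, and its positive part is the
  integral of the difference of the two drifts over the times at which \<open>X\<close> exceeds \<open>Y\<close>. Adding it
  to \<open>Y\<close> gives the equation of the maximum, subtracting it from \<open>X\<close> that of the minimum. On the
  set where \<open>X = Y\<close> the maximum follows \<open>\<beta>\<close> and the minimum follows \<open>\<alpha>\<close>.\<close>

lemma solves_max_min:
  assumes X: "solves G \<alpha> X" and Y: "solves G \<beta> Y"
  shows "solves G (glue X Y \<alpha> \<beta>) (\<lambda>t \<omega>. max (X t \<omega>) (Y t \<omega>))"
    and "solves G (glue X Y \<beta> \<alpha>) (\<lambda>t \<omega>. min (X t \<omega>) (Y t \<omega>))"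
proof -
  have XY: "continuous_adapted G X" "continuous_adapted G Y" using X Y by (auto simp: solves_def)
  have init: "AE \<omega> in pspace G. X 0 \<omega> = init G \<omega> \<and> Y 0 \<omega> = init G \<omega>"
    using X Y by (auto simp: solves_def)
  define b where "b \<gamma> Z \<omega> s = drift G \<omega> s (Z s \<omega>) (\<gamma> s \<omega>)" for \<gamma> Z :: "real \<Rightarrow> 'a \<Rightarrow> real" and \<omega> s
  define I where "I = ito_integral G (vol G)"
  have key: "AE \<omega> in pspace G.
     (set_integrable lborel (time_set G) (b (glue X Y \<alpha> \<beta>) (\<lambda>t \<omega>. max (X t \<omega>) (Y t \<omega>)) \<omega>) \<and>
       (\<forall>t\<in>time_set G. max (X t \<omega>) (Y t \<omega>) = max (X 0 \<omega>) (Y 0 \<omega>) +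
         (LINT s:{0..t}|lborel. b (glue X Y \<alpha> \<beta>) (\<lambda>t \<omega>. max (X t \<omega>) (Y t \<omega>)) \<omega> s) + I t \<omega>)) \<and>
     (set_integrable lborel (time_set G) (b (glue X Y \<beta> \<alpha>) (\<lambda>t \<omega>. min (X t \<omega>) (Y t \<omega>)) \<omega>) \<and>
       (\<forall>t\<in>time_set G. min (X t \<omega>) (Y t \<omega>) = min (X 0 \<omega>) (Y 0 \<omega>) +
         (LINT s:{0..t}|lborel. b (glue X Y \<beta> \<alpha>) (\<lambda>t \<omega>. min (X t \<omega>) (Y t \<omega>)) \<omega> s) + I t \<omega>))"
    using init X[unfolded solves_def, THEN conjunct2, THEN conjunct2] Y[unfolded solves_def, THEN conjunct2, THEN conjunct2]
      AE_space
  proof eventually_elim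
    case (elim \<omega>)
    define x y where "x t = X t \<omega>" and "y t = Y t \<omega>" for t
    define p where "p = b \<alpha> X \<omega>"
    define q where "q = b \<beta> Y \<omega>"
    define d where "d t = x t - y t" for t
    define r where "r s = p s - q s" for s
    define r1 where "r1 s = (if 0 < d s then r s else 0)" for s
    have p: "set_integrable lborel (time_set G) p" and q: "set_integrable lborel (time_set G) q"
      using elim unfolding p_def q_def b_def by blast+
    have r: "set_integrable lborel (time_set G) r" unfolding r_def by (rule set_integral_diff(1)[OF p q])
    have dc: "continuous_on (time_set G) d"
      using XY elim(4) unfolding d_def x_def y_def continuous_adapted_def by (intro continuous_intros) auto
    have x_eq: "x t = x 0 + (LINT s:{0..t}|lborel. p s) + I t \<omega>" and y_eq: "y t = y 0 + (LINT s:{0..t}|lborel. q s) + I t \<omega>"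
      if "t \<in> time_set G" for t
      using elim that unfolding x_def y_def p_def q_def b_def I_def by blast+
    have xy0: "x 0 = y 0" using elim by (simp add: x_def y_def)
    have sub: "set_integrable lborel {0..t} f" if "set_integrable lborel (time_set G) f" "t \<in> time_set G" for t and f :: "real \<Rightarrow> real"
      by (rule set_integrable_Icc_subset[OF that(1)]) (use that(2) in auto)
    have d_eq: "d t = (LINT s:{0..t}|lborel. r s)" if t: "t \<in> time_set G" for t
      unfolding d_def r_def x_eq[OF t] y_eq[OF t] xy0 set_integral_diff(2)[OF sub[OF p t] sub[OF q t]] by simp
    have d0: "d 0 = 0" using xy0 by (simp add: d_def)
    have r1: "set_integrable lborel (time_set G) r1"
    proof -
      have "(\<lambda>s. indicator (time_set G) s *\<^sub>R d s) \<in> borel_measurable borel"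
        by (rule borel_measurable_continuous_on_indicator[OF _ dc]) auto
      then have "{s \<in> space lborel. 0 < indicator (time_set G) s *\<^sub>R d s} \<in> sets lborel" by measurable
      from integrable_mult_indicator[OF this r[unfolded set_integrable_def]]
      show ?thesis unfolding set_integrable_def
        by (rule Bochner_Integration.integrable_cong[THEN iffD1, rotated -1]) (auto simp: r1_def indicator_def)
    qed
    have pos: "max 0 (d t) = (LINT s:{0..t}|lborel. r1 s)" if "t \<in> time_set G" for t
      unfolding r1_def by (rule positive_part_indefinite_integral[OF r dc d0 d_eq that])
    have V: "b (glue X Y \<alpha> \<beta>) (\<lambda>t \<omega>. max (X t \<omega>) (Y t \<omega>)) \<omega> = (\<lambda>s. q s + r1 s)"
      by (auto simp: b_def glue_def p_def q_def r1_def r_def d_def x_def y_def max_def fun_eq_iff)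
    have W: "b (glue X Y \<beta> \<alpha>) (\<lambda>t \<omega>. min (X t \<omega>) (Y t \<omega>)) \<omega> = (\<lambda>s. p s - r1 s)"
      by (auto simp: b_def glue_def p_def q_def r1_def r_def d_def x_def y_def min_def fun_eq_iff)
    show ?case unfolding V W
    proof (intro conjI ballI)
      show "set_integrable lborel (time_set G) (\<lambda>s. q s + r1 s)" by (rule set_integral_add(1)[OF q r1])
      show "set_integrable lborel (time_set G) (\<lambda>s. p s - r1 s)" by (rule set_integral_diff(1)[OF p r1])
      fix t assume t: "t \<in> time_set G"
      have "max (x t) (y t) = max (x 0) (y 0) + (LINT s:{0..t}|lborel. q s + r1 s) + I t \<omega>"
        unfolding set_integral_add(2)[OF sub[OF q t] sub[OF r1 t]] pos[OF t, symmetric]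
        using y_eq[OF t] xy0 by (auto simp: d_def max_def)
      then show "max (X t \<omega>) (Y t \<omega>) = max (X 0 \<omega>) (Y 0 \<omega>) + (LINT s:{0..t}|lborel. q s + r1 s) + I t \<omega>"
        by (simp add: x_def y_def)
      have "min (x t) (y t) = min (x 0) (y 0) + (LINT s:{0..t}|lborel. p s - r1 s) + I t \<omega>"
        unfolding set_integral_diff(2)[OF sub[OF p t] sub[OF r1 t]] pos[OF t, symmetric]
        using x_eq[OF t] xy0 by (auto simp: d_def max_def min_def)
      then show "min (X t \<omega>) (Y t \<omega>) = min (X 0 \<omega>) (Y 0 \<omega>) + (LINT s:{0..t}|lborel. p s - r1 s) + I t \<omega>"
        by (simp add: x_def y_def)
    qed
  qed
  show "solves G (glue X Y \<alpha> \<beta>) (\<lambda>t \<omega>. max (X t \<omega>) (Y t \<omega>))"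
    unfolding solves_def
  proof (intro conjI continuous_adapted_max_min XY)
    show "AE \<omega> in pspace G. max (X 0 \<omega>) (Y 0 \<omega>) = init G \<omega>" using init by eventually_elim simp
  qed (use key in \<open>eventually_elim, unfold b_def I_def, blast\<close>)
  show "solves G (glue X Y \<beta> \<alpha>) (\<lambda>t \<omega>. min (X t \<omega>) (Y t \<omega>))"
    unfolding solves_def
  proof (intro conjI continuous_adapted_max_min XY)
    show "AE \<omega> in pspace G. min (X 0 \<omega>) (Y 0 \<omega>) = init G \<omega>" using init by eventually_elim simp
  qed (use key in \<open>eventually_elim, unfold b_def I_def, blast\<close>)
qed


section \<open>Submodularity of the expected cost\<close>

text \<open>The condition on the terminal cost does not involve \<open>t\<close>, and the time interval has positive
  length, so it holds for almost every \<open>\<omega>\<close> on its own.\<close>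

lemma submodular_pathwise:
  assumes B: "AE (\<omega>, t) in prob_time G. submodular (cost_f G \<omega> t) \<and> submodular (cost_g G \<omega>)"
  shows "AE \<omega> in pspace G. (AE t in time_leb G. submodular (cost_f G \<omega> t)) \<and> submodular (cost_g G \<omega>)"
proof -
  interpret P: prob_space "pspace G" by (rule is_prob_space)
  interpret T: sigma_finite_measure "time_leb G" by (rule sigma_finite_time_leb)
  interpret pair_sigma_finite "pspace G" "time_leb G" ..
  have "AE \<omega> in pspace G. AE t in time_leb G. submodular (cost_f G \<omega> t) \<and> submodular (cost_g G \<omega>)"
    using AE_pair[OF B] by simp
  then show ?thesis
  proof eventually_elim
    case (elim \<omega>)
    have "submodular (cost_g G \<omega>)"
    proof (rule ccontr)
      assume neg: "\<not> ?thesis"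
      have "AE t in time_leb G. False" using elim by eventually_elim (use neg in simp)
      then obtain N where N: "{t \<in> space (time_leb G). \<not> False} \<subseteq> N" "emeasure (time_leb G) N = 0" "N \<in> sets (time_leb G)"
        by (rule AE_E)
      have "emeasure (time_leb G) (space (time_leb G)) \<le> emeasure (time_leb G) N"
        by (rule emeasure_mono) (use N in auto)
      then have "emeasure (time_leb G) (space (time_leb G)) = 0" using N(2) by simp
      then show False using horizon_pos by (simp add: emeasure_restrict_space space_restrict_space)
    qed
    with elim show ?case by auto
  qed
qed

text \<open>Where \<open>X \<le> Y\<close>, the glued controls merely interchange the two pairs and the costs of both sides
  agree. Where \<open>X > Y\<close>, the controls stay with their states but the flows \<open>\<mu>\<close> and \<open>\<nu>\<close> are swapped:
  the control costs cancel and submodularity compares the rest. The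
  inequality is integrated first over time, then over \<open>\<omega>\<close>; in both steps the lower bounds on the
  left-hand side and finiteness of the right-hand side make all terms finite.\<close>

lemma expected_cost_exchange:
  assumes \<alpha>: "\<alpha> \<in> controls G" and \<beta>: "\<beta> \<in> controls G" and X: "solves G \<alpha> X" and Y: "solves G \<beta> Y"
    and \<mu>: "\<mu> \<in> flows G" and \<nu>: "\<nu> \<in> flows G" and le: "flow_le G \<mu> \<nu>"
    and B: "AE (\<omega>, t) in prob_time G. submodular (cost_f G \<omega> t) \<and> submodular (cost_g G \<omega>)"
    and fin: "\<bar>expected_cost G \<alpha> \<mu>\<bar> \<noteq> \<infinity>" "\<bar>expected_cost G \<beta> \<nu>\<bar> \<noteq> \<infinity>"
    and bdd: "- \<infinity> < expected_cost G (glue X Y \<alpha> \<beta>) \<nu>" "- \<infinity> < expected_cost G (glue X Y \<beta> \<alpha>) \<mu>"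
  shows "\<bar>expected_cost G (glue X Y \<alpha> \<beta>) \<nu>\<bar> \<noteq> \<infinity>" "\<bar>expected_cost G (glue X Y \<beta> \<alpha>) \<mu>\<bar> \<noteq> \<infinity>"
    "expected_cost G (glue X Y \<alpha> \<beta>) \<nu> + expected_cost G (glue X Y \<beta> \<alpha>) \<mu> \<le> expected_cost G \<alpha> \<mu> + expected_cost G \<beta> \<nu>"
proof -
  define \<gamma> where "\<gamma> = glue X Y \<alpha> \<beta>"
  define \<delta> where "\<delta> = glue X Y \<beta> \<alpha>"
  have XY: "continuous_adapted G X" "continuous_adapted G Y" using X Y by (auto simp: solves_def)
  have \<gamma>: "\<gamma> \<in> controls G" and \<delta>: "\<delta> \<in> controls G"
    unfolding \<gamma>_def \<delta>_def using glue_in_controls XY \<alpha> \<beta> by auto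
  note V = solves_max_min(1)[OF X Y, folded \<gamma>_def]
  note W = solves_max_min(2)[OF X Y, folded \<delta>_def]
  have cs: "continuous_adapted G (state G \<alpha>)" "continuous_adapted G (state G \<beta>)"
    "continuous_adapted G (state G \<gamma>)" "continuous_adapted G (state G \<delta>)"
    using solves_state[OF X] solves_state[OF Y] solves_state[OF V] solves_state[OF W] by (auto simp: solves_def)
  note tm = total_cost_measurable[OF \<alpha> cs(1) \<mu>] total_cost_measurable[OF \<beta> cs(2) \<nu>]
    total_cost_measurable[OF \<gamma> cs(3) \<nu>] total_cost_measurable[OF \<delta> cs(4) \<mu>]
  note wd = cost_well_defined[OF \<alpha> \<mu>] cost_well_defined[OF \<beta> \<nu>] cost_well_defined[OF \<gamma> \<nu>] cost_well_defined[OF \<delta> \<mu>]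
  note wd1 = wd[unfolded expected_cost_defined_def, THEN conjunct1]
  note wd2 = wd[unfolded expected_cost_defined_def, THEN conjunct2]
  have le_pi: "\<mu> (horizon G) \<le>st \<nu> (horizon G)" "AE t in time_leb G. \<mu> t \<le>st \<nu> t"
    using le horizon_pos by (auto simp: flow_le_def AE_time_pi_iff)
  have time: "AE t in time_leb G. t \<in> time_set G"
    by (rule AE_I2) (simp add: space_restrict_space)
  have path: "AE \<omega> in pspace G. \<bar>total_cost G \<alpha> \<mu> \<omega>\<bar> \<noteq> \<infinity> \<longrightarrow> \<bar>total_cost G \<beta> \<nu> \<omega>\<bar> \<noteq> \<infinity> \<longrightarrow>
      - \<infinity> < total_cost G \<gamma> \<nu> \<omega> \<longrightarrow> - \<infinity> < total_cost G \<delta> \<mu> \<omega> \<longrightarrow>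
      total_cost G \<gamma> \<nu> \<omega> + total_cost G \<delta> \<mu> \<omega> \<le> total_cost G \<alpha> \<mu> \<omega> + total_cost G \<beta> \<nu> \<omega>"
    using submodular_pathwise[OF B] wd1
      solves_unique[OF \<alpha> solves_state[OF X] X] solves_unique[OF \<beta> solves_state[OF Y] Y]
      solves_unique[OF \<gamma> solves_state[OF V] V] solves_unique[OF \<delta> solves_state[OF W] W] AE_space
  proof eventually_elim
    case (elim \<omega>)
    note st = elim(6-9)
    have f: "AE t in time_leb G. submodular (cost_f G \<omega> t)" and g: "submodular (cost_g G \<omega>)" using elim(1) by auto
    define T where "T = horizon G"
    have T: "T \<in> time_set G" using endpoints_in_time_set by (simp add: T_def)
    show ?case
    proof (intro impI)
      assume tc: "\<bar>total_cost G \<alpha> \<mu> \<omega>\<bar> \<noteq> \<infinity>" "\<bar>total_cost G \<beta> \<nu> \<omega>\<bar> \<noteq> \<infinity>"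
        "- \<infinity> < total_cost G \<gamma> \<nu> \<omega>" "- \<infinity> < total_cost G \<delta> \<mu> \<omega>"
      have aux1: "\<bar>i\<bar> \<noteq> \<infinity>" if "\<bar>i + ereal k\<bar> \<noteq> \<infinity>" for i k using that by (cases i) auto
      have aux2: "- \<infinity> < i" if "- \<infinity> < i + ereal k" for i k using that by (cases i) auto
      note ti = aux1[OF tc(1)[unfolded total_cost_def]] aux1[OF tc(2)[unfolded total_cost_def]]
        aux2[OF tc(3)[unfolded total_cost_def]] aux2[OF tc(4)[unfolded total_cost_def]]
      have ineq: "AE t in time_leb G. running_cost G \<gamma> \<nu> \<omega> t + running_cost G \<delta> \<mu> \<omega> t
          \<le> running_cost G \<alpha> \<mu> \<omega> t + running_cost G \<beta> \<nu> \<omega> t"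
        using f le_pi(2) time
      proof eventually_elim
        case (elim t)
        have P: "\<mu> t \<in> prob_measures" "\<nu> t \<in> prob_measures"
          by (rule flow_in_prob_measures[OF \<mu> elim(3)] flow_in_prob_measures[OF \<nu> elim(3)])+
        have s: "state G \<alpha> t \<omega> = X t \<omega>" "state G \<beta> t \<omega> = Y t \<omega>" "state G \<gamma> t \<omega> = max (X t \<omega>) (Y t \<omega>)"
          "state G \<delta> t \<omega> = min (X t \<omega>) (Y t \<omega>)"
          using st elim(3) by auto
        have sub: "cost_f G \<omega> t (X t \<omega>) (\<nu> t) - cost_f G \<omega> t (Y t \<omega>) (\<nu> t)
            \<le> cost_f G \<omega> t (X t \<omega>) (\<mu> t) - cost_f G \<omega> t (Y t \<omega>) (\<mu> t)" if "Y t \<omega> < X t \<omega>"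
          using elim(1)[unfolded submodular_def, rule_format, OF P(1) P(2) less_imp_le[OF that] elim(2)] .
        show ?case
          unfolding running_cost_def s
          using sub by (auto simp: \<gamma>_def \<delta>_def glue_def max_def min_def)
      qed
      note rm = running_cost_time_measurable[OF \<alpha> cs(1) \<mu> elim(10)] running_cost_time_measurable[OF \<beta> cs(2) \<nu> elim(10)]
        running_cost_time_measurable[OF \<gamma> cs(3) \<nu> elim(10)] running_cost_time_measurable[OF \<delta> cs(4) \<mu> elim(10)]
      have ineq': "AE t in time_leb G. \<bar>running_cost G \<alpha> \<mu> \<omega> t\<bar> \<noteq> \<infinity> \<longrightarrow> \<bar>running_cost G \<beta> \<nu> \<omega> t\<bar> \<noteq> \<infinity> \<longrightarrow>
          - \<infinity> < running_cost G \<gamma> \<nu> \<omega> t \<longrightarrow> - \<infinity> < running_cost G \<delta> \<mu> \<omega> t \<longrightarrow>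
          running_cost G \<gamma> \<nu> \<omega> t + running_cost G \<delta> \<mu> \<omega> t \<le> running_cost G \<alpha> \<mu> \<omega> t + running_cost G \<beta> \<nu> \<omega> t"
        using ineq by eventually_elim simp
      note ex = ereal_integral_exchange[OF rm elim(2-5) ti ineq']
      have P: "\<mu> T \<in> prob_measures" "\<nu> T \<in> prob_measures"
        by (rule flow_in_prob_measures[OF \<mu> T] flow_in_prob_measures[OF \<nu> T])+
      have s: "state G \<alpha> T \<omega> = X T \<omega>" "state G \<beta> T \<omega> = Y T \<omega>" "state G \<gamma> T \<omega> = max (X T \<omega>) (Y T \<omega>)"
        "state G \<delta> T \<omega> = min (X T \<omega>) (Y T \<omega>)"
        using st T by auto
      have sub: "cost_g G \<omega> (X T \<omega>) (\<nu> T) - cost_g G \<omega> (Y T \<omega>) (\<nu> T)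
          \<le> cost_g G \<omega> (X T \<omega>) (\<mu> T) - cost_g G \<omega> (Y T \<omega>) (\<mu> T)" if "Y T \<omega> < X T \<omega>"
        using g[unfolded submodular_def, rule_format, OF P(1) P(2) less_imp_le[OF that] le_pi(1)[folded T_def]] .
      have gle: "cost_g G \<omega> (state G \<gamma> T \<omega>) (\<nu> T) + cost_g G \<omega> (state G \<delta> T \<omega>) (\<mu> T)
          \<le> cost_g G \<omega> (state G \<alpha> T \<omega>) (\<mu> T) + cost_g G \<omega> (state G \<beta> T \<omega>) (\<nu> T)"
        unfolding s using sub by (auto simp: max_def min_def)
      obtain a b c d where abcd:
        "ereal_integral (time_leb G) (running_cost G \<alpha> \<mu> \<omega>) = ereal a"
        "ereal_integral (time_leb G) (running_cost G \<beta> \<nu> \<omega>) = ereal b"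
        "ereal_integral (time_leb G) (running_cost G \<gamma> \<nu> \<omega>) = ereal c"
        "ereal_integral (time_leb G) (running_cost G \<delta> \<mu> \<omega>) = ereal d"
        using ti(1,2) ex(1,2) by (metis abs_neq_infinity_cases)
      have "c + d \<le> a + b" using ex(3) by (simp add: abcd)
      then show "total_cost G \<gamma> \<nu> \<omega> + total_cost G \<delta> \<mu> \<omega> \<le> total_cost G \<alpha> \<mu> \<omega> + total_cost G \<beta> \<nu> \<omega>"
        using gle by (simp add: total_cost_def abcd T_def)
    qed
  qed
  note * = ereal_integral_exchange[OF tm wd2 fin[unfolded expected_cost_def]
      bdd[folded \<gamma>_def \<delta>_def, unfolded expected_cost_def] path]
  show "\<bar>expected_cost G (glue X Y \<alpha> \<beta>) \<nu>\<bar> \<noteq> \<infinity>" "\<bar>expected_cost G (glue X Y \<beta> \<alpha>) \<mu>\<bar> \<noteq> \<infinity>"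
    "expected_cost G (glue X Y \<alpha> \<beta>) \<nu> + expected_cost G (glue X Y \<beta> \<alpha>) \<mu> \<le> expected_cost G \<alpha> \<mu> + expected_cost G \<beta> \<nu>"
    using * unfolding expected_cost_def \<gamma>_def \<delta>_def by auto
qed

text \<open>If both optimal costs are finite, the exchange inequality shows that the control of the minimum
  is also optimal for \<open>\<mu>\<close>, so the minimum is \<open>X\<close>. If one optimal cost is \<open>\<infinity>\<close>, every
  control is optimal for the flow in question; then uniqueness identifies \<open>X\<close> with \<open>Y\<close>.\<close>

lemma optimal_states_mono:
  assumes unique: "\<And>\<mu> X \<alpha> Y \<beta>. \<lbrakk>\<mu> \<in> flows G; optimal_pair G \<mu> X \<alpha>; optimal_pair G \<mu> Y \<beta>\<rbrakk> \<Longrightarrow> indistinguishable G X Y"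
    and B: "AE (\<omega>, t) in prob_time G. submodular (cost_f G \<omega> t) \<and> submodular (cost_g G \<omega>)"
    and \<mu>: "\<mu> \<in> flows G" and \<nu>: "\<nu> \<in> flows G" and le: "flow_le G \<mu> \<nu>"
    and X: "optimal_pair G \<mu> X \<alpha>" and Y: "optimal_pair G \<nu> Y \<beta>"
  shows "AE \<omega> in pspace G. \<forall>t\<in>time_set G. X t \<omega> \<le> Y t \<omega>"
proof -
  have \<alpha>: "\<alpha> \<in> controls G" "solves G \<alpha> X" "- \<infinity> < expected_cost G \<alpha> \<mu>"
    "\<And>\<gamma>. \<gamma> \<in> controls G \<Longrightarrow> expected_cost G \<alpha> \<mu> \<le> expected_cost G \<gamma> \<mu>"
    using X by (auto simp: optimal_pair_def)
  have \<beta>: "\<beta> \<in> controls G" "solves G \<beta> Y" "- \<infinity> < expected_cost G \<beta> \<nu>"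
    "\<And>\<gamma>. \<gamma> \<in> controls G \<Longrightarrow> expected_cost G \<beta> \<nu> \<le> expected_cost G \<gamma> \<nu>"
    using Y by (auto simp: optimal_pair_def)
  have equal: ?thesis if "indistinguishable G X Y"
    using that unfolding indistinguishable_def by eventually_elim simp
  show ?thesis
  proof (cases "expected_cost G \<alpha> \<mu> = \<infinity> \<or> expected_cost G \<beta> \<nu> = \<infinity>")
    case True
    then show ?thesis
    proof
      assume inf: "expected_cost G \<alpha> \<mu> = \<infinity>"
      then have "expected_cost G \<gamma> \<mu> = \<infinity>" if "\<gamma> \<in> controls G" for \<gamma> using \<alpha>(4)[OF that] by simp
      then have "optimal_pair G \<mu> Y \<beta>" using \<beta> by (simp add: optimal_pair_def)
      then show ?thesis by (intro equal unique[OF \<mu> X])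
    next
      assume inf: "expected_cost G \<beta> \<nu> = \<infinity>"
      then have "expected_cost G \<gamma> \<nu> = \<infinity>" if "\<gamma> \<in> controls G" for \<gamma> using \<beta>(4)[OF that] by simp
      then have "optimal_pair G \<nu> X \<alpha>" using \<alpha> by (simp add: optimal_pair_def)
      then show ?thesis by (intro equal unique[OF \<nu> _ Y])
    qed
  next
    case False
    then have fin: "\<bar>expected_cost G \<alpha> \<mu>\<bar> \<noteq> \<infinity>" "\<bar>expected_cost G \<beta> \<nu>\<bar> \<noteq> \<infinity>" using \<alpha>(3) \<beta>(3) by auto
    have XY: "continuous_adapted G X" "continuous_adapted G Y" using \<alpha>(2) \<beta>(2) by (auto simp: solves_def)
    have \<gamma>: "glue X Y \<alpha> \<beta> \<in> controls G" and \<delta>: "glue X Y \<beta> \<alpha> \<in> controls G"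
      using glue_in_controls XY \<alpha>(1) \<beta>(1) by auto
    have J: "expected_cost G \<beta> \<nu> \<le> expected_cost G (glue X Y \<alpha> \<beta>) \<nu>" "expected_cost G \<alpha> \<mu> \<le> expected_cost G (glue X Y \<beta> \<alpha>) \<mu>"
      by (rule \<beta>(4)[OF \<gamma>] \<alpha>(4)[OF \<delta>])+
    have bdd: "- \<infinity> < expected_cost G (glue X Y \<alpha> \<beta>) \<nu>" "- \<infinity> < expected_cost G (glue X Y \<beta> \<alpha>) \<mu>"
      using J \<alpha>(3) \<beta>(3) by (auto intro: less_le_trans)
    note ex = expected_cost_exchange[OF \<alpha>(1) \<beta>(1) \<alpha>(2) \<beta>(2) \<mu> \<nu> le B fin bdd]
    obtain a b c d where abcd: "expected_cost G \<alpha> \<mu> = ereal a" "expected_cost G \<beta> \<nu> = ereal b"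
      "expected_cost G (glue X Y \<alpha> \<beta>) \<nu> = ereal c" "expected_cost G (glue X Y \<beta> \<alpha>) \<mu> = ereal d"
      using fin ex(1,2) by (metis abs_neq_infinity_cases)
    have "expected_cost G (glue X Y \<beta> \<alpha>) \<mu> \<le> expected_cost G \<alpha> \<mu>"
      using ex(3) J by (simp add: abcd)
    then have "optimal_pair G \<mu> (\<lambda>t \<omega>. min (X t \<omega>) (Y t \<omega>)) (glue X Y \<beta> \<alpha>)"
      using \<delta> solves_max_min(2)[OF \<alpha>(2) \<beta>(2)] bdd(2) \<alpha>(4)
      by (auto simp: optimal_pair_def intro: order_trans)
    from unique[OF \<mu> X this] show ?thesis
      unfolding indistinguishable_def by eventually_elim (auto simp: min_def split: if_splits)
  qed
qed

end


section \<open>The best-response map\<close>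

lemma st_le_distr:
  assumes "prob_space N" "X \<in> borel_measurable N" "Y \<in> borel_measurable N" and le: "AE \<omega> in N. X \<omega> \<le> (Y \<omega> :: real)"
  shows "distr N borel X \<le>st distr N borel Y"
  unfolding st_le_def cdf_def
proof
  interpret prob_space N by fact
  note [measurable] = assms(2,3)
  fix s :: real
  show "measure (distr N borel Y) {..s} \<le> measure (distr N borel X) {..s}"
    unfolding measure_distr[OF assms(2) atMost_borel] measure_distr[OF assms(3) atMost_borel]
    by (rule finite_measure_mono_AE) (use le in \<open>eventually_elim, auto\<close>, measurable)
qed

lemma abs_tail_bound:
  fixes Z :: "'b \<Rightarrow> real"
  assumes "prob_space N" and [measurable]: "Z \<in> borel_measurable N"
    and \<psi>: "strict_mono_on {0..} \<psi>" and bound: "(\<integral>\<^sup>+ \<omega>. ennreal (\<psi> \<bar>Z \<omega>\<bar>) \<partial>N) \<le> ennreal M"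
    and a: "0 \<le> a" "0 < \<psi> a" and M: "0 \<le> M"
  shows "measure N {\<omega> \<in> space N. a \<le> \<bar>Z \<omega>\<bar>} \<le> M / \<psi> a"
proof -
  interpret prob_space N by fact
  let ?A = "{\<omega> \<in> space N. a \<le> \<bar>Z \<omega>\<bar>}"
  have A: "?A \<in> sets N" by measurable
  have "ennreal (\<psi> a * measure N ?A) = ennreal (\<psi> a) * emeasure N ?A"
    using a by (simp add: emeasure_eq_measure ennreal_mult)
  also have "\<dots> = (\<integral>\<^sup>+ \<omega>. ennreal (\<psi> a) * indicator ?A \<omega> \<partial>N)"
    by (rule nn_integral_cmult_indicator[OF A, symmetric])
  also have "\<dots> \<le> (\<integral>\<^sup>+ \<omega>. ennreal (\<psi> \<bar>Z \<omega>\<bar>) \<partial>N)"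
  proof (rule nn_integral_mono)
    fix \<omega>
    have "\<psi> a \<le> \<psi> \<bar>Z \<omega>\<bar>" if "a \<le> \<bar>Z \<omega>\<bar>" using strict_mono_on_leD[OF \<psi> _ _ that] a by simp
    then show "ennreal (\<psi> a) * indicator ?A \<omega> \<le> ennreal (\<psi> \<bar>Z \<omega>\<bar>)"
      by (auto simp: indicator_def intro: ennreal_leI)
  qed
  also have "\<dots> \<le> ennreal M" by (rule bound)
  finally have "\<psi> a * measure N ?A \<le> M" using M by (simp add: ennreal_le_iff)
  then show ?thesis using a by (simp add: pos_le_divide_eq mult.commute)
qed

text \<open>Both bounds are Markov's inequality for \<open>\<psi> \<bar>Z\<bar>\<close>, applied to the lower and to the upper tail.\<close>

lemma law_between_mu_Min_mu_Max:
  fixes Z :: "'b \<Rightarrow> real"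
  assumes "prob_space N" and Z[measurable]: "Z \<in> borel_measurable N"
    and \<psi>: "continuous_on {0..} \<psi>" "strict_mono_on {0..} \<psi>" "filterlim \<psi> at_top at_top"
    and M: "0 < M" "\<psi> 0 < M"
    and bound: "(\<integral>\<^sup>+ \<omega>. ennreal (\<psi> \<bar>Z \<omega>\<bar>) \<partial>N) \<le> ennreal M"
  shows "mu_Min \<psi> M \<le>st distr N borel Z" "distr N borel Z \<le>st mu_Max \<psi> M"
proof -
  interpret prob_space N by fact
  have c: "cdf (distr N borel Z) s = measure N {\<omega> \<in> space N. Z \<omega> \<le> s}" for s
    unfolding cdf_def by (subst measure_distr[OF Z]) (auto intro: arg_cong[of _ _ "measure N"])
  have tail: "measure N {\<omega> \<in> space N. a \<le> \<bar>Z \<omega>\<bar>} \<le> M / max M (\<psi> a)" if "0 \<le> a" for a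
  proof (cases "\<psi> a \<le> M")
    case True
    then show ?thesis using M by (simp add: max_def)
  next
    case False
    then show ?thesis using abs_tail_bound[OF assms(1) Z \<psi>(2) bound that] M by (simp add: max_def)
  qed
  show "mu_Min \<psi> M \<le>st distr N borel Z"
    unfolding st_le_def
  proof
    fix s
    show "cdf (distr N borel Z) s \<le> cdf (mu_Min \<psi> M) s"
    proof (cases "s \<le> 0")
      case True
      have "cdf (distr N borel Z) s \<le> measure N {\<omega> \<in> space N. - s \<le> \<bar>Z \<omega>\<bar>}"
        unfolding c by (rule finite_measure_mono) auto
      also have "\<dots> \<le> M / max M (\<psi> (- s))" by (rule tail) (use True in simp)
      finally show ?thesis using True by (simp add: cdf_mu_Min[OF \<psi> M] max_def)
    next
      case False
      then have "cdf (mu_Min \<psi> M) s = 1" using M by (simp add: cdf_mu_Min[OF \<psi> M] max_def)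
      then show ?thesis by (simp add: c)
    qed
  qed
  show "distr N borel Z \<le>st mu_Max \<psi> M"
    unfolding st_le_def
  proof
    fix s
    show "cdf (mu_Max \<psi> M) s \<le> cdf (distr N borel Z) s"
    proof (cases "s < 0")
      case True
      then have "cdf (mu_Max \<psi> M) s = 0" using M by (simp add: cdf_mu_Max[OF \<psi> M] max_def)
      then show ?thesis by (simp add: c)
    next
      case False
      have "1 - measure N {\<omega> \<in> space N. Z \<omega> \<le> s} = measure N (space N - {\<omega> \<in> space N. Z \<omega> \<le> s})"
        by (rule prob_compl[symmetric]) measurable
      also have "\<dots> \<le> measure N {\<omega> \<in> space N. s \<le> \<bar>Z \<omega>\<bar>}"
        by (rule finite_measure_mono) auto
      also have "\<dots> \<le> M / max M (\<psi> s)" by (rule tail) (use False in simp)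
      finally show ?thesis using False by (simp add: cdf_mu_Max[OF \<psi> M] c)
    qed
  qed
qed

abbreviation response_flow :: "'a mfg \<Rightarrow> (real \<Rightarrow> real measure) \<Rightarrow> real \<Rightarrow> real measure"
  where "response_flow G \<mu> \<equiv> \<lambda>t. distr (pspace G) borel (opt_state G \<mu> t)"

theorem theorem2p13:
  fixes G :: "'a mfg" and \<psi> :: "real \<Rightarrow> real" and M :: real
  assumes "mean_field_game G"
    and A1_existence: "\<And>\<mu>. \<mu> \<in> flows G \<Longrightarrow> \<exists>X \<alpha>. optimal_pair G \<mu> X \<alpha>"
    and A1_uniqueness: "\<And>\<mu> X \<alpha> Y \<beta>. \<lbrakk>\<mu> \<in> flows G; optimal_pair G \<mu> X \<alpha>; optimal_pair G \<mu> Y \<beta>\<rbrakk> \<Longrightarrow>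
      indistinguishable G X Y \<and> (AE (\<omega>, t) in prob_time G. \<alpha> t \<omega> = \<beta> t \<omega>)"
    and A2_psi: "continuous_on {0..} \<psi>" "strict_mono_on {0..} \<psi>" "\<And>s. 0 \<le> s \<Longrightarrow> 0 \<le> \<psi> s"
      "filterlim \<psi> at_top at_top"
    and A2_M: "\<psi> 0 < M"
    and A2_bound: "\<And>\<mu> t. \<lbrakk>\<mu> \<in> flows G; t \<in> time_set G\<rbrakk> \<Longrightarrow>
      (\<integral>\<^sup>+ \<omega>. ennreal (\<psi> \<bar>opt_state G \<mu> t \<omega>\<bar>) \<partial>pspace G) \<le> ennreal M"
    and B: "AE (\<omega>, t) in prob_time G. submodular (cost_f G \<omega> t) \<and> submodular (cost_g G \<omega>)"
  shows "mfg_solutions G \<psi> M \<noteq> {} \<and>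
    complete_lattice (mfg_solution_order G \<psi> M) \<and>
    (\<exists>m. least (mfg_solution_order G \<psi> M) m (mfg_solutions G \<psi> M)) \<and>
    (\<exists>m. greatest (mfg_solution_order G \<psi> M) m (mfg_solutions G \<psi> M))"
proof -
  interpret mean_field_game G by fact
  note \<psi> = A2_psi(1,2,4)
  have M: "0 < M" "\<psi> 0 < M" using A2_psi(3)[of 0] A2_M by auto
  let ?L = "flow_order G \<psi> M"
  let ?S = "admissible_flows G \<psi> M"
  have init: "init G \<in> borel_measurable (pspace G)"
    by (rule measurable_filt_pspace[OF init_measurable endpoints_in_time_set(2)])
  interpret L: complete_lattice ?L
    by (rule complete_lattice_flow_order[OF is_prob_space horizon_pos init mu_Min_in_prob_measures[OF \<psi> M]
          mu_Max_in_prob_measures[OF \<psi> M] mu_Min_le_mu_Max[OF \<psi> M]])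
  have opt: "\<exists>\<alpha>. optimal_pair G \<mu> (opt_state G \<mu>) \<alpha>" if "\<mu> \<in> flows G" for \<mu>
    unfolding opt_state_def by (rule someI_ex[OF A1_existence[OF that]])
  have opt_ca: "continuous_adapted G (opt_state G \<mu>)" and opt_init: "AE \<omega> in pspace G. opt_state G \<mu> 0 \<omega> = init G \<omega>"
    if "\<mu> \<in> flows G" for \<mu>
    using opt[OF that] by (auto simp: optimal_pair_def solves_def)
  have opt_meas: "opt_state G \<mu> t \<in> borel_measurable (pspace G)" if "\<mu> \<in> flows G" "t \<in> time_set G" for \<mu> t
    using opt_ca[OF that(1)] that(2) measurable_filt_pspace unfolding continuous_adapted_def by blast
  have R_flow: "response_flow G \<mu> \<in> flows G" if \<mu>: "\<mu> \<in> flows G" for \<mu>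
    unfolding flows_def
    by (rule measurable_law_of_continuous_process[OF is_prob_space opt_meas[OF \<mu>]])
       (use opt_ca[OF \<mu>] in \<open>auto simp: continuous_adapted_def\<close>)
  have R_S: "response_flow G \<mu> \<in> ?S" if \<mu>: "\<mu> \<in> flows G" for \<mu>
  proof -
    have "response_flow G \<mu> 0 = distr (pspace G) borel (init G)"
      by (rule distr_cong_AE[OF refl refl opt_init[OF \<mu>] opt_meas[OF \<mu> endpoints_in_time_set(2)] init])
    moreover have "AE t in time_pi G. 0 < t \<longrightarrow> mu_Min \<psi> M \<le>st response_flow G \<mu> t \<and> response_flow G \<mu> t \<le>st mu_Max \<psi> M"
      using AE_time_pi_in_time_set
    proof eventually_elim
      case (elim t)
      show ?case
        using law_between_mu_Min_mu_Max[OF is_prob_space opt_meas[OF \<mu> elim] \<psi> M A2_bound[OF \<mu> elim]] by simp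
    qed
    ultimately show ?thesis using R_flow[OF \<mu>] by (simp add: admissible_flows_def)
  qed
  have R_mono: "flow_le G (response_flow G \<mu>) (response_flow G \<nu>)"
    if \<mu>: "\<mu> \<in> flows G" and \<nu>: "\<nu> \<in> flows G" and le: "flow_le G \<mu> \<nu>" for \<mu> \<nu>
  proof -
    obtain \<alpha> \<beta> where "optimal_pair G \<mu> (opt_state G \<mu>) \<alpha>" "optimal_pair G \<nu> (opt_state G \<nu>) \<beta>"
      using opt[OF \<mu>] opt[OF \<nu>] by blast
    from optimal_states_mono[OF A1_uniqueness[THEN conjunct1] B \<mu> \<nu> le this]
    have le: "AE \<omega> in pspace G. \<forall>t\<in>time_set G. opt_state G \<mu> t \<omega> \<le> opt_state G \<nu> t \<omega>" .
    show ?thesis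
      unfolding flow_le_def using AE_time_pi_in_time_set
    proof eventually_elim
      case (elim t)
      show ?case
        by (rule st_le_distr[OF is_prob_space opt_meas[OF \<mu> elim] opt_meas[OF \<nu> elim]])
           (use le in eventually_elim, use elim in blast)
    qed
  qed
  have adm: "\<mu> \<in> flows G" if "\<mu> \<in> ?S" for \<mu>
    using that by (simp add: admissible_flows_def)
  \<comment> \<open>Equivalent flows lie below each other, so monotonicity also shows that
    the response does not depend on the representative.\<close>
  have R_class: "best_response G (flow_eq G `` {\<mu>}) = flow_eq G `` {response_flow G \<mu>}" if \<mu>: "\<mu> \<in> flows G" for \<mu>
  proof -
    have "flow_eq G `` {response_flow G \<nu>} = flow_eq G `` {response_flow G \<mu>}" if "\<nu> \<in> flow_eq G `` {\<mu>}" for \<nu>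
    proof (rule equiv_class_eq[OF equiv_flow_eq])
      show "(response_flow G \<nu>, response_flow G \<mu>) \<in> flow_eq G"
        using that R_flow R_mono by (simp add: flow_eq_iff_flow_le)
    qed
    moreover have "\<mu> \<in> flow_eq G `` {\<mu>}" using \<mu> by (simp add: flow_eq_iff_flow_le flow_le_refl)
    ultimately show ?thesis unfolding best_response_def by blast
  qed
  have maps: "best_response G \<in> carrier ?L \<rightarrow> carrier ?L"
    using R_S by (auto simp: flow_lattice_eq R_class adm)
  have iso: "isotone ?L ?L (best_response G)"
  proof (rule isotoneI)
    fix x y assume "x \<in> carrier ?L" "y \<in> carrier ?L" "x \<sqsubseteq>\<^bsub>?L\<^esub> y"
    then show "best_response G x \<sqsubseteq>\<^bsub>?L\<^esub> best_response G y"
      by (auto simp: flow_lattice_eq R_class adm flow_lattice_le_classes R_flow R_mono)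
  qed (rule L.weak_partial_order_axioms)+
  have fpl: "fpl ?L (best_response G) = mfg_solution_order G \<psi> M"
    by (simp add: fps_def mfg_solution_order_def mfg_solutions_def)
  interpret F: weak_complete_lattice "mfg_solution_order G \<psi> M"
    using Knaster_Tarski[OF L.weak_complete_lattice_axioms maps iso] unfolding fpl .
  have carrier: "carrier (mfg_solution_order G \<psi> M) = mfg_solutions G \<psi> M"
    by (simp add: mfg_solution_order_def)
  have complete: "complete_lattice (mfg_solution_order G \<psi> M)"
    using F.sup_exists F.inf_exists
    by (unfold_locales) (auto simp: mfg_solution_order_def)
  obtain m where m: "least (mfg_solution_order G \<psi> M) m (mfg_solutions G \<psi> M)"
    using F.sup_exists[of "{}"] by (auto simp: carrier)
  obtain n where n: "greatest (mfg_solution_order G \<psi> M) n (mfg_solutions G \<psi> M)"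
    using F.inf_exists[of "{}"] by (auto simp: carrier)
  show ?thesis using complete m n by (auto simp: least_def)
qed

end
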